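(* Let $(A,C,\psi)$ be an entwining structure over a field $k$ and $r\ge1$. (1) The maps $inc_1^\bullet:\mathscr C^\bullet(M_r(A),C,\psi)\to\mathscr C^\bullet(A,C,\psi)$ and $tr^\bullet:\mathscr C^\bullet(A,C,\psi)\to\mathscr C^\bullet(M_r(A),C,\psi)$ restrict to the corresponding invariant subcomplexes; that is, we have morphisms $inc_1^\bullet:\mathscr I^\bullet(M_r(A),C,\psi)\to\mathscr I^\bullet(A,C,\psi)$ and $tr^\bullet:\mathscr I^\bullet(A,C,\psi)\to\mathscr I^\bullet(M_r(A),C,\psi)$. (2) The morphisms $inc_1^\bullet:\mathscr I^\bullet(M_r(A),C,\psi)\to\mathscr I^\bullet(A,C,\psi)$ and $tr^\bullet:\mathscr I^\bullet(A,C,\psi)\to\mathscr I^\bullet(M_r(A),C,\psi)$ are homotopy inverses of each other. Hence the invariant subcomplexes $\mathscr I^\bullet(M_r(A),C,\psi)$ and $\mathscr I^\bullet(A,C,\psi)$ are quasi-isomorphic.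
   Context: Let $k$ be a field; $\otimes$ and $Hom$ are over $k$. An entwining structure $(A,C,\psi)$ over $k$ consists of a unital associative $k$-algebra $A$ with product $\theta$, a counital coassociative $k$-coalgebra $C$ (coproduct $\Delta$, counit $\varepsilon$), and a $k$-linear map $\psi:C\otimes A\to A\otimes C$, written $\psi(c\otimes a)=a_\psi\otimes c^\psi$ with summation suppressed, such that: (i) $\psi\circ(id_C\otimes\theta)=(\theta\otimes id_C)\circ(id_A\otimes\psi)\circ(\psi\otimes id_A)$; (ii) $(id_A\otimes\Delta)\circ\psi=(\psi\otimes id_C)\circ(id_C\otimes\psi)\circ(\Delta\otimes id_A)$; (iii) $a_\psi\,\varepsilon(c^\psi)=\varepsilon(c)a$; (iv) $1_\psi\otimes c^\psi=1\otimes c$. Iterating, $a_{1\psi}\otimes\cdots\otimes a_{m\psi}\otimes c^{\psi^m}$ denotes the image of $c\otimes a_1\otimes\cdots\otimes a_m$ under the map $C\otimes A^{\otimes m}\to A^{\otimes m}\otimes C$ that moves $C$ past $a_1$, then $a_2$, ..., then $a_m$ by $\psi$. The Hochschild complex is $\mathscr C^n(A,C,\psi)=Hom(C\otimes A^{\otimes n+1},k)$, $n\ge0$, with $$\delta^n(g)(c,a_1,\dots,a_{n+2})=g(c^\psi,a_2,\dots,a_{n+1},a_{n+2}a_{1\psi})+\sum_{i=1}^{n+1}(-1)^i g(c,a_1,\dots,a_ia_{i+1},\dots,a_{n+2}).$$ The invariant subcomplex $\mathscr I^\bullet(A,C,\psi)\subseteq\mathscr C^\bullet(A,C,\psi)$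 consists in degree $n$ of those $g$ with $g(c\otimes a_1\otimes\cdots\otimes a_{n+1})=g(c^{\psi^{n+1}}\otimes a_{1\psi}\otimes\cdots\otimes a_{n+1\,\psi})$ for all $c\in C$, $a_i\in A$. $M_r(A)=A\otimes M_r(k)$ is the algebra of $r\times r$ matrices over $A$; $E_{ij}(a)$ is the matrix with $(i,j)$ entry $a$ and all others $0$. The entwining extends to $\psi:C\otimes M_r(A)\to M_r(A)\otimes C$, $\psi(c\otimes(a\otimes u))=(a_\psi\otimes u)\otimes c^\psi$, making $(M_r(A),C,\psi)$ an entwining structure. Let $inc_1:A\to M_r(A)$, $a\mapsto E_{11}(a)$, and $inc_1^n(f)=f\circ(id_C\otimes inc_1^{\otimes n+1})$. The generalized trace is $tr:C\otimes M_r(A)^{\otimes n+1}\to C\otimes A^{\otimes n+1}$, $tr(c\otimes a_1u_1\otimes\cdots\otimes a_{n+1}u_{n+1})=tr(u_1\cdots u_{n+1})\,(c\otimes a_1\otimes\cdots\otimes a_{n+1})$ for $a_i\in A$, $u_i\in M_r(k)$, and $tr^n(g)=g\circ tr$. *)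

theory Defs
  imports "HOL-Analysis.Analysis" "HOL-Library.Poly_Mapping" "HOL-Library.Function_Algebras"
begin

section \<open>Tensor products of vector spaces\<close>

text \<open>
  Vector spaces over the field \<open>'k\<close> are types with an explicit scalar multiplication.
  The type \<open>'x \<Rightarrow>\<^sub>0 'k\<close> is the free vector space on \<open>'x\<close>, and \<open>V \<otimes> W\<close> is the quotient of the free
  vector space on \<open>V \<times> W\<close> by the span of the bilinearity relations. Its elements are the cosets,
  so equality in \<open>V \<otimes> W\<close> is equality of sets. A type cannot depend on the scalar multiplications;
  hence the tensor product is a set of cosets and not a type of its own.
\<close>

definition fscale :: "'k::field \<Rightarrow> ('x \<Rightarrow>\<^sub>0 'k) \<Rightarrow> ('x \<Rightarrow>\<^sub>0 'k)"
  where "fscale s t = Poly_Mapping.map ((*) s) t"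

abbreviation basis :: "'x \<Rightarrow> ('x \<Rightarrow>\<^sub>0 'k::field)"
  where "basis x \<equiv> Poly_Mapping.single x 1"

definition lin_ext :: "('k::field \<Rightarrow> 'v::ab_group_add \<Rightarrow> 'v) \<Rightarrow> ('x \<Rightarrow> 'v) \<Rightarrow> ('x \<Rightarrow>\<^sub>0 'k) \<Rightarrow> 'v"
  where "lin_ext s f t = (\<Sum>x\<in>Poly_Mapping.keys t. s (Poly_Mapping.lookup t x) (f x))"

text \<open>The relations saying that \<open>F v\<close> is linear in \<open>v\<close>; here \<open>F\<close> inserts \<open>v\<close> in one tensor slot.\<close>

definition slot_relations ::
  "('k::field \<Rightarrow> 'v::ab_group_add \<Rightarrow> 'v) \<Rightarrow> ('v \<Rightarrow> 'x) \<Rightarrow> ('x \<Rightarrow>\<^sub>0 'k) set"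
  where "slot_relations s F =
    {basis (F (v + w)) - basis (F v) - basis (F w) |v w. True} \<union>
    {basis (F (s k v)) - fscale k (basis (F v)) |k v. True}"

definition tensor_rel ::
  "('k::field \<Rightarrow> 'v::ab_group_add \<Rightarrow> 'v) \<Rightarrow> ('k \<Rightarrow> 'w::ab_group_add \<Rightarrow> 'w) \<Rightarrow> ('v \<times> 'w \<Rightarrow>\<^sub>0 'k) set"
  where "tensor_rel sV sW = module.span fscale
    ((\<Union>w. slot_relations sV (\<lambda>v. (v, w))) \<union> (\<Union>v. slot_relations sW (\<lambda>w. (v, w))))"

definition tensor_rel3 ::
  "('k::field \<Rightarrow> 'u::ab_group_add \<Rightarrow> 'u) \<Rightarrow> ('k \<Rightarrow> 'v::ab_group_add \<Rightarrow> 'v) \<Rightarrow>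
   ('k \<Rightarrow> 'w::ab_group_add \<Rightarrow> 'w) \<Rightarrow> ('u \<times> 'v \<times> 'w \<Rightarrow>\<^sub>0 'k) set"
  where "tensor_rel3 sU sV sW = module.span fscale
    ((\<Union>v w. slot_relations sU (\<lambda>u. (u, v, w))) \<union>
     (\<Union>u w. slot_relations sV (\<lambda>v. (u, v, w))) \<union>
     (\<Union>u v. slot_relations sW (\<lambda>w. (u, v, w))))"

definition coset :: "('x \<Rightarrow>\<^sub>0 'k::field) set \<Rightarrow> ('x \<Rightarrow>\<^sub>0 'k) \<Rightarrow> ('x \<Rightarrow>\<^sub>0 'k) set"
  where "coset R t = {u. u - t \<in> R}"

text \<open>
  Maps out of a tensor product are evaluated on an arbitrary representative
  \<open>\<Sum> v\<^sub>i \<otimes> w\<^sub>i\<close> (Sweedler notation). Below this is only done for maps that are linear in every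
  tensor slot, or followed by passage to a coset, so that the choice does not matter
  (\<open>lin_ext_rep_coset\<close>).
\<close>

definition rep :: "('x \<Rightarrow>\<^sub>0 'k::field) set \<Rightarrow> ('x \<Rightarrow>\<^sub>0 'k)"
  where "rep T = (SOME t. t \<in> T)"

definition linear_into_quotient ::
  "('k::field \<Rightarrow> 'v::ab_group_add \<Rightarrow> 'v) \<Rightarrow> ('x \<Rightarrow>\<^sub>0 'k) set \<Rightarrow> ('v \<Rightarrow> ('x \<Rightarrow>\<^sub>0 'k) set) \<Rightarrow> bool"
  where "linear_into_quotient s R F \<longleftrightarrow>
    (\<forall>v. F v \<in> range (coset R)) \<and>
    (\<forall>v w. F (v + w) = coset R (rep (F v) + rep (F w))) \<and>
    (\<forall>k v. F (s k v) = coset R (fscale k (rep (F v))))"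

lemma lookup_fscale [simp]: "Poly_Mapping.lookup (fscale k t) x = k * Poly_Mapping.lookup t x"
  by (simp add: fscale_def Poly_Mapping.map.rep_eq when_def)

lemma vector_space_fscale: "vector_space (fscale :: 'k::field \<Rightarrow> ('x \<Rightarrow>\<^sub>0 'k) \<Rightarrow> _)"
  by unfold_locales (auto intro!: poly_mapping_eqI simp: lookup_add algebra_simps)

interpretation free_vs: vector_space "fscale :: 'k::field \<Rightarrow> ('x \<Rightarrow>\<^sub>0 'k) \<Rightarrow> _"
  by (rule vector_space_fscale)

context vector_space
begin

lemma lin_ext_superset:
  assumes "finite S" "Poly_Mapping.keys t \<subseteq> S"
  shows "lin_ext scale f t = (\<Sum>x\<in>S. scale (Poly_Mapping.lookup t x) (f x))"
  unfolding lin_ext_def using assms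
  by (intro sum.mono_neutral_left) (auto simp: in_keys_iff)

lemma lin_ext_add: "lin_ext scale f (t + u) = lin_ext scale f t + lin_ext scale f u"
proof -
  let ?S = "Poly_Mapping.keys t \<union> Poly_Mapping.keys u"
  have "Poly_Mapping.keys (t + u) \<subseteq> ?S" by (rule Poly_Mapping.keys_add)
  then show ?thesis
    by (simp add: lin_ext_superset[of ?S] lookup_add scale_left_distrib sum.distrib)
qed

lemma lin_ext_fscale: "lin_ext scale f (fscale k t) = scale k (lin_ext scale f t)"
proof -
  have "Poly_Mapping.keys (fscale k t) \<subseteq> Poly_Mapping.keys t"
    by (auto simp: in_keys_iff)
  then show ?thesis
    by (simp add: lin_ext_superset[of "Poly_Mapping.keys t"] scale_sum_right)
qed

lemma linear_lin_ext: "Vector_Spaces.linear fscale scale (lin_ext scale f)"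
  by unfold_locales (simp_all add: lin_ext_add lin_ext_fscale)

lemma lin_ext_basis: "lin_ext scale f (basis x) = f x"
  by (simp add: lin_ext_def)

lemma lin_ext_diff: "lin_ext scale f (t - u) = lin_ext scale f t - lin_ext scale f u"
proof -
  interpret l: Vector_Spaces.linear fscale scale "lin_ext scale f" by (rule linear_lin_ext)
  show ?thesis by (rule l.diff)
qed

lemma lin_ext_slot_relations:
  assumes "Vector_Spaces.linear sV scale (\<lambda>v. f (F v))" and "t \<in> slot_relations sV F"
  shows "lin_ext scale f t = 0"
proof -
  interpret l: Vector_Spaces.linear sV scale "\<lambda>v. f (F v)" by (rule assms)
  show ?thesis using assms(2)
    by (auto simp: slot_relations_def lin_ext_diff lin_ext_fscale lin_ext_basis l.add l.scale)
qed

lemma lin_ext_span: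
  assumes "t \<in> free_vs.span S" and "\<And>u. u \<in> S \<Longrightarrow> lin_ext scale f u = 0"
  shows "lin_ext scale f t = 0"
  using assms(1)
proof (induction rule: free_vs.span_induct)
  show "free_vs.subspace {t. lin_ext scale f t = 0}"
    by (auto simp: free_vs.subspace_def lin_ext_add lin_ext_fscale lin_ext_def[of _ _ 0])
qed (use assms(2) in auto)

lemma lin_ext_tensor_rel:
  assumes "\<And>w. Vector_Spaces.linear sV scale (\<lambda>v. f (v, w))"
    and "\<And>v. Vector_Spaces.linear sW scale (\<lambda>w. f (v, w))"
    and "t \<in> tensor_rel sV sW"
  shows "lin_ext scale f t = 0"
  using assms(3) unfolding tensor_rel_def
  by (rule lin_ext_span)
    (use lin_ext_slot_relations[of sV f "\<lambda>v. (v, _)"] lin_ext_slot_relations[of sW f "\<lambda>w. (_, w)"]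
      assms(1,2) in auto)

end

lemma rep_coset:
  assumes "free_vs.subspace R"
  shows "rep (coset R t) - t \<in> R"
proof -
  have "t \<in> coset R t" using assms by (simp add: coset_def free_vs.subspace_0)
  then have "rep (coset R t) \<in> coset R t" unfolding rep_def by (rule someI)
  then show ?thesis by (simp add: coset_def)
qed

lemma coset_eq:
  assumes "free_vs.subspace R" and "t - u \<in> R"
  shows "coset R t = coset R u"
proof -
  have "x - t \<in> R \<longleftrightarrow> x - u \<in> R" for x
    using free_vs.subspace_add[OF assms(1), of "x - t" "t - u"]
      free_vs.subspace_diff[OF assms(1), of "x - u" "t - u"] assms(2) by auto
  then show ?thesis by (auto simp: coset_def)
qed

lemma subspace_tensor_rel: "free_vs.subspace (tensor_rel sV sW)"
  by (simp add: tensor_rel_def)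

lemma (in vector_space) lin_ext_rep_coset:
  assumes "\<And>w. Vector_Spaces.linear sV scale (\<lambda>v. f (v, w))"
    and "\<And>v. Vector_Spaces.linear sW scale (\<lambda>w. f (v, w))"
  shows "lin_ext scale f (rep (coset (tensor_rel sV sW) t)) = lin_ext scale f t"
proof -
  have "lin_ext scale f (rep (coset (tensor_rel sV sW) t) - t) = 0"
    using assms rep_coset[OF subspace_tensor_rel] by (rule lin_ext_tensor_rel)
  then show ?thesis by (simp add: lin_ext_diff)
qed


section \<open>Entwining structures\<close>

locale k_algebra = vector_space sA
  for sA :: "'k::field \<Rightarrow> 'a::ab_group_add \<Rightarrow> 'a" +
  fixes mul :: "'a \<Rightarrow> 'a \<Rightarrow> 'a" and one :: 'a
  assumes mul_linear_right: "Vector_Spaces.linear sA sA (\<lambda>b. mul a b)"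
    and mul_linear_left: "Vector_Spaces.linear sA sA (\<lambda>a. mul a b)"
    and mul_assoc: "mul (mul a b) c = mul a (mul b c)"
    and mul_one_left: "mul one a = a"
    and mul_one_right: "mul a one = a"

locale k_coalgebra = vector_space sC
  for sC :: "'k::field \<Rightarrow> 'c::ab_group_add \<Rightarrow> 'c" +
  fixes Delta :: "'c \<Rightarrow> ('c \<times> 'c \<Rightarrow>\<^sub>0 'k) set" and eps :: "'c \<Rightarrow> 'k"
  assumes Delta_linear: "linear_into_quotient sC (tensor_rel sC sC) Delta"
    and eps_linear: "Vector_Spaces.linear sC (*) eps"
    and coassoc:
      "coset (tensor_rel3 sC sC sC)
         (lin_ext fscale (\<lambda>(x, y). lin_ext fscale (\<lambda>(x1, x2). basis (x1, x2, y)) (rep (Delta x)))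
           (rep (Delta c))) =
       coset (tensor_rel3 sC sC sC)
         (lin_ext fscale (\<lambda>(x, y). lin_ext fscale (\<lambda>(y1, y2). basis (x, y1, y2)) (rep (Delta y)))
           (rep (Delta c)))"
    and counit_left: "lin_ext sC (\<lambda>(x, y). sC (eps x) y) (rep (Delta c)) = c"
    and counit_right: "lin_ext sC (\<lambda>(x, y). sC (eps y) x) (rep (Delta c)) = c"

text \<open>
  The linear map \<open>\<psi> : C \<otimes> A \<rightarrow> A \<otimes> C\<close> is given as a bilinear map \<open>C \<times> A \<rightarrow> A \<otimes> C\<close>.
\<close>

locale entwining_structure =
  A: k_algebra sA mul one + C: k_coalgebra sC Delta eps
  for sA :: "'k::field \<Rightarrow> 'a::ab_group_add \<Rightarrow> 'a"
    and mul :: "'a \<Rightarrow> 'a \<Rightarrow> 'a" and one :: 'a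
    and sC :: "'k \<Rightarrow> 'c::ab_group_add \<Rightarrow> 'c"
    and Delta :: "'c \<Rightarrow> ('c \<times> 'c \<Rightarrow>\<^sub>0 'k) set" and eps :: "'c \<Rightarrow> 'k" +
  fixes psi :: "'c \<Rightarrow> 'a \<Rightarrow> ('a \<times> 'c \<Rightarrow>\<^sub>0 'k) set"
  assumes psi_linear_C: "linear_into_quotient sC (tensor_rel sA sC) (\<lambda>c. psi c a)"
    and psi_linear_A: "linear_into_quotient sA (tensor_rel sA sC) (\<lambda>a. psi c a)"
    and psi_mul:
      "psi c (mul a b) = coset (tensor_rel sA sC)
         (lin_ext fscale
           (\<lambda>(a', c'). lin_ext fscale (\<lambda>(b', c''). basis (mul a' b', c'')) (rep (psi c' b)))
           (rep (psi c a)))"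
    and psi_Delta:
      "coset (tensor_rel3 sA sC sC)
         (lin_ext fscale (\<lambda>(a', c'). lin_ext fscale (\<lambda>(x, y). basis (a', x, y)) (rep (Delta c')))
           (rep (psi c a))) =
       coset (tensor_rel3 sA sC sC)
         (lin_ext fscale
           (\<lambda>(x, y). lin_ext fscale
             (\<lambda>(a', y'). lin_ext fscale (\<lambda>(a'', x'). basis (a'', x', y')) (rep (psi x a')))
             (rep (psi y a)))
           (rep (Delta c)))"
    and psi_eps: "lin_ext sA (\<lambda>(a', c'). sA (eps c') a') (rep (psi c a)) = sA (eps c) a"
    and psi_one: "psi c one = coset (tensor_rel sA sC) (basis (one, c))"

text \<open>
  \<open>psi_iter psi c [a\<^sub>1,\<dots>,a\<^sub>m]\<close> represents the image of \<open>c \<otimes> a\<^sub>1 \<otimes> \<dots> \<otimes> a\<^sub>m\<close> in \<open>A\<^sup>\<otimes>\<^sup>m \<otimes> C\<close>; it is only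
  used as an argument of maps that are linear in every tensor slot.
\<close>

primrec psi_iter ::
  "('c \<Rightarrow> 'a \<Rightarrow> ('a \<times> 'c \<Rightarrow>\<^sub>0 'k::field) set) \<Rightarrow> 'c \<Rightarrow> 'a list \<Rightarrow> ('a list \<times> 'c \<Rightarrow>\<^sub>0 'k)"
  where
    "psi_iter psi c [] = basis ([], c)"
  | "psi_iter psi c (a # as) =
       lin_ext fscale
         (\<lambda>(a', c'). lin_ext fscale (\<lambda>(as', c''). basis (a' # as', c'')) (psi_iter psi c' as))
         (rep (psi c a))"


section \<open>Cochain complexes\<close>

record 'x cochains =
  obj :: "nat \<Rightarrow> 'x set"
  diff :: "nat \<Rightarrow> 'x \<Rightarrow> 'x"

definition linear_map_on ::
  "('k::field \<Rightarrow> 'x::ab_group_add \<Rightarrow> 'x) \<Rightarrow> ('k \<Rightarrow> 'y::ab_group_add \<Rightarrow> 'y) \<Rightarrow>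
   'x set \<Rightarrow> 'y set \<Rightarrow> ('x \<Rightarrow> 'y) \<Rightarrow> bool"
  where "linear_map_on s1 s2 V W f \<longleftrightarrow>
    f ` V \<subseteq> W \<and> (\<forall>x\<in>V. \<forall>y\<in>V. f (x + y) = f x + f y) \<and> (\<forall>k. \<forall>x\<in>V. f (s1 k x) = s2 k (f x))"

definition cochain_complex ::
  "('k::field \<Rightarrow> 'x::ab_group_add \<Rightarrow> 'x) \<Rightarrow> 'x cochains \<Rightarrow> bool"
  where "cochain_complex s K \<longleftrightarrow> vector_space s \<and>
    (\<forall>n. module.subspace s (obj K n)) \<and>
    (\<forall>n. linear_map_on s s (obj K n) (obj K (Suc n)) (diff K n)) \<and>
    (\<forall>n. \<forall>x\<in>obj K n. diff K (Suc n) (diff K n x) = 0)"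

definition cochain_map ::
  "('k::field \<Rightarrow> 'x::ab_group_add \<Rightarrow> 'x) \<Rightarrow> ('k \<Rightarrow> 'y::ab_group_add \<Rightarrow> 'y) \<Rightarrow>
   'x cochains \<Rightarrow> 'y cochains \<Rightarrow> (nat \<Rightarrow> 'x \<Rightarrow> 'y) \<Rightarrow> bool"
  where "cochain_map s1 s2 K L f \<longleftrightarrow> cochain_complex s1 K \<and> cochain_complex s2 L \<and>
    (\<forall>n. linear_map_on s1 s2 (obj K n) (obj L n) (f n)) \<and>
    (\<forall>n. \<forall>x\<in>obj K n. f (Suc n) (diff K n x) = diff L n (f n x))"

text \<open>A homotopy is indexed by its target degree: \<open>h n\<close> maps degree \<open>n + 1\<close> to degree \<open>n\<close>.\<close>

definition cochain_homotopic ::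
  "('k::field \<Rightarrow> 'x::ab_group_add \<Rightarrow> 'x) \<Rightarrow> ('k \<Rightarrow> 'y::ab_group_add \<Rightarrow> 'y) \<Rightarrow>
   'x cochains \<Rightarrow> 'y cochains \<Rightarrow> (nat \<Rightarrow> 'x \<Rightarrow> 'y) \<Rightarrow> (nat \<Rightarrow> 'x \<Rightarrow> 'y) \<Rightarrow> bool"
  where "cochain_homotopic s1 s2 K L f g \<longleftrightarrow>
    cochain_map s1 s2 K L f \<and> cochain_map s1 s2 K L g \<and>
    (\<exists>h. (\<forall>n. linear_map_on s1 s2 (obj K (Suc n)) (obj L n) (h n)) \<and>
      (\<forall>x\<in>obj K 0. f 0 x - g 0 x = h 0 (diff K 0 x)) \<and>
      (\<forall>n. \<forall>x\<in>obj K (Suc n).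
        f (Suc n) x - g (Suc n) x = h (Suc n) (diff K (Suc n) x) + diff L n (h n x)))"

definition homotopy_inverses ::
  "('k::field \<Rightarrow> 'x::ab_group_add \<Rightarrow> 'x) \<Rightarrow> ('k \<Rightarrow> 'y::ab_group_add \<Rightarrow> 'y) \<Rightarrow>
   'x cochains \<Rightarrow> 'y cochains \<Rightarrow> (nat \<Rightarrow> 'x \<Rightarrow> 'y) \<Rightarrow> (nat \<Rightarrow> 'y \<Rightarrow> 'x) \<Rightarrow> bool"
  where "homotopy_inverses s1 s2 K L f g \<longleftrightarrow>
    cochain_map s1 s2 K L f \<and> cochain_map s2 s1 L K g \<and>
    cochain_homotopic s1 s1 K K (\<lambda>n. g n \<circ> f n) (\<lambda>n. id) \<and>
    cochain_homotopic s2 s2 L L (\<lambda>n. f n \<circ> g n) (\<lambda>n. id)"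

definition cocycles :: "'x::ab_group_add cochains \<Rightarrow> nat \<Rightarrow> 'x set"
  where "cocycles K n = {x \<in> obj K n. diff K n x = 0}"

definition coboundaries :: "'x::ab_group_add cochains \<Rightarrow> nat \<Rightarrow> 'x set"
  where "coboundaries K n = (case n of 0 \<Rightarrow> {0} | Suc m \<Rightarrow> diff K m ` obj K m)"

definition cohomologous :: "'x::ab_group_add cochains \<Rightarrow> nat \<Rightarrow> ('x \<times> 'x) set"
  where "cohomologous K n =
    {(x, y). x \<in> cocycles K n \<and> y \<in> cocycles K n \<and> x - y \<in> coboundaries K n}"

definition cohomology :: "'x::ab_group_add cochains \<Rightarrow> nat \<Rightarrow> 'x set set"
  where "cohomology K n = cocycles K n // cohomologous K n"

definition cohomology_map ::
  "'y::ab_group_add cochains \<Rightarrow> (nat \<Rightarrow> 'x \<Rightarrow> 'y) \<Rightarrow> nat \<Rightarrow> 'x set \<Rightarrow> 'y set"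
  where "cohomology_map L f n X = cohomologous L n `` (f n ` X)"

definition quasi_isomorphism ::
  "('k::field \<Rightarrow> 'x::ab_group_add \<Rightarrow> 'x) \<Rightarrow> ('k \<Rightarrow> 'y::ab_group_add \<Rightarrow> 'y) \<Rightarrow>
   'x cochains \<Rightarrow> 'y cochains \<Rightarrow> (nat \<Rightarrow> 'x \<Rightarrow> 'y) \<Rightarrow> bool"
  where "quasi_isomorphism s1 s2 K L f \<longleftrightarrow> cochain_map s1 s2 K L f \<and>
    (\<forall>n. bij_betw (cohomology_map L f n) (cohomology K n) (cohomology L n))"


section \<open>The Hochschild complex and its invariant subcomplex\<close>

text \<open>
  An element of \<open>Hom(C \<otimes> A\<^sup>\<otimes>\<^sup>n\<^sup>+\<^sup>1, k)\<close> is the multilinear map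
  \<open>g c [a\<^sub>1,\<dots>,a\<^sub>n\<^sub>+\<^sub>1]\<close>, extended by \<open>0\<close> to lists of other lengths.
\<close>

type_synonym ('c, 'a, 'k) cochain = "'c \<Rightarrow> 'a list \<Rightarrow> 'k"

definition cscale :: "'k::field \<Rightarrow> ('c, 'a, 'k) cochain \<Rightarrow> ('c, 'a, 'k) cochain"
  where "cscale s g = (\<lambda>c as. s * g c as)"

definition hoch_cochains ::
  "('k::field \<Rightarrow> 'a::ab_group_add \<Rightarrow> 'a) \<Rightarrow> ('k \<Rightarrow> 'c::ab_group_add \<Rightarrow> 'c) \<Rightarrow>
   nat \<Rightarrow> ('c, 'a, 'k) cochain set"
  where "hoch_cochains sA sC n = {g.
    (\<forall>as. Vector_Spaces.linear sC (*) (\<lambda>c. g c as)) \<and>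
    (\<forall>c xs ys. Vector_Spaces.linear sA (*) (\<lambda>a. g c (xs @ a # ys))) \<and>
    (\<forall>c as. length as \<noteq> n + 1 \<longrightarrow> g c as = 0)}"

text \<open>
  The list \<open>as = [a\<^sub>1,\<dots>,a\<^sub>n\<^sub>+\<^sub>2]\<close> is indexed from \<open>0\<close>, that is \<open>a\<^sub>i = as ! (i - 1)\<close>.
\<close>

definition hoch_diff ::
  "('a \<Rightarrow> 'a \<Rightarrow> 'a) \<Rightarrow> ('c \<Rightarrow> 'a \<Rightarrow> ('a \<times> 'c \<Rightarrow>\<^sub>0 'k::field) set) \<Rightarrow>
   nat \<Rightarrow> ('c, 'a, 'k) cochain \<Rightarrow> ('c, 'a, 'k) cochain"
  where "hoch_diff mul psi n g = (\<lambda>c as.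
    if length as = n + 2 then
      lin_ext (*) (\<lambda>(a', c'). g c' (butlast (tl as) @ [mul (last as) a'])) (rep (psi c (hd as))) +
      (\<Sum>i = 1..n + 1. (- 1) ^ i *
        g c (take (i - 1) as @ [mul (as ! (i - 1)) (as ! i)] @ drop (i + 1) as))
    else 0)"

definition hochschild_complex ::
  "('k::field \<Rightarrow> 'a::ab_group_add \<Rightarrow> 'a) \<Rightarrow> ('a \<Rightarrow> 'a \<Rightarrow> 'a) \<Rightarrow>
   ('k \<Rightarrow> 'c::ab_group_add \<Rightarrow> 'c) \<Rightarrow> ('c \<Rightarrow> 'a \<Rightarrow> ('a \<times> 'c \<Rightarrow>\<^sub>0 'k) set) \<Rightarrow>
   ('c, 'a, 'k) cochain cochains"
  where "hochschild_complex sA mul sC psi =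
    \<lparr>obj = hoch_cochains sA sC, diff = hoch_diff mul psi\<rparr>"

definition inv_cochains ::
  "('k::field \<Rightarrow> 'a::ab_group_add \<Rightarrow> 'a) \<Rightarrow> ('k \<Rightarrow> 'c::ab_group_add \<Rightarrow> 'c) \<Rightarrow>
   ('c \<Rightarrow> 'a \<Rightarrow> ('a \<times> 'c \<Rightarrow>\<^sub>0 'k) set) \<Rightarrow> nat \<Rightarrow> ('c, 'a, 'k) cochain set"
  where "inv_cochains sA sC psi n = {g \<in> hoch_cochains sA sC n.
    \<forall>c as. length as = n + 1 \<longrightarrow>
      g c as = lin_ext (*) (\<lambda>(as', c'). g c' as') (psi_iter psi c as)}"

definition invariant_complex ::
  "('k::field \<Rightarrow> 'a::ab_group_add \<Rightarrow> 'a) \<Rightarrow> ('a \<Rightarrow> 'a \<Rightarrow> 'a) \<Rightarrow>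
   ('k \<Rightarrow> 'c::ab_group_add \<Rightarrow> 'c) \<Rightarrow> ('c \<Rightarrow> 'a \<Rightarrow> ('a \<times> 'c \<Rightarrow>\<^sub>0 'k) set) \<Rightarrow>
   ('c, 'a, 'k) cochain cochains"
  where "invariant_complex sA mul sC psi =
    \<lparr>obj = inv_cochains sA sC psi, diff = hoch_diff mul psi\<rparr>"


section \<open>Matrix algebras\<close>

text \<open>
  \<open>M\<^sub>r(A)\<close> is the type \<open>'a^'n^'n\<close> with \<open>r = CARD('n)\<close>. The library product \<open>**\<close> needs the
  class \<open>semiring_1\<close> on the entries, so the product for an explicit multiplication is defined here.
\<close>

definition mat_scale :: "('k \<Rightarrow> 'a \<Rightarrow> 'a) \<Rightarrow> 'k \<Rightarrow> 'a^'n^'n \<Rightarrow> 'a^'n^'n"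
  where "mat_scale sA s X = (\<chi> i j. sA s (X $ i $ j))"

definition mat_mul :: "('a::ab_group_add \<Rightarrow> 'a \<Rightarrow> 'a) \<Rightarrow> 'a^'n^'n \<Rightarrow> 'a^'n^'n \<Rightarrow> 'a^'n^'n"
  where "mat_mul mul X Y = (\<chi> i j. \<Sum>l\<in>UNIV. mul (X $ i $ l) (Y $ l $ j))"

definition Emat :: "'n \<Rightarrow> 'n \<Rightarrow> 'a::zero \<Rightarrow> 'a^'n^'n"
  where "Emat i j a = (\<chi> p q. if p = i \<and> q = j then a else 0)"

text \<open>The decomposable element \<open>a \<otimes> u\<close> of \<open>M\<^sub>r(A) = A \<otimes> M\<^sub>r(k)\<close>.\<close>

definition mat_tensor :: "('k \<Rightarrow> 'a \<Rightarrow> 'a) \<Rightarrow> 'a \<Rightarrow> 'k^'n^'n \<Rightarrow> 'a^'n^'n"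
  where "mat_tensor sA a u = (\<chi> i j. sA (u $ i $ j) a)"

text \<open>
  The next two definitions are the linear extensions of the formulas on decomposables
  \<open>a \<otimes> u\<close>, along the decomposition \<open>X = \<Sum>\<^sub>i\<^sub>j X\<^sub>i\<^sub>j \<otimes> e\<^sub>i\<^sub>j\<close>, where \<open>e\<^sub>i\<^sub>j\<close> are the matrix units of
  \<open>M\<^sub>r(k)\<close>; see \<open>psi_mat_decomposable\<close> and \<open>gen_trace_decomposable\<close>.
\<close>

definition psi_mat ::
  "('k::field \<Rightarrow> 'a::ab_group_add \<Rightarrow> 'a) \<Rightarrow> ('k \<Rightarrow> 'c::ab_group_add \<Rightarrow> 'c) \<Rightarrow>
   ('c \<Rightarrow> 'a \<Rightarrow> ('a \<times> 'c \<Rightarrow>\<^sub>0 'k) set) \<Rightarrow> 'c \<Rightarrow> 'a^'n::finite^'n \<Rightarrow> (('a^'n^'n) \<times> 'c \<Rightarrow>\<^sub>0 'k) set"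
  where "psi_mat sA sC psi c X = coset (tensor_rel (mat_scale sA) sC)
    (\<Sum>i\<in>UNIV. \<Sum>j\<in>UNIV.
      lin_ext fscale (\<lambda>(a', c'). basis (mat_tensor sA a' (Emat i j 1), c')) (rep (psi c (X $ i $ j))))"

definition gen_trace :: "'c \<Rightarrow> ('a^'n::finite^'n) list \<Rightarrow> ('c \<times> 'a list \<Rightarrow>\<^sub>0 'k::field)"
  where "gen_trace c Xs = (\<Sum>ps | length ps = length Xs.
    fscale (trace (foldr (**) (map (\<lambda>(i, j). Emat i j 1) ps) (mat 1)))
      (basis (c, map2 (\<lambda>X (i, j). X $ i $ j) Xs ps)))"

definition tr_map :: "nat \<Rightarrow> ('c, 'a, 'k::field) cochain \<Rightarrow> ('c, 'a^'n::finite^'n, 'k) cochain"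
  where "tr_map n g = (\<lambda>c Xs. lin_ext (*) (\<lambda>(c', as). g c' as) (gen_trace c Xs))"

text \<open>The index called \<open>1\<close> is an arbitrary element \<open>i\<close> of the index type.\<close>

definition inc_map :: "'n \<Rightarrow> nat \<Rightarrow> ('c, 'a::zero^'n::finite^'n, 'k) cochain \<Rightarrow> ('c, 'a, 'k) cochain"
  where "inc_map i n f = (\<lambda>c as. f c (map (Emat i i) as))"


lemma vector_space_mat_scale:
  assumes "vector_space sA"
  shows "vector_space (mat_scale sA)"
proof -
  interpret vector_space sA by (rule assms)
  show ?thesis
    by unfold_locales (simp_all add: mat_scale_def vec_eq_iff scale_right_distrib scale_left_distrib)
qed

lemma lin_ext_tensor_rel_quotient:
  assumes R: "free_vs.subspace R"
    and "\<And>v v' w. f (v + v', w) - f (v, w) - f (v', w) \<in> R"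
    and "\<And>k v w. f (sV k v, w) - fscale k (f (v, w)) \<in> R"
    and "\<And>v w w'. f (v, w + w') - f (v, w) - f (v, w') \<in> R"
    and "\<And>k v w. f (v, sW k w) - fscale k (f (v, w)) \<in> R"
    and "t \<in> tensor_rel sV sW"
  shows "lin_ext fscale f t \<in> R"
  using assms(6) unfolding tensor_rel_def
proof (induction rule: free_vs.span_induct)
  show "free_vs.subspace {t. lin_ext fscale f t \<in> R}"
    using R by (auto simp: free_vs.subspace_def free_vs.lin_ext_add free_vs.lin_ext_fscale
        lin_ext_def[of _ _ 0])
qed (use assms(2-5) in \<open>auto simp: slot_relations_def free_vs.lin_ext_diff free_vs.lin_ext_fscale
        free_vs.lin_ext_basis\<close>)

lemma tensor_rel_relations:
  shows "basis (v + v', w) - basis (v, w) - basis (v', w) \<in> tensor_rel sV sW"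
    and "basis (sV k v, w) - fscale k (basis (v, w)) \<in> tensor_rel sV sW"
    and "basis (v, w + w') - basis (v, w) - basis (v, w') \<in> tensor_rel sV sW"
    and "basis (v, sW k w) - fscale k (basis (v, w)) \<in> tensor_rel sV sW"
proof -
  note [simp] = slot_relations_def
  show "basis (v + v', w) - basis (v, w) - basis (v', w) \<in> tensor_rel sV sW"
    unfolding tensor_rel_def by (rule free_vs.span_base) force
  show "basis (sV k v, w) - fscale k (basis (v, w)) \<in> tensor_rel sV sW"
    unfolding tensor_rel_def by (rule free_vs.span_base) force
  show "basis (v, w + w') - basis (v, w) - basis (v, w') \<in> tensor_rel sV sW"
    unfolding tensor_rel_def by (rule free_vs.span_base) force
  show "basis (v, sW k w) - fscale k (basis (v, w)) \<in> tensor_rel sV sW"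
    unfolding tensor_rel_def by (rule free_vs.span_base) force
qed

lemma tensor_rel_lincomb:
  assumes "vector_space sV" and "finite S"
  shows "basis (\<Sum>i\<in>S. sV (k i) (x i), w) - (\<Sum>i\<in>S. fscale (k i) (basis (x i, w))) \<in> tensor_rel sV sW"
  using assms(2)
proof induction
  case empty
  show ?case
    using free_vs.subspace_neg[OF subspace_tensor_rel tensor_rel_relations(1)[of 0 0 w sV sW]]
    by simp
next
  case (insert i S)
  let ?y = "\<Sum>i\<in>S. sV (k i) (x i)" and ?B = "\<Sum>i\<in>S. fscale (k i) (basis (x i, w))"
  have "(basis (sV (k i) (x i) + ?y, w) - basis (sV (k i) (x i), w) - basis (?y, w))
      + (basis (sV (k i) (x i), w) - fscale (k i) (basis (x i, w))) + (basis (?y, w) - ?B)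
      \<in> tensor_rel sV sW"
    by (intro free_vs.subspace_add[OF subspace_tensor_rel] tensor_rel_relations insert.IH)
  then show ?case using insert.hyps by (simp add: algebra_simps)
qed

lemma sum_UNIV_pair: "(\<Sum>p\<in>UNIV. f p) = (\<Sum>i\<in>UNIV. \<Sum>j\<in>UNIV. f (i, j))"
  by (simp add: sum.cartesian_product flip: UNIV_Times_UNIV)

lemma psi_mat_decomposable:
  fixes psi :: "'c::ab_group_add \<Rightarrow> 'a::ab_group_add \<Rightarrow> ('a \<times> 'c \<Rightarrow>\<^sub>0 'k::field) set"
    and u :: "'k^'n::finite^'n"
  assumes "entwining_structure sA mul one sC Delta eps psi"
  shows "psi_mat sA sC psi c (mat_tensor sA a u) =
    coset (tensor_rel (mat_scale sA) sC)
      (lin_ext fscale (\<lambda>(a', c'). basis (mat_tensor sA a' u, c')) (rep (psi c a)))"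
proof -
  interpret entwining_structure sA mul one sC Delta eps psi by (rule assms)
  let ?R = "tensor_rel (mat_scale sA) sC :: (('a^'n^'n) \<times> 'c \<Rightarrow>\<^sub>0 'k) set"
  define e :: "'n \<times> 'n \<Rightarrow> 'k^'n^'n" where "e = (\<lambda>(i, j). Emat i j 1)"
  define U :: "'n \<times> 'n \<Rightarrow> 'k" where "U = (\<lambda>(i, j). u $ i $ j)"
  define F where "F = (\<lambda>v (a', c' :: 'c). basis (mat_tensor sA a' v, c') :: ('a^'n^'n) \<times> 'c \<Rightarrow>\<^sub>0 'k)"
  define t where "t = rep (psi c a)"
  define P where "P = (\<lambda>p. rep (psi c (sA (U p) a)))"
  note R = subspace_tensor_rel[of "mat_scale sA" sC]
  note VM = vector_space_mat_scale[OF A.vector_space_axioms]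
  have add: "mat_tensor sA (x + y) v = mat_tensor sA x v + mat_tensor sA y v" for x y and v :: "'k^'n^'n"
    by (simp add: mat_tensor_def vec_eq_iff A.scale_right_distrib)
  have scl: "mat_tensor sA (sA k x) v = mat_scale sA k (mat_tensor sA x v)" for k x and v :: "'k^'n^'n"
    by (simp add: mat_tensor_def mat_scale_def vec_eq_iff mult.commute)
  have F_rel: "lin_ext fscale (F v) z \<in> ?R" if "z \<in> tensor_rel sA sC" for v z
    using R _ _ _ _ that
    by (rule lin_ext_tensor_rel_quotient) (simp_all add: F_def add scl tensor_rel_relations)
  have P: "P p - fscale (U p) t \<in> tensor_rel sA sC" for p
    using psi_linear_A rep_coset[OF subspace_tensor_rel]
    by (simp add: linear_into_quotient_def P_def t_def)
  have dec: "mat_tensor sA x u = (\<Sum>p\<in>UNIV. mat_scale sA (U p) (mat_tensor sA x (e p)))" for x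
  proof -
    have "(\<Sum>p\<in>UNIV. mat_scale sA (U p) (mat_tensor sA x (e p))) $ i $ j = sA (u $ i $ j) x" for i j
    proof -
      have "(\<Sum>p\<in>UNIV. mat_scale sA (U p) (mat_tensor sA x (e p))) $ i $ j =
          (\<Sum>p\<in>UNIV. if p = (i, j) then sA (u $ i $ j) x else 0)"
        unfolding sum_component
        by (intro sum.cong refl) (auto simp: mat_scale_def mat_tensor_def e_def U_def Emat_def split: if_splits)
      then show ?thesis by simp
    qed
    then show ?thesis by (simp add: mat_tensor_def vec_eq_iff)
  qed
  have FU: "F u y - (\<Sum>p\<in>UNIV. fscale (U p) (F (e p) y)) \<in> ?R" for y
    using tensor_rel_lincomb[OF VM, of UNIV U "\<lambda>p. mat_tensor sA (fst y) (e p)" "snd y" sC]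
    by (cases y) (simp add: F_def dec)
  have "(\<Sum>y\<in>Poly_Mapping.keys t. fscale (Poly_Mapping.lookup t y)
      (F u y - (\<Sum>p\<in>UNIV. fscale (U p) (F (e p) y)))) \<in> ?R"
    by (intro free_vs.subspace_sum[OF R] free_vs.subspace_scale[OF R] FU)
  moreover have "(\<Sum>y\<in>Poly_Mapping.keys t. fscale (Poly_Mapping.lookup t y)
      (F u y - (\<Sum>p\<in>UNIV. fscale (U p) (F (e p) y)))) =
      lin_ext fscale (F u) t - (\<Sum>p\<in>UNIV. fscale (U p) (lin_ext fscale (F (e p)) t))"
    by (simp add: lin_ext_def free_vs.scale_right_diff_distrib sum_subtractf free_vs.scale_sum_right
        sum.swap[of _ UNIV "Poly_Mapping.keys t"] mult.commute)
  ultimately have 1: "lin_ext fscale (F u) t - (\<Sum>p\<in>UNIV. fscale (U p) (lin_ext fscale (F (e p)) t)) \<in> ?R"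
    by simp
  have "(\<Sum>p\<in>UNIV. lin_ext fscale (F (e p)) (P p - fscale (U p) t)) \<in> ?R"
    by (intro free_vs.subspace_sum[OF R] F_rel P)
  then have 2: "(\<Sum>p\<in>UNIV. lin_ext fscale (F (e p)) (P p)) -
      (\<Sum>p\<in>UNIV. fscale (U p) (lin_ext fscale (F (e p)) t)) \<in> ?R"
    by (simp add: free_vs.lin_ext_diff free_vs.lin_ext_fscale sum_subtractf)
  have "(\<Sum>p\<in>UNIV. lin_ext fscale (F (e p)) (P p)) - lin_ext fscale (F u) t \<in> ?R"
    using free_vs.subspace_diff[OF R 2 1] by simp
  then have "coset ?R (\<Sum>p\<in>UNIV. lin_ext fscale (F (e p)) (P p)) = coset ?R (lin_ext fscale (F u) t)"
    by (rule coset_eq[OF R])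
  moreover have "(\<Sum>p\<in>UNIV. lin_ext fscale (F (e p)) (P p)) = (\<Sum>i\<in>UNIV. \<Sum>j\<in>UNIV.
      lin_ext fscale (\<lambda>(a', c'). basis (mat_tensor sA a' (Emat i j 1), c'))
        (rep (psi c (mat_tensor sA a u $ i $ j))))"
    by (simp add: sum_UNIV_pair F_def e_def P_def U_def mat_tensor_def)
  ultimately show ?thesis by (simp add: psi_mat_def F_def t_def)
qed

lemma sum_lists_Suc:
  "(\<Sum>ps | length ps = Suc m. f ps) =
   (\<Sum>p\<in>UNIV. \<Sum>ps | length ps = m. f (p # ps))" for f :: "'x::finite list \<Rightarrow> 'y::comm_monoid_add"
proof -
  have "(\<Sum>(p, ps)\<in>UNIV \<times> {ps. length ps = m}. f (p # ps)) = (\<Sum>ps | length ps = Suc m. f ps)"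
    by (rule sum.reindex_bij_witness[of _ "\<lambda>ps. (hd ps, tl ps)" "\<lambda>(p, ps). p # ps"])
      (auto simp: length_Suc_conv)
  then show ?thesis by (simp add: sum.cartesian_product)
qed

lemma prod_matrices_expand:
  fixes us :: "('k::field^'n::finite^'n) list"
  shows "foldr (**) us (mat 1) $ p $ q =
    (\<Sum>ps | length ps = length us.
      prod_list (map2 (\<lambda>u (i, j). u $ i $ j) us ps) *
      foldr (**) (map (\<lambda>(i, j). Emat i j 1) ps) (mat 1) $ p $ q)"
proof (induction us arbitrary: p)
  case (Cons u us)
  let ?e = "\<lambda>(i, j). Emat i j (1 :: 'k) :: 'k^'n^'n"
  let ?X = "\<lambda>ps. foldr (**) (map ?e ps) (mat 1) :: 'k^'n^'n"
  let ?c = "\<lambda>ps. prod_list (map2 (\<lambda>u (i, j). u $ i $ j) us ps)"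
  have e: "(Emat i j 1 ** X) $ p $ q = (if i = p then X $ j $ q else 0)" for i j and X :: "'k^'n^'n"
    by (simp add: matrix_matrix_mult_def Emat_def if_distrib[of "\<lambda>x. x * _"] cong: if_cong)
  have "(\<Sum>ps | length ps = length (u # us).
      prod_list (map2 (\<lambda>u (i, j). u $ i $ j) (u # us) ps) * ?X ps $ p $ q) =
      (\<Sum>i\<in>UNIV. \<Sum>j\<in>UNIV. \<Sum>ps | length ps = length us.
        (u $ i $ j * ?c ps) * (?e (i, j) ** ?X ps) $ p $ q)"
    by (simp add: sum_lists_Suc sum_UNIV_pair)
  also have "\<dots> = (\<Sum>i\<in>UNIV. if i = p then \<Sum>j\<in>UNIV. \<Sum>ps | length ps = length us.
        (u $ p $ j * ?c ps) * ?X ps $ j $ q else 0)"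
    by (intro sum.cong refl) (auto simp: e)
  also have "\<dots> = (\<Sum>j\<in>UNIV. u $ p $ j * (\<Sum>ps | length ps = length us. ?c ps * ?X ps $ j $ q))"
    by (simp add: sum_distrib_left mult.assoc)
  also have "\<dots> = foldr (**) (u # us) (mat 1) $ p $ q"
    unfolding Cons.IH[symmetric] by (simp add: matrix_matrix_mult_def[of u])
  finally show ?case by simp
qed simp

lemma multilinear_scale_list:
  assumes lin: "\<And>xs ys. Vector_Spaces.linear sA (*) (\<lambda>a. h (xs @ a # ys))"
    and "length ks = length as"
  shows "h (zs @ map2 sA ks as) = prod_list ks * h (zs @ as)"
  using assms(2)
proof (induction ks as arbitrary: zs rule: list_induct2)
  case (Cons k ks a as)
  interpret l: Vector_Spaces.linear sA "(*)" "\<lambda>a. h (zs @ a # map2 sA ks as)" by (rule lin)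
  show ?case using Cons.IH[of "zs @ [a]"] by (simp add: l.scale mult.assoc)
qed simp

lemma gen_trace_decomposable:
  fixes aus :: "('a::ab_group_add \<times> ('k::field^'n::finite^'n)) list"
  assumes g: "g \<in> hoch_cochains sA sC n"
  shows "tr_map n g c (map (\<lambda>(a, u). mat_tensor sA a u) aus) =
    trace (foldr (**) (map snd aus) (mat 1)) * g c (map fst aus)"
proof -
  let ?us = "map snd aus" and ?as = "map fst aus"
  let ?Xs = "map (\<lambda>(a, u). mat_tensor sA a u) aus"
  let ?e = "\<lambda>ps. foldr (**) (map (\<lambda>(i, j). Emat i j 1) ps) (mat 1) :: 'k^'n^'n"
  let ?k = "\<lambda>ps. map2 (\<lambda>u (i, j). u $ i $ j) ?us ps"
  have k: "vector_space ((*) :: 'k \<Rightarrow> 'k \<Rightarrow> 'k)"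
    by unfold_locales (simp_all add: algebra_simps)
  interpret l: Vector_Spaces.linear fscale "(*)" "lin_ext (*) (\<lambda>(c', as). g c' as)"
    by (rule vector_space.linear_lin_ext[OF k])
  have entries: "map2 (\<lambda>X (i, j). X $ i $ j) ?Xs ps = map2 sA (?k ps) ?as"
    if "length ps = length aus" for ps
    using that by (induction ps aus rule: list_induct2) (auto simp: mat_tensor_def)
  have "tr_map n g c ?Xs = (\<Sum>ps | length ps = length aus.
      trace (?e ps) * g c (map2 (\<lambda>X (i, j). X $ i $ j) ?Xs ps))"
    by (simp add: tr_map_def gen_trace_def l.sum l.scale vector_space.lin_ext_basis[OF k])
  also have "\<dots> = (\<Sum>ps | length ps = length aus. trace (?e ps) * (prod_list (?k ps) * g c ?as))"
  proof (rule sum.cong)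
    fix ps :: "('n \<times> 'n) list"
    assume "ps \<in> {ps. length ps = length aus}"
    then have len: "length ps = length aus" by simp
    have "g c ([] @ map2 sA (?k ps) ?as) = prod_list (?k ps) * g c ([] @ ?as)"
      by (rule multilinear_scale_list) (use g len in \<open>auto simp: hoch_cochains_def\<close>)
    then show "trace (?e ps) * g c (map2 (\<lambda>X (i, j). X $ i $ j) ?Xs ps) =
        trace (?e ps) * (prod_list (?k ps) * g c ?as)"
      using entries[OF len] by simp
  qed simp
  also have "\<dots> = trace (foldr (**) ?us (mat 1)) * g c ?as"
    unfolding trace_def prod_matrices_expand[of ?us]
    by (simp add: sum_distrib_left sum_distrib_right mult_ac sum.swap[of _ UNIV "{ps. length ps = length aus}"])
  finally show ?thesis .
qed

end

theory Submission
  imports Defs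
begin

text \<open>
  Let \<open>T\<close> be the operator on cochains that moves the coalgebra past all tensor factors, so that \<open>g\<close> is
  invariant iff \<open>T g = g\<close> (\<open>inv_cochains_mem\<close>). Every operator that commutes with \<open>T\<close> preserves
  invariant cochains, and everything in sight commutes with \<open>T\<close>. For the faces of the Hochschild
  differential this is the compatibility of \<open>\<psi>\<close> with products (\<open>twist_list_entwined_diff\<close>). For the maps
  between \<open>A\<close> and \<open>M\<^sub>r(A)\<close> it holds because the entwining acts on each matrix entry separately, hence
  commutes with any rearrangement of entries, and because it fixes the unit
  (\<open>twist_list_trace\<close>, \<open>twist_list_corner\<close>, \<open>twist_list_homotopy\<close>).

  It therefore suffices to compare the two complexes of all cochains. The trace is a chain map by
  multiplicativity of path sums and its cyclic invariance (\<open>trace_entwined_diff\<close>), and its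
  composite with the corner inclusion on \<open>C(A)\<close> is the identity, because the only closed path through
  nonzero entries of corner matrices is constant (\<open>corner_trace\<close>). For the other composite one uses the
  homotopy of the Morita invariance of Hochschild homology. In the present convention the wrapping
  face multiplies the first entry onto the last one, so the last entry plays the role of the
  coefficients. Write \<open>e\<^sub>p\<^sub>q\<close> for matrix units. The \<open>j\<close>-th term of the homotopy sends
  \<open>c \<otimes> X\<^sub>1 \<otimes> \<dots> \<otimes> X\<^sub>m\<close> to the sum over all paths \<open>k = l\<^sub>0, l\<^sub>1, \<dots>, l\<^sub>j\<close> of
  \<open>c \<otimes> e\<^sub>1\<^sub>1(x\<^sub>1) \<otimes> \<dots> \<otimes> e\<^sub>1\<^sub>1(x\<^sub>j) \<otimes> e\<^sub>1\<^sub>l(1) \<otimes> X\<^sub>j\<^sub>+\<^sub>1 \<otimes> \<dots> \<otimes> X\<^sub>m e\<^sub>k\<^sub>1\<close>, where \<open>l = l\<^sub>j\<close> and \<open>x\<^sub>i\<close> is the entry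
  of \<open>X\<^sub>i\<close> at \<open>(l\<^sub>i\<^sub>-\<^sub>1, l\<^sub>i)\<close>. Faces of neighbouring terms cancel. The first wrapping face gives back the
  argument (\<open>homotopy_wrap\<close>) and the last product face gives its trace in the corner
  (\<open>homotopy_bar\<close>).

  All these sums are defined by recursion on the list of tensor factors, after splitting off the
  first one, so that each identity is an induction on lists. Elements of \<open>A \<otimes> C\<close> only enter
  through the values of bilinear forms on them.
\<close>

section \<open>Linear maps and evaluation of bilinear forms on tensors\<close>

text \<open>
  Unlike the library notion, this does not include the vector space axioms. It applies uniformly to
  forms on \<open>A\<close> and \<open>C\<close>, to functionals on function spaces and to operators on cochains.
\<close>

definition is_linear ::
  "('k::field \<Rightarrow> 'v::ab_group_add \<Rightarrow> 'v) \<Rightarrow> ('k \<Rightarrow> 'w::ab_group_add \<Rightarrow> 'w) \<Rightarrow> ('v \<Rightarrow> 'w) \<Rightarrow> bool"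
  where "is_linear s t f \<longleftrightarrow> (\<forall>x y. f (x + y) = f x + f y) \<and> (\<forall>k x. f (s k x) = t k (f x))"

definition fun_scale :: "'k::field \<Rightarrow> ('x \<Rightarrow> 'k) \<Rightarrow> 'x \<Rightarrow> 'k"
  where "fun_scale k G = (\<lambda>x. k * G x)"

lemma vector_space_times: "vector_space ((*) :: 'k::field \<Rightarrow> 'k \<Rightarrow> 'k)"
  by unfold_locales (simp_all add: algebra_simps)

lemma linear_iff_is_linear:
  "vector_space s \<Longrightarrow> vector_space t \<Longrightarrow> Vector_Spaces.linear s t f \<longleftrightarrow> is_linear s t f"
  by (simp add: Vector_Spaces.linear_iff is_linear_def)

lemma is_linearD:
  assumes "is_linear s t f"
  shows "f (x + y) = f x + f y" "f (s k x) = t k (f x)"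
  using assms by (simp_all add: is_linear_def)

lemma is_linear_0:
  assumes "is_linear s t f"
  shows "f 0 = 0"
  using is_linearD(1)[OF assms, of 0 0] by simp

lemma is_linear_diff_arg:
  assumes "is_linear s t f"
  shows "f (x - y) = f x - f y"
  using is_linearD(1)[OF assms, of "x - y" y] by (simp add: algebra_simps)

lemma is_linear_sum_arg:
  assumes "is_linear s t f"
  shows "f (\<Sum>i\<in>I. x i) = (\<Sum>i\<in>I. f (x i))"
  by (induction I rule: infinite_finite_induct) (auto simp: is_linear_0[OF assms] is_linearD[OF assms])

lemma is_linear_comp:
  assumes "is_linear s t f" "is_linear t u g"
  shows "is_linear s u (\<lambda>v. g (f v))"
  using assms by (simp add: is_linear_def)

lemma is_linear_zero_form: "is_linear s (*) (\<lambda>v. 0)"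
  by (simp add: is_linear_def)

lemma is_linear_add_form:
  "is_linear s (*) f \<Longrightarrow> is_linear s (*) g \<Longrightarrow> is_linear s (*) (\<lambda>v. f v + g v)"
  by (simp add: is_linear_def algebra_simps)

lemma is_linear_diff_form:
  "is_linear s (*) f \<Longrightarrow> is_linear s (*) g \<Longrightarrow> is_linear s (*) (\<lambda>v. f v - g v)"
  by (simp add: is_linear_def algebra_simps)

lemma is_linear_scaled_form: "is_linear s (*) f \<Longrightarrow> is_linear s (*) (\<lambda>v. k * f v)"
  by (simp add: is_linear_def algebra_simps)

lemma is_linear_sum_form:
  "(\<And>i. i \<in> I \<Longrightarrow> is_linear s (*) (f i)) \<Longrightarrow> is_linear s (*) (\<lambda>v. \<Sum>i\<in>I. f i v)"
  by (simp add: is_linear_def sum.distrib sum_distrib_left)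

text \<open>
  The operators on cochains below are finite linear combinations of evaluations at points, that is,
  linear functionals on a space of functions. Such a functional preserves linear dependence on a
  parameter, and it commutes with the finite sums that stand for an element of a tensor product
  (\<open>functional_eval_tensor\<close>).
\<close>

lemma functional_family:
  assumes "is_linear fun_scale (*) \<Phi>" and "\<And>x. is_linear s (*) (\<lambda>v. K v x)"
  shows "is_linear s (*) (\<lambda>v. \<Phi> (K v))"
proof -
  have "K (v + w) = K v + K w" for v w
    using assms(2) by (auto simp: is_linear_def)
  moreover have "K (s k v) = fun_scale k (K v)" for k v
    using assms(2) by (auto simp: is_linear_def fun_scale_def)
  ultimately show ?thesis using assms(1) by (simp add: is_linear_def)
qed

lemma functional_add:
  assumes "is_linear fun_scale (*) \<Phi>"
  shows "\<Phi> (\<lambda>x. G x + H x) = \<Phi> G + \<Phi> H"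
  using is_linearD(1)[OF assms, of G H] by (simp add: plus_fun_def)

lemma functional_scale:
  assumes "is_linear fun_scale (*) \<Phi>"
  shows "\<Phi> (\<lambda>x. k * G x) = k * \<Phi> G"
  using is_linearD(2)[OF assms, of k G] by (simp add: fun_scale_def)

lemma functional_diff:
  assumes "is_linear fun_scale (*) \<Phi>"
  shows "\<Phi> (\<lambda>x. G x - H x) = \<Phi> G - \<Phi> H"
  using is_linear_diff_arg[OF assms, of G H] by (simp add: fun_diff_def)

lemma functional_0:
  assumes "is_linear fun_scale (*) \<Phi>"
  shows "\<Phi> (\<lambda>x. 0) = 0"
  using is_linear_0[OF assms] by (simp add: zero_fun_def)

lemma functional_sum:
  assumes "is_linear fun_scale (*) \<Phi>"
  shows "\<Phi> (\<lambda>x. \<Sum>i\<in>I. G i x) = (\<Sum>i\<in>I. \<Phi> (G i))"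
  by (induction I rule: infinite_finite_induct)
    (simp_all add: functional_add[OF assms] functional_0[OF assms])

lemma functional_point: "is_linear fun_scale (*) (\<lambda>G. G x)"
  by (simp add: is_linear_def fun_scale_def)

lemma functional_comp:
  assumes "is_linear fun_scale (*) \<Phi>"
  shows "is_linear fun_scale (*) (\<lambda>G. \<Phi> (\<lambda>x. G (h x)))"
  by (rule functional_family[OF assms functional_point])

definition bilinear_form ::
  "('k::field \<Rightarrow> 'v::ab_group_add \<Rightarrow> 'v) \<Rightarrow> ('k \<Rightarrow> 'w::ab_group_add \<Rightarrow> 'w) \<Rightarrow> ('v \<Rightarrow> 'w \<Rightarrow> 'k) \<Rightarrow> bool"
  where "bilinear_form sV sW F \<longleftrightarrow>
    (\<forall>w. is_linear sV (*) (\<lambda>v. F v w)) \<and> (\<forall>v. is_linear sW (*) (F v))"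

lemma bilinear_formI:
  "(\<And>w. is_linear sV (*) (\<lambda>v. F v w)) \<Longrightarrow> (\<And>v. is_linear sW (*) (\<lambda>w. F v w)) \<Longrightarrow>
    bilinear_form sV sW (\<lambda>v w. F v w)"
  by (simp add: bilinear_form_def)

definition eval_tensor :: "('x \<Rightarrow> 'y \<Rightarrow> 'k::field) \<Rightarrow> ('x \<times> 'y \<Rightarrow>\<^sub>0 'k) \<Rightarrow> 'k"
  where "eval_tensor F t = lin_ext (*) (\<lambda>(x, y). F x y) t"

lemma eval_tensor_sum_def:
  "eval_tensor F t =
    (\<Sum>p\<in>Poly_Mapping.keys t. Poly_Mapping.lookup t p * F (fst p) (snd p))"
  by (simp add: eval_tensor_def lin_ext_def case_prod_beta)

lemma eval_tensor_family:
  "(\<And>x y. is_linear s (*) (\<lambda>v. K v x y)) \<Longrightarrow> is_linear s (*) (\<lambda>v. eval_tensor (K v) t)"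
  unfolding eval_tensor_sum_def by (intro is_linear_sum_form is_linear_scaled_form)

lemma functional_eval_tensor:
  assumes "is_linear fun_scale (*) \<Phi>"
  shows "\<Phi> (\<lambda>z. eval_tensor (\<lambda>x y. K x y z) t) = eval_tensor (\<lambda>x y. \<Phi> (K x y)) t"
  unfolding eval_tensor_sum_def by (simp add: functional_sum[OF assms] functional_scale[OF assms])

lemma eval_tensor_diff:
  "eval_tensor (\<lambda>x y. F x y - G x y) t = eval_tensor F t - eval_tensor G t"
  by (simp add: eval_tensor_sum_def algebra_simps sum_subtractf)

lemma eval_tensor_sum:
  "eval_tensor (\<lambda>x y. \<Sum>i\<in>I. F i x y) t = (\<Sum>i\<in>I. eval_tensor (F i) t)"
  unfolding eval_tensor_sum_def sum_distrib_left by (rule sum.swap)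

lemma eval_tensor_0: "eval_tensor (\<lambda>x y. 0) t = 0"
  by (simp add: eval_tensor_sum_def)

lemma eval_tensor_basis: "eval_tensor F (basis (x, y)) = F x y"
  by (simp add: eval_tensor_def vector_space.lin_ext_basis[OF vector_space_times])

lemma is_linear_eval_tensor: "is_linear fscale (*) (eval_tensor F)"
  by (simp add: is_linear_def eval_tensor_def vector_space.lin_ext_add[OF vector_space_times]
      vector_space.lin_ext_fscale[OF vector_space_times])

lemma eval_tensor_lin_ext:
  "eval_tensor F (lin_ext fscale (\<lambda>(x, y). K x y) t) = eval_tensor (\<lambda>x y. eval_tensor F (K x y)) t"
  unfolding lin_ext_def[of fscale] is_linear_sum_arg[OF is_linear_eval_tensor]
    is_linearD(2)[OF is_linear_eval_tensor]
  by (simp add: eval_tensor_sum_def[of "\<lambda>x y. eval_tensor F (K x y)"] case_prod_beta)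

text \<open>Bilinear forms do not see the choice of a representative of a tensor.\<close>

lemma eval_tensor_rep_coset:
  assumes "vector_space sV" "vector_space sW" "bilinear_form sV sW F"
  shows "eval_tensor F (rep (coset (tensor_rel sV sW) t)) = eval_tensor F t"
  unfolding eval_tensor_def
  by (rule vector_space.lin_ext_rep_coset[OF vector_space_times])
    (use assms in \<open>auto simp: linear_iff_is_linear vector_space_times bilinear_form_def\<close>)


section \<open>Moving the coalgebra past the algebra\<close>

text \<open>
  In Sweedler notation \<open>twist psi F c a\<close> is \<open>F(a\<^sub>\<psi>, c\<^sup>\<psi>)\<close>, and \<open>twist_list psi g\<close> is the cochain that the
  invariance condition compares with \<open>g\<close>.
\<close>

definition twist ::
  "('c \<Rightarrow> 'a \<Rightarrow> ('a \<times> 'c \<Rightarrow>\<^sub>0 'k::field) set) \<Rightarrow> ('a \<Rightarrow> 'c \<Rightarrow> 'k) \<Rightarrow> 'c \<Rightarrow> 'a \<Rightarrow> 'k"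
  where "twist psi F c a = eval_tensor F (rep (psi c a))"

definition twist_list ::
  "('c \<Rightarrow> 'a \<Rightarrow> ('a \<times> 'c \<Rightarrow>\<^sub>0 'k::field) set) \<Rightarrow> ('c, 'a, 'k) cochain \<Rightarrow> ('c, 'a, 'k) cochain"
  where "twist_list psi g c as = eval_tensor (\<lambda>as' c'. g c' as') (psi_iter psi c as)"

lemma twist_family:
  "(\<And>x y. is_linear s (*) (\<lambda>v. K v x y)) \<Longrightarrow> is_linear s (*) (\<lambda>v. twist psi (\<lambda>x y. K v x y) c a)"
  unfolding twist_def by (rule eval_tensor_family)

lemma functional_twist:
  "is_linear fun_scale (*) \<Phi> \<Longrightarrow>
    \<Phi> (\<lambda>z. twist psi (\<lambda>x y. K x y z) c a) = twist psi (\<lambda>x y. \<Phi> (K x y)) c a"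
  unfolding twist_def by (rule functional_eval_tensor)

lemma twist_diff:
  "twist psi (\<lambda>x y. F x y - G x y) c a = twist psi F c a - twist psi G c a"
  unfolding twist_def by (rule eval_tensor_diff)

lemma twist_sum:
  "twist psi (\<lambda>x y. \<Sum>i\<in>I. F i x y) c a = (\<Sum>i\<in>I. twist psi (F i) c a)"
  unfolding twist_def by (rule eval_tensor_sum)

lemma twist_0: "twist psi (\<lambda>x y. 0) c a = 0"
  unfolding twist_def by (rule eval_tensor_0)

lemma twist_list_Nil [simp]: "twist_list psi g c [] = g c []"
  by (simp add: twist_list_def eval_tensor_basis)

lemma twist_list_Cons [simp]:
  "twist_list psi g c (a # as) =
    twist psi (\<lambda>a' c'. twist_list psi (\<lambda>c'' xs. g c'' (a' # xs)) c' as) c a"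
  by (simp add: twist_list_def twist_def eval_tensor_lin_ext eval_tensor_basis)

lemma twist_list_family:
  "(\<And>c xs. is_linear s (*) (\<lambda>v. K v c xs)) \<Longrightarrow> is_linear s (*) (\<lambda>v. twist_list psi (K v) c as)"
  unfolding twist_list_def by (rule eval_tensor_family)

lemma twist_list_diff:
  "twist_list psi (\<lambda>c xs. f c xs - g c xs) c as = twist_list psi f c as - twist_list psi g c as"
  by (simp add: twist_list_def eval_tensor_diff)

lemma twist_list_sum:
  "twist_list psi (\<lambda>c xs. \<Sum>i\<in>I. f i c xs) c as = (\<Sum>i\<in>I. twist_list psi (f i) c as)"
  by (simp add: twist_list_def eval_tensor_sum)

lemma twist_list_0: "twist_list psi (\<lambda>c xs. 0) c as = 0"
  by (simp add: twist_list_def eval_tensor_0)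

lemma twist_list_cong_length:
  assumes "\<And>c xs. length xs = length as \<Longrightarrow> f c xs = g c xs"
  shows "twist_list psi f c as = twist_list psi g c as"
  using assms
proof (induction as arbitrary: f g c)
  case (Cons a as)
  have "twist_list psi (\<lambda>c xs. f c (a' # xs)) c' as = twist_list psi (\<lambda>c xs. g c (a' # xs)) c' as" for a' c'
    by (rule Cons.IH) (simp add: Cons.prems)
  then show ?case by simp
qed simp

text \<open>
  Linearity is required for arguments of every length, so that it survives when the first entry is
  fixed (\<open>multilinear_cochain_Cons\<close>) and no degree has to be carried through the inductions.
\<close>

definition multilinear_cochain ::
  "('k::field \<Rightarrow> 'a::ab_group_add \<Rightarrow> 'a) \<Rightarrow> ('k \<Rightarrow> 'c::ab_group_add \<Rightarrow> 'c) \<Rightarrow> ('c, 'a, 'k) cochain \<Rightarrow> bool"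
  where "multilinear_cochain sA sC g \<longleftrightarrow>
    (\<forall>as. is_linear sC (*) (\<lambda>c. g c as)) \<and> (\<forall>c xs ys. is_linear sA (*) (\<lambda>a. g c (xs @ a # ys)))"

definition multilinear :: "('k::field \<Rightarrow> 'a::ab_group_add \<Rightarrow> 'a) \<Rightarrow> ('a list \<Rightarrow> 'k) \<Rightarrow> bool"
  where "multilinear sA G \<longleftrightarrow> (\<forall>xs ys. is_linear sA (*) (\<lambda>a. G (xs @ a # ys)))"

lemma multilinear_cochain_iff:
  "multilinear_cochain sA sC g \<longleftrightarrow>
    (\<forall>as. is_linear sC (*) (\<lambda>c. g c as)) \<and> (\<forall>c. multilinear sA (g c))"
  by (simp add: multilinear_cochain_def multilinear_def)

lemma multilinearD: "multilinear sA G \<Longrightarrow> is_linear sA (*) (\<lambda>a. G (xs @ a # ys))"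
  by (simp add: multilinear_def)

lemma multilinear_hd: "multilinear sA G \<Longrightarrow> is_linear sA (*) (\<lambda>a. G (a # ys))"
  using multilinearD[of sA G "[]"] by simp

lemma multilinear_second: "multilinear sA G \<Longrightarrow> is_linear sA (*) (\<lambda>a. G (x # a # ys))"
  using multilinearD[of sA G "[x]"] by simp

lemma multilinear_last: "multilinear sA G \<Longrightarrow> is_linear sA (*) (\<lambda>a. G (xs @ [a]))"
  by (rule multilinearD)

lemma multilinear_Cons: "multilinear sA G \<Longrightarrow> multilinear sA (\<lambda>xs. G (a # xs))"
  unfolding multilinear_def append_Cons[symmetric] by blast

lemma multilinear_cochain_Cons:
  "multilinear_cochain sA sC g \<Longrightarrow> multilinear_cochain sA sC (\<lambda>c xs. g c (a # xs))"
  by (simp add: multilinear_cochain_iff multilinear_Cons)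

lemma multilinearI:
  assumes "\<And>ys. is_linear sA (*) (\<lambda>a. G (a # ys))" and "\<And>x. multilinear sA (\<lambda>xs. G (x # xs))"
  shows "multilinear sA G"
  unfolding multilinear_def
proof (intro allI)
  fix xs ys
  show "is_linear sA (*) (\<lambda>a. G (xs @ a # ys))"
    using assms by (cases xs) (auto simp: multilinear_def)
qed

lemma multilinear_sum:
  "(\<And>i. i \<in> I \<Longrightarrow> multilinear sA (G i)) \<Longrightarrow> multilinear sA (\<lambda>xs. \<Sum>i\<in>I. G i xs)"
  by (simp add: multilinear_def is_linear_sum_form)

lemma hoch_cochains_iff:
  assumes "vector_space sA" "vector_space sC"
  shows "g \<in> hoch_cochains sA sC n \<longleftrightarrow>
    multilinear_cochain sA sC g \<and> (\<forall>c as. length as \<noteq> n + 1 \<longrightarrow> g c as = 0)"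
  using assms
  by (simp add: hoch_cochains_def multilinear_cochain_def linear_iff_is_linear vector_space_times)


section \<open>The differential by recursion on lists\<close>

primrec map_last :: "('a \<Rightarrow> 'a) \<Rightarrow> 'a list \<Rightarrow> 'a list"
  where
    "map_last f [] = []"
  | "map_last f (x # xs) = (case xs of [] \<Rightarrow> [f x] | _ # _ \<Rightarrow> x # map_last f xs)"

declare map_last.simps(2) [simp del]

lemma map_last_single [simp]: "map_last f [x] = [f x]"
  by (simp add: map_last.simps(2))

lemma map_last_Cons: "xs \<noteq> [] \<Longrightarrow> map_last f (x # xs) = x # map_last f xs"
  by (simp add: map_last.simps(2) split: list.split)

lemma map_last_Cons_Cons [simp]: "map_last f (x # y # xs) = x # map_last f (y # xs)"
  by (simp add: map_last_Cons)

lemma map_last_snoc [simp]: "map_last f (xs @ [x]) = xs @ [f x]"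
  by (induction xs) (simp_all add: map_last_Cons)

lemma length_map_last [simp]: "length (map_last f xs) = length xs"
  by (cases xs rule: rev_cases) simp_all

lemma map_last_eq_Nil [simp]: "map_last f xs = [] \<longleftrightarrow> xs = []"
  by (cases xs rule: rev_cases) simp_all

lemma multilinear_map_last:
  assumes "multilinear sA G" "is_linear sA sA f"
  shows "multilinear sA (\<lambda>xs. G (map_last f xs))"
  unfolding multilinear_def
proof (intro allI)
  fix xs ys
  show "is_linear sA (*) (\<lambda>a. G (map_last f (xs @ a # ys)))"
  proof (cases ys rule: rev_cases)
    case Nil
    then show ?thesis using is_linear_comp[OF assms(2) multilinear_last[OF assms(1)]] by simp
  next
    case (snoc zs z)
    have "map_last f (xs @ a # zs @ [z]) = xs @ a # zs @ [f z]" for a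
      using map_last_snoc[of f "xs @ a # zs" z] by simp
    then show ?thesis using snoc multilinearD[OF assms(1)] by simp
  qed
qed

text \<open>
  The alternating sum of the products of neighbouring entries. Splitting off the first entry makes
  it recursive, and the identities that it satisfies become inductions without index bookkeeping.
\<close>

primrec bar :: "('a \<Rightarrow> 'a \<Rightarrow> 'a) \<Rightarrow> ('a list \<Rightarrow> 'k::field) \<Rightarrow> 'a list \<Rightarrow> 'k"
  where
    "bar mul G [] = 0"
  | "bar mul G (a # as) =
      (case as of [] \<Rightarrow> 0 | b # bs \<Rightarrow> G (mul a b # bs)) - bar mul (\<lambda>xs. G (a # xs)) as"

lemma functional_bar: "is_linear fun_scale (*) (\<lambda>G. bar mul G as)"
proof (induction as)
  case (Cons a as)
  have "is_linear fun_scale (*) (\<lambda>G. case as of [] \<Rightarrow> 0 | b # bs \<Rightarrow> G (mul a b # bs))"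
    by (cases as) (simp_all add: is_linear_zero_form functional_point)
  then show ?case
    unfolding bar.simps by (rule is_linear_diff_form[OF _ functional_comp[OF Cons.IH]])
qed (simp add: is_linear_zero_form)

lemma bar_cong_length:
  assumes "\<And>xs. Suc (length xs) = length as \<Longrightarrow> G xs = H xs"
  shows "bar mul G as = bar mul H as"
  using assms
proof (induction as arbitrary: G H)
  case (Cons a as)
  have "bar mul (\<lambda>xs. G (a # xs)) as = bar mul (\<lambda>xs. H (a # xs)) as"
    by (rule Cons.IH) (simp add: Cons.prems)
  then show ?case using Cons.prems by (simp split: list.split)
qed simp

text \<open>The summand \<open>i\<close> is the face with number \<open>i + 1\<close>, so \<open>bar\<close> is minus the part of the differential
  without wrapping.\<close>

lemma bar_eq_alternating_sum:
  "bar mul G as = (\<Sum>i<length as - 1. (- 1) ^ i * G (take i as @ [mul (as ! i) (as ! Suc i)] @ drop (i + 2) as))"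
proof (induction as arbitrary: G)
  case (Cons a as)
  show ?case
  proof (cases as)
    case (Cons b bs)
    have "bar mul (\<lambda>xs. G (a # xs)) as =
        (\<Sum>i<length bs. (- 1) ^ i * G (a # take i as @ [mul (as ! i) (as ! Suc i)] @ drop (i + 2) as))"
      unfolding Cons.IH by (simp add: Cons)
    then show ?thesis
      by (simp add: Cons sum.lessThan_Suc_shift sum_negf del: sum.lessThan_Suc)
  qed simp
qed simp

text \<open>
  The face that moves the first entry past the coalgebra and multiplies it onto the last one. On lists
  with fewer than two entries there is no such face; the value \<open>0\<close> makes the identities below hold
  for all lists.
\<close>

definition wrap ::
  "('a \<Rightarrow> 'a \<Rightarrow> 'a) \<Rightarrow> ('c \<Rightarrow> 'a \<Rightarrow> ('a \<times> 'c \<Rightarrow>\<^sub>0 'k::field) set) \<Rightarrow>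
    ('c, 'a, 'k) cochain \<Rightarrow> ('c, 'a, 'k) cochain"
  where "wrap mul psi g c as = (case as of [] \<Rightarrow> 0 | a # xs \<Rightarrow>
    if xs = [] then 0 else twist psi (\<lambda>a' c'. g c' (map_last (\<lambda>z. mul z a') xs)) c a)"

lemma wrap_simps [simp]:
  "wrap mul psi g c [] = 0"
  "wrap mul psi g c [a] = 0"
  "xs \<noteq> [] \<Longrightarrow>
    wrap mul psi g c (a # xs) = twist psi (\<lambda>a' c'. g c' (map_last (\<lambda>z. mul z a') xs)) c a"
  by (simp_all add: wrap_def)

text \<open>
  This is the Hochschild differential in all degrees at once: the degree of a cochain can be read off
  from the length of the lists on which it lives.
\<close>

definition entwined_diff ::
  "('a \<Rightarrow> 'a \<Rightarrow> 'a) \<Rightarrow> ('c \<Rightarrow> 'a \<Rightarrow> ('a \<times> 'c \<Rightarrow>\<^sub>0 'k::field) set) \<Rightarrow>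
    ('c, 'a, 'k) cochain \<Rightarrow> ('c, 'a, 'k) cochain"
  where "entwined_diff mul psi g c as = wrap mul psi g c as - bar mul (g c) as"

lemma hoch_diff_eq_entwined_diff:
  assumes "\<And>c as. length as \<noteq> n + 1 \<Longrightarrow> g c as = 0"
  shows "hoch_diff mul psi n g = entwined_diff mul psi g"
proof (intro ext)
  fix c as
  show "hoch_diff mul psi n g c as = entwined_diff mul psi g c as"
  proof (cases "length as = n + 2")
    case True
    then obtain a xs where as: "as = a # xs" "xs \<noteq> []"
      by (cases as; cases "tl as") auto
    have "butlast xs @ [mul (last xs) a'] = map_last (\<lambda>z. mul z a') xs" for a'
      using as(2) by (cases xs rule: rev_cases) simp_all
    then have 1: "lin_ext (*) (\<lambda>(a', c'). g c' (butlast (tl as) @ [mul (last as) a'])) (rep (psi c (hd as)))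
        = wrap mul psi g c as"
      using as by (simp add: twist_def eval_tensor_def)
    have "(\<Sum>i = 1..n + 1. (- 1) ^ i * g c (take (i - 1) as @ [mul (as ! (i - 1)) (as ! i)] @ drop (i + 1) as))
        = (\<Sum>i<n + 1. (- 1) ^ Suc i * g c (take i as @ [mul (as ! i) (as ! Suc i)] @ drop (i + 2) as))"
      by (rule sum.reindex_bij_witness[of _ Suc "\<lambda>i. i - 1"]) auto
    also have "\<dots> = - bar mul (g c) as"
      unfolding bar_eq_alternating_sum using True by (simp add: sum_negf)
    finally show ?thesis using True 1 by (simp add: hoch_diff_def entwined_diff_def)
  next
    case False
    have "bar mul (g c) as = bar mul (\<lambda>_. 0) as"
      by (rule bar_cong_length) (use False assms in auto)
    moreover have "wrap mul psi g c as = 0"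
      using False assms by (cases as) (auto simp: wrap_def twist_0)
    ultimately show ?thesis
      using False by (simp add: hoch_diff_def entwined_diff_def functional_0[OF functional_bar])
  qed
qed


lemma map_last_map_last: "map_last f (map_last g xs) = map_last (\<lambda>x. f (g x)) xs"
  by (cases xs rule: rev_cases) simp_all

text \<open>Left multiplication on the last entry commutes with any \<open>f\<close> of the form \<open>\<lambda>z. z b\<close>.\<close>

lemma bar_map_last:
  assumes "\<And>a b. mul a (f b) = f (mul a b)"
  shows "bar mul (\<lambda>xs. G (map_last f xs)) as = bar mul G (map_last f as)"
proof (induction as arbitrary: G)
  case (Cons a as)
  show ?case
  proof (cases as)
    case (Cons b bs)
    have "bar mul (\<lambda>xs. G (map_last f (a # xs))) as = bar mul (\<lambda>xs. G (a # xs)) (map_last f as)"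
    proof (cases "bs = []")
      case False
      have "bar mul (\<lambda>xs. G (map_last f (a # xs))) as = bar mul (\<lambda>xs. G (a # map_last f xs)) as"
        by (rule bar_cong_length) (use Cons False in \<open>auto simp: map_last_Cons simp flip: length_greater_0_conv\<close>)
      then show ?thesis using Cons.IH[of "\<lambda>xs. G (a # xs)"] by simp
    qed (simp add: Cons)
    then show ?thesis using Cons assms by (cases bs) simp_all
  qed simp
qed simp

text \<open>
  After splitting off \<open>a\<close>, the terms that multiply twice inside the tail vanish by induction. The others
  multiply \<open>a\<close> with its neighbour before or after another product, and cancel by associativity.
\<close>

lemma bar_bar:
  assumes "\<And>a b c. mul (mul a b) c = mul a (mul b c)"
  shows "bar mul (bar mul G) as = 0"
proof (induction as arbitrary: G)
  case (Cons a as)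
  let ?X = "\<lambda>xs. case xs of [] \<Rightarrow> 0 | x # xs' \<Rightarrow> G (mul a x # xs')"
  have "bar mul (\<lambda>xs. bar mul G (a # xs)) as = bar mul ?X as"
    using Cons.IH by (simp add: functional_diff[OF functional_bar])
  then show ?case using assms by (simp split: list.split)
qed simp

section \<open>The complex of an entwined algebra\<close>

text \<open>
  The part of an entwining structure that the Hochschild complex sees, with \<open>\<psi>\<close> described by the values
  of bilinear forms. Both \<open>A\<close> and \<open>M\<^sub>r(A)\<close> are instances.
\<close>

locale entwined_algebra =
  fixes sA :: "'k::field \<Rightarrow> 'a::ab_group_add \<Rightarrow> 'a" and mul :: "'a \<Rightarrow> 'a \<Rightarrow> 'a"
    and sC :: "'k \<Rightarrow> 'c::ab_group_add \<Rightarrow> 'c"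
    and psi :: "'c \<Rightarrow> 'a \<Rightarrow> ('a \<times> 'c \<Rightarrow>\<^sub>0 'k) set"
  assumes vector_space_A: "vector_space sA" and vector_space_C: "vector_space sC"
    and mul_linear_right: "is_linear sA sA (\<lambda>b. mul a b)"
    and mul_linear_left: "is_linear sA sA (\<lambda>a. mul a b)"
    and mul_assoc: "mul (mul a b) d = mul a (mul b d)"
    and twist_linear_C: "bilinear_form sA sC F \<Longrightarrow> is_linear sC (*) (\<lambda>c. twist psi F c a)"
    and twist_linear_A: "bilinear_form sA sC F \<Longrightarrow> is_linear sA (*) (\<lambda>a. twist psi F c a)"
    and twist_mul: "bilinear_form sA sC F \<Longrightarrow> twist psi F c (mul a b) =
      twist psi (\<lambda>a' c'. twist psi (\<lambda>b' c''. F (mul a' b') c'') c' b) c a"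
begin

lemma multilinear_bar:
  assumes "multilinear sA G"
  shows "multilinear sA (bar mul G)"
proof -
  have "is_linear sA (*) (\<lambda>a. bar mul G (xs @ a # ys))" for xs ys
    using assms
  proof (induction xs arbitrary: G)
    case Nil
    show ?case
    proof (cases ys)
      case (Cons b bs)
      have "is_linear sA (*) (\<lambda>a. G (mul a b # bs))"
        by (rule is_linear_comp[OF mul_linear_left multilinear_hd[OF Nil]])
      moreover have "is_linear sA (*) (\<lambda>a. bar mul (\<lambda>xs. G (a # xs)) (b # bs))"
        by (rule functional_family[OF functional_bar multilinear_hd[OF Nil]])
      ultimately show ?thesis using is_linear_diff_form by (fastforce simp: Cons)
    qed (simp add: is_linear_zero_form)
  next
    case (Cons x xs)
    have 1: "is_linear sA (*) (\<lambda>a. bar mul (\<lambda>xs. G (x # xs)) (xs @ a # ys))"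
      by (rule Cons.IH[OF multilinear_Cons[OF Cons.prems]])
    show ?case
    proof (cases xs)
      case Nil
      have "is_linear sA (*) (\<lambda>a. G (mul x a # ys))"
        by (rule is_linear_comp[OF mul_linear_right multilinear_hd[OF Cons.prems]])
      then show ?thesis using is_linear_diff_form[OF _ 1] Nil by simp
    next
      case (Cons y xs')
      have "is_linear sA (*) (\<lambda>a. G ((mul x y # xs') @ a # ys))"
        by (rule multilinearD[OF Cons.prems])
      then show ?thesis using is_linear_diff_form[OF _ 1] Cons by simp
    qed
  qed
  then show ?thesis by (simp add: multilinear_def)
qed

lemma multilinear_cochain_bar:
  assumes "multilinear_cochain sA sC g"
  shows "multilinear_cochain sA sC (\<lambda>c. bar mul (g c))"
  using assms multilinear_bar
  by (auto simp: multilinear_cochain_iff intro!: functional_family[OF functional_bar])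

lemma bilinear_map_last:
  assumes "multilinear_cochain sA sC g" "as \<noteq> []"
  shows "bilinear_form sA sC (\<lambda>a c. g c (map_last (\<lambda>z. mul z a) as))"
proof (rule bilinear_formI)
  fix c
  obtain ms z where as: "as = ms @ [z]" using assms(2) by (cases as rule: rev_cases) auto
  have "multilinear sA (g c)" using assms(1) by (simp add: multilinear_cochain_iff)
  then show "is_linear sA (*) (\<lambda>a. g c (map_last (\<lambda>z. mul z a) as))"
    unfolding as map_last_snoc by (rule is_linear_comp[OF mul_linear_right multilinear_last])
qed (use assms(1) in \<open>simp add: multilinear_cochain_iff\<close>)

lemma multilinear_cochain_wrap:
  assumes g: "multilinear_cochain sA sC g"
  shows "multilinear_cochain sA sC (wrap mul psi g)"
  unfolding multilinear_cochain_iff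
proof (intro conjI allI)
  fix as
  show "is_linear sC (*) (\<lambda>c. wrap mul psi g c as)"
  proof (cases as)
    case (Cons a xs)
    then show ?thesis
      by (cases "xs = []") (simp_all add: is_linear_zero_form twist_linear_C[OF bilinear_map_last[OF g]])
  qed (simp add: is_linear_zero_form)
next
  fix c
  show "multilinear sA (wrap mul psi g c)"
  proof (rule multilinearI)
    fix ys
    show "is_linear sA (*) (\<lambda>a. wrap mul psi g c (a # ys))"
      by (cases "ys = []") (simp_all add: is_linear_zero_form twist_linear_A[OF bilinear_map_last[OF g]])
  next
    fix x
    have "multilinear sA (g c)" for c using g by (simp add: multilinear_cochain_iff)
    then have "is_linear sA (*) (\<lambda>a. g c' (map_last (\<lambda>z. mul z x') (xs @ a # ys)))" for c' x' xs ys
      by (rule multilinearD[OF multilinear_map_last[OF _ mul_linear_left]])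
    then show "multilinear sA (\<lambda>xs. wrap mul psi g c (x # xs))"
      unfolding multilinear_def by (simp add: twist_family)
  qed
qed

lemma multilinear_cochain_entwined_diff:
  assumes "multilinear_cochain sA sC g"
  shows "multilinear_cochain sA sC (entwined_diff mul psi g)"
  using multilinear_cochain_wrap[OF assms] multilinear_cochain_bar[OF assms]
  by (simp add: multilinear_cochain_def entwined_diff_def is_linear_diff_form)

text \<open>
  Wrapping \<open>a\<close> and then its neighbour \<open>b\<close> amounts to wrapping the product \<open>a b\<close>, since \<open>\<psi>\<close> is
  multiplicative. That term is the first one of \<open>bar (wrap g)\<close>, and the others commute with wrapping.
\<close>

lemma wrap_wrap:
  assumes g: "multilinear_cochain sA sC g"
  shows "wrap mul psi (wrap mul psi g) c as =
    wrap mul psi (\<lambda>c. bar mul (g c)) c as + bar mul (wrap mul psi g c) as"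
proof -
  consider "as = []" | a where "as = [a]" | a b where "as = [a, b]"
    | a b xs where "as = a # b # xs" "xs \<noteq> []"
    by (cases as; cases "tl as"; cases "tl (tl as)") auto
  then show ?thesis
  proof cases
    case (4 a b xs)
    let ?m = "\<lambda>a'. map_last (\<lambda>z. mul z a')"
    have "wrap mul psi (wrap mul psi g) c as =
        twist psi (\<lambda>a' c'. twist psi (\<lambda>b' c''. g c'' (?m b' (?m a' xs))) c' b) c a"
      using 4 by (simp add: map_last_Cons)
    also have "\<dots> = wrap mul psi g c (mul a b # xs)"
      using 4 by (simp add: twist_mul[OF bilinear_map_last[OF g]] map_last_map_last mul_assoc)
    finally have 1: "wrap mul psi (wrap mul psi g) c as = wrap mul psi g c (mul a b # xs)" .
    have "bar mul (\<lambda>ys. wrap mul psi g c (a # ys)) (b # xs) =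
        bar mul (\<lambda>ys. twist psi (\<lambda>a' c'. g c' (?m a' ys)) c a) (b # xs)"
      by (rule bar_cong_length) (use 4 in \<open>auto simp flip: length_greater_0_conv\<close>)
    also have "\<dots> = twist psi (\<lambda>a' c'. bar mul (\<lambda>ys. g c' (?m a' ys)) (b # xs)) c a"
      by (rule functional_twist[OF functional_bar])
    also have "\<dots> = wrap mul psi (\<lambda>c. bar mul (g c)) c as"
      using 4 by (simp add: bar_map_last mul_assoc del: bar.simps)
    finally show ?thesis using 1 4 by simp
  qed (simp_all add: twist_0)
qed

lemma wrap_diff:
  "wrap mul psi (\<lambda>c as. f c as - g c as) c as = wrap mul psi f c as - wrap mul psi g c as"
  by (simp add: wrap_def twist_diff split: list.split)

lemma entwined_diff_entwined_diff:
  assumes g: "multilinear_cochain sA sC g"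
  shows "entwined_diff mul psi (entwined_diff mul psi g) c as = 0"
  unfolding entwined_diff_def
  by (simp add: wrap_diff functional_diff[OF functional_bar] wrap_wrap[OF g] bar_bar mul_assoc)


section \<open>Moving the coalgebra commutes with the faces\<close>

lemma linear_C_twist_list:
  assumes "multilinear_cochain sA sC g"
  shows "is_linear sC (*) (\<lambda>c. twist_list psi g c as)"
  using assms
proof (induction as arbitrary: g)
  case (Cons a as)
  have "bilinear_form sA sC (\<lambda>a' c'. twist_list psi (\<lambda>c'' xs. g c'' (a' # xs)) c' as)"
    using Cons.prems
    by (intro bilinear_formI Cons.IH multilinear_cochain_Cons twist_list_family)
      (auto simp: multilinear_cochain_iff multilinear_hd)
  then show ?case by (simp add: twist_linear_C)
qed (simp add: multilinear_cochain_def)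

lemma bilinear_twist_list:
  assumes "multilinear_cochain sA sC g"
  shows "bilinear_form sA sC (\<lambda>a c. twist_list psi (\<lambda>c' xs. g c' (a # xs)) c as)"
  using assms
  by (intro bilinear_formI linear_C_twist_list multilinear_cochain_Cons twist_list_family)
    (auto simp: multilinear_cochain_iff multilinear_hd)

text \<open>The entries are moved one after the other, and moving \<open>a\<close> and then \<open>b\<close> is moving \<open>a b\<close>.\<close>

lemma twist_list_bar:
  assumes "multilinear_cochain sA sC g"
  shows "twist_list psi (\<lambda>c. bar mul (g c)) c as = bar mul (twist_list psi g c) as"
  using assms
proof (induction as arbitrary: g c)
  case (Cons a as)
  let ?h = "\<lambda>a' c. \<lambda>xs. g c (a' # xs)"
  have IH: "twist_list psi (\<lambda>c. bar mul (?h a' c)) c' as = bar mul (twist_list psi (?h a') c') as" for a' c'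
    by (rule Cons.IH[OF multilinear_cochain_Cons[OF Cons.prems]])
  have sw: "bar mul (\<lambda>xs. twist_list psi g c (a # xs)) as =
      twist psi (\<lambda>a' c'. bar mul (twist_list psi (?h a') c') as) c a"
    unfolding twist_list_Cons by (rule functional_twist[OF functional_bar])
  show ?case
  proof (cases as)
    case Nil
    then show ?thesis by (simp add: twist_0)
  next
    case (Cons b bs)
    have "twist_list psi (\<lambda>c. bar mul (g c)) c (a # as) =
        twist psi (\<lambda>a' c'. twist psi (\<lambda>b' c''.
          twist_list psi (\<lambda>c xs. g c (mul a' b' # xs)) c'' bs) c' b) c a
        - twist psi (\<lambda>a' c'. twist_list psi (\<lambda>c. bar mul (?h a' c)) c' as) c a"
      by (simp add: Cons twist_list_diff twist_diff)
    also have "\<dots> = twist_list psi g c (mul a b # bs) - bar mul (\<lambda>xs. twist_list psi g c (a # xs)) as"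
      by (simp add: IH sw[simplified] twist_mul[OF bilinear_twist_list[OF Cons.prems]])
    finally show ?thesis by (simp add: Cons)
  qed
qed simp

text \<open>
  On both sides the coalgebra passes \<open>a\<^sub>1, \<dots>, a\<^sub>m\<close> in this order and then \<open>a\<^sub>1\<^sub>\<psi>\<close> once more: on the left
  as a part of the face, on the right as the second factor of the last entry.
\<close>

lemma twist_list_wrap:
  assumes "multilinear_cochain sA sC g"
  shows "twist_list psi (wrap mul psi g) c as = wrap mul psi (twist_list psi g) c as"
proof -
  \<comment> \<open>The entry \<open>a\<close> has already been moved once; it waits in front until the coalgebra has passed \<open>xs\<close>.\<close>
  have *: "twist_list psi (\<lambda>c xs. wrap mul psi g c (a # xs)) c xs =
      twist_list psi g c (map_last (\<lambda>z. mul z a) xs)" if "xs \<noteq> []" for a c xs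
    using that assms
  proof (induction xs arbitrary: g c)
    case (Cons x xs)
    show ?case
    proof (cases "xs = []")
      case True
      have "bilinear_form sA sC (\<lambda>a c. g c [a])"
        using Cons.prems(2)
        by (intro bilinear_formI) (auto simp: multilinear_cochain_iff multilinear_hd)
      then show ?thesis using True by (simp add: twist_mul)
    next
      case False
      have "twist_list psi (\<lambda>c xs. wrap mul psi g c (a # x' # xs)) c' xs =
          twist_list psi (\<lambda>c xs. wrap mul psi (\<lambda>c xs. g c (x' # xs)) c (a # xs)) c' xs" for x' c'
        by (rule twist_list_cong_length)
            (use False in \<open>auto simp: map_last_Cons simp flip: length_greater_0_conv\<close>)
      also have "\<dots> x' c' = twist_list psi (\<lambda>c xs. g c (x' # xs)) c' (map_last (\<lambda>z. mul z a) xs)" for x' c'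
        by (rule Cons.IH[OF False multilinear_cochain_Cons[OF Cons.prems(2)]])
      finally show ?thesis using False by (simp add: map_last_Cons)
    qed
  qed simp
  show ?thesis
  proof (cases as)
    case (Cons a xs)
    then show ?thesis using * by (cases "xs = []") (simp_all add: twist_0)
  qed simp
qed

lemma twist_list_entwined_diff:
  assumes "multilinear_cochain sA sC g"
  shows "twist_list psi (entwined_diff mul psi g) c as = entwined_diff mul psi (twist_list psi g) c as"
  unfolding entwined_diff_def
  by (simp add: twist_list_diff twist_list_wrap[OF assms] twist_list_bar[OF assms])

end


section \<open>The entwining on matrices\<close>

text \<open>A linear map into a tensor product becomes a linear form after evaluation at a bilinear form.\<close>

lemma is_linear_eval_rep:
  assumes "vector_space sA" "vector_space sC" "bilinear_form sA sC F"
    and "linear_into_quotient s (tensor_rel sA sC) P"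
  shows "is_linear s (*) (\<lambda>v. eval_tensor F (rep (P v)))"
  using assms(4) unfolding is_linear_def linear_into_quotient_def
  by (metis eval_tensor_rep_coset[OF assms(1-3)] is_linearD[OF is_linear_eval_tensor])

lemma (in entwining_structure) twist_one:
  assumes "bilinear_form sA sC F"
  shows "twist psi F c one = F one c"
  using A.vector_space_axioms C.vector_space_axioms assms
  by (simp add: twist_def psi_one eval_tensor_rep_coset eval_tensor_basis)

lemma (in entwining_structure) entwined_algebra: "entwined_algebra sA mul sC psi"
proof
  note vs = A.vector_space_axioms C.vector_space_axioms
  show "is_linear sA sA (\<lambda>b. mul a b)" for a
    using A.mul_linear_right by (simp add: linear_iff_is_linear vs)
  show "is_linear sA sA (\<lambda>a. mul a b)" for b
    using A.mul_linear_left by (simp add: linear_iff_is_linear vs)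
  show "is_linear sC (*) (\<lambda>c. twist psi F c a)" if F: "bilinear_form sA sC F" for F a
    unfolding twist_def by (rule is_linear_eval_rep[OF vs F psi_linear_C])
  show "is_linear sA (*) (\<lambda>a. twist psi F c a)" if F: "bilinear_form sA sC F" for F c
    unfolding twist_def by (rule is_linear_eval_rep[OF vs F psi_linear_A])
  show "twist psi F c (mul a b) =
      twist psi (\<lambda>a' c'. twist psi (\<lambda>b' c''. F (mul a' b') c'') c' b) c a"
    if F: "bilinear_form sA sC F" for F c a b
    unfolding twist_def
    by (simp add: psi_mul eval_tensor_rep_coset[OF vs F] eval_tensor_lin_ext eval_tensor_basis)
qed (simp_all add: A.vector_space_axioms C.vector_space_axioms A.mul_assoc)

lemma Emat_entry: "Emat i j a $ p $ q = (if p = i \<and> q = j then a else 0)"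
  by (simp add: Emat_def)

lemma is_linear_entry: "is_linear (mat_scale sA) sA (\<lambda>X. X $ i $ j)"
  by (simp add: is_linear_def mat_scale_def)

context entwined_algebra
begin

lemma scale_simps: "sA k 0 = 0" "sA 0 a = 0" "sA 1 a = a"
  using vector_space_A unfolding module_iff_vector_space[symmetric]
  by (simp_all add: module.scale_zero_right module.scale_zero_left module.scale_one)

lemma mul_zero: "mul a 0 = 0" "mul 0 b = 0"
  using is_linear_0[OF mul_linear_right] is_linear_0[OF mul_linear_left] by simp_all

lemma is_linear_Emat: "is_linear sA (mat_scale sA) (Emat i j)"
  by (simp add: is_linear_def mat_scale_def Emat_def vec_eq_iff scale_simps)

lemma mat_mul_Emat:
  "mat_mul mul (Emat i l a) (Emat p j b) = (if l = p then Emat i j (mul a b) else 0 :: 'a^'n::finite^'n)"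
proof -
  have "(\<Sum>m\<in>UNIV. mul (if r = i \<and> m = l then a else 0) (if m = p \<and> s = j then b else 0)) =
      (\<Sum>m\<in>UNIV. if m = l then (if l = p \<and> r = i \<and> s = j then mul a b else 0) else 0)" for r s
    by (intro sum.cong) (auto simp: mul_zero)
  then show ?thesis by (auto simp: mat_mul_def Emat_def vec_eq_iff)
qed

lemma bilinear_Emat:
  assumes "bilinear_form (mat_scale sA) sC F"
  shows "bilinear_form sA sC (\<lambda>a. F (Emat i j a))"
  using assms unfolding bilinear_form_def
  by (auto intro: is_linear_comp[OF is_linear_Emat])

lemma twist_psi_mat:
  fixes X :: "'a^'n::finite^'n"
  assumes "bilinear_form (mat_scale sA) sC F"
  shows "twist (psi_mat sA sC psi) F c X =
    (\<Sum>i\<in>UNIV. \<Sum>j\<in>UNIV. twist psi (\<lambda>a' c'. F (Emat i j a') c') c (X $ i $ j))"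
proof -
  have "mat_tensor sA a (Emat i j 1) = (Emat i j a :: 'a^'n^'n)" for a i j
    by (simp add: mat_tensor_def Emat_def vec_eq_iff scale_simps)
  then show ?thesis
    unfolding twist_def psi_mat_def
      eval_tensor_rep_coset[OF vector_space_mat_scale[OF vector_space_A] vector_space_C assms]
      is_linear_sum_arg[OF is_linear_eval_tensor] eval_tensor_lin_ext eval_tensor_basis by simp
qed

lemma twist_psi_mat_pairs:
  fixes X :: "'a^'n::finite^'n"
  assumes "bilinear_form (mat_scale sA) sC F"
  shows "twist (psi_mat sA sC psi) F c X =
    (\<Sum>x\<in>UNIV. twist psi (\<lambda>a' c'. F (Emat (fst x) (snd x) a') c') c (X $ fst x $ snd x))"
  by (simp add: twist_psi_mat[OF assms] sum_UNIV_pair)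

lemma twist_zero_arg: "bilinear_form sA sC F \<Longrightarrow> twist psi F c 0 = 0"
  by (rule is_linear_0[OF twist_linear_A])

lemma twist_psi_mat_Emat:
  assumes "bilinear_form (mat_scale sA) sC F"
  shows "twist (psi_mat sA sC psi) F c (Emat i j a :: 'a^'n::finite^'n) =
    twist psi (\<lambda>a' c'. F (Emat i j a') c') c a"
proof -
  have "twist (psi_mat sA sC psi) F c (Emat i j a) =
      (\<Sum>x\<in>UNIV. if x = (i, j) then twist psi (\<lambda>a' c'. F (Emat i j a') c') c a else 0)"
    unfolding twist_psi_mat_pairs[OF assms]
    by (intro sum.cong) (auto simp: Emat_entry twist_zero_arg bilinear_Emat[OF assms])
  then show ?thesis by simp
qed

text \<open>
  The entwining acts on entries, so it commutes with any operation \<open>\<theta>\<close> that only moves, duplicates or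
  deletes entries. The homotopy is built from two such operations.
\<close>

lemma twist_psi_mat_rearrange:
  fixes X :: "'a^'n::finite^'n" and u :: "'n \<times> 'n \<Rightarrow> 'n \<times> 'n" and P :: "'n \<times> 'n \<Rightarrow> bool"
  defines "\<theta> \<equiv> \<lambda>X :: 'a^'n^'n. (\<chi> p q. if P (p, q) then X $ fst (u (p, q)) $ snd (u (p, q)) else 0)"
  assumes F: "bilinear_form (mat_scale sA) sC F"
  shows "twist (psi_mat sA sC psi) F c (\<theta> X) = twist (psi_mat sA sC psi) (\<lambda>X' c'. F (\<theta> X') c') c X"
proof -
  define T where "T y x = twist psi (\<lambda>a c'. F (Emat (fst y) (snd y) a) c') c (X $ fst x $ snd x)" for y x
  have lin: "is_linear (mat_scale sA) (*) (\<lambda>X. F X c')" for c'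
    using F by (simp add: bilinear_form_def)
  have \<theta>: "is_linear (mat_scale sA) (mat_scale sA) \<theta>"
    by (simp add: is_linear_def \<theta>_def mat_scale_def vec_eq_iff scale_simps)
  have F\<theta>: "bilinear_form (mat_scale sA) sC (\<lambda>X c'. F (\<theta> X) c')"
    using F by (auto simp: bilinear_form_def intro: is_linear_comp[OF \<theta>])
  have "twist (psi_mat sA sC psi) F c (\<theta> X) = (\<Sum>y\<in>UNIV. if P y then T y (u y) else 0)"
    unfolding twist_psi_mat_pairs[OF F]
    by (intro sum.cong) (auto simp: \<theta>_def T_def twist_zero_arg bilinear_Emat[OF F])
  also have "\<dots> = (\<Sum>y\<in>UNIV. \<Sum>x\<in>UNIV. if P y \<and> u y = x then T y x else 0)"
  proof (intro sum.cong refl)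
    show "(if P y then T y (u y) else 0) = (\<Sum>x\<in>UNIV. if P y \<and> u y = x then T y x else 0)" for y
      by (cases "P y") simp_all
  qed
  also have "\<dots> = (\<Sum>x\<in>UNIV. \<Sum>y\<in>UNIV. if P y \<and> u y = x then T y x else 0)"
    by (rule sum.swap)
  also have "\<dots> = twist (psi_mat sA sC psi) (\<lambda>X' c'. F (\<theta> X') c') c X"
    unfolding twist_psi_mat_pairs[OF F\<theta>]
  proof (intro sum.cong refl)
    fix x :: "'n \<times> 'n"
    have E: "\<theta> (Emat (fst x) (snd x) a) =
        (\<Sum>y\<in>UNIV. if P y \<and> u y = x then Emat (fst y) (snd y) a else 0)" for a
    proof -
      have "(\<Sum>y\<in>UNIV. if P y \<and> u y = x then Emat (fst y) (snd y) a else 0) $ p $ q =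
          (\<Sum>y\<in>UNIV. if y = (p, q) then (if P (p, q) \<and> u (p, q) = x then a else 0) else 0)" for p q
        unfolding sum_component by (intro sum.cong) (auto simp: Emat_entry)
      then have "(\<Sum>y\<in>UNIV. if P y \<and> u y = x then Emat (fst y) (snd y) a else 0) $ p $ q =
          (if P (p, q) \<and> u (p, q) = x then a else 0)" for p q
        by simp
      then show ?thesis
        unfolding vec_eq_iff by (auto simp: \<theta>_def Emat_entry dest: prod_eqI)
    qed
    have "F (\<theta> (Emat (fst x) (snd x) a)) c' =
        (\<Sum>y\<in>UNIV. if P y \<and> u y = x then F (Emat (fst y) (snd y) a) c' else 0)" for a c'
      unfolding E is_linear_sum_arg[OF lin] by (intro sum.cong) (auto simp: is_linear_0[OF lin])
    then have "twist psi (\<lambda>a c'. F (\<theta> (Emat (fst x) (snd x) a)) c') c (X $ fst x $ snd x) =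
        (\<Sum>y\<in>UNIV. twist psi (\<lambda>a c'. if P y \<and> u y = x then F (Emat (fst y) (snd y) a) c' else 0)
          c (X $ fst x $ snd x))"
      by (simp add: twist_sum)
    also have "\<dots> = (\<Sum>y\<in>UNIV. if P y \<and> u y = x then T y x else 0)"
      by (intro sum.cong) (auto simp: T_def twist_0)
    finally show "(\<Sum>y\<in>UNIV. if P y \<and> u y = x then T y x else 0) =
        twist psi (\<lambda>a c'. F (\<theta> (Emat (fst x) (snd x) a)) c') c (X $ fst x $ snd x)" ..
  qed
  finally show ?thesis .
qed

lemma twist_psi_mat_linear_C:
  assumes "bilinear_form (mat_scale sA) sC F"
  shows "is_linear sC (*) (\<lambda>c. twist (psi_mat sA sC psi) F c (X :: 'a^'n::finite^'n))"
  unfolding twist_psi_mat[OF assms]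
  by (intro is_linear_sum_form twist_linear_C bilinear_Emat assms)

lemma twist_psi_mat_linear_A:
  assumes "bilinear_form (mat_scale sA) sC F"
  shows "is_linear (mat_scale sA) (*) (\<lambda>X. twist (psi_mat sA sC psi) F c (X :: 'a^'n::finite^'n))"
  unfolding twist_psi_mat[OF assms]
  by (intro is_linear_sum_form is_linear_comp[OF is_linear_entry twist_linear_A] bilinear_Emat assms)

lemma mat_mul_linear_right: "is_linear (mat_scale sA) (mat_scale sA) (mat_mul mul (X :: 'a^'n::finite^'n))"
proof -
  have "sA k (\<Sum>l\<in>I. f l) = (\<Sum>l\<in>I. sA k (f l))" for k and f :: "'n \<Rightarrow> 'a" and I
    by (rule module.scale_sum_right) (simp add: module_iff_vector_space vector_space_A)
  then show ?thesis
    by (simp add: is_linear_def mat_mul_def mat_scale_def vec_eq_iff is_linearD[OF mul_linear_right]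
        sum.distrib)
qed

lemma mat_mul_linear_left:
  "is_linear (mat_scale sA) (mat_scale sA) (\<lambda>X. mat_mul mul X (Y :: 'a^'n::finite^'n))"
proof -
  have "sA k (\<Sum>l\<in>I. f l) = (\<Sum>l\<in>I. sA k (f l))" for k and f :: "'n \<Rightarrow> 'a" and I
    by (rule module.scale_sum_right) (simp add: module_iff_vector_space vector_space_A)
  then show ?thesis
    by (simp add: is_linear_def mat_mul_def mat_scale_def vec_eq_iff is_linearD[OF mul_linear_left]
        sum.distrib)
qed

lemma mat_mul_assoc:
  "mat_mul mul (mat_mul mul X Y) Z = mat_mul mul X (mat_mul mul Y (Z :: 'a^'n::finite^'n))"
proof -
  have "(\<Sum>l\<in>UNIV. mul (\<Sum>m\<in>UNIV. mul (X $ i $ m) (Y $ m $ l)) (Z $ l $ j)) =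
      (\<Sum>m\<in>UNIV. mul (X $ i $ m) (\<Sum>l\<in>UNIV. mul (Y $ m $ l) (Z $ l $ j)))" for i j
    unfolding is_linear_sum_arg[OF mul_linear_left] is_linear_sum_arg[OF mul_linear_right] mul_assoc
    by (rule sum.swap)
  then show ?thesis by (simp add: mat_mul_def vec_eq_iff)
qed

text \<open>
  Both sides expand to the sum over \<open>i, l, j\<close> of the contributions of \<open>X\<^sub>i\<^sub>l Y\<^sub>l\<^sub>j\<close>, to which
  multiplicativity of the entwining on \<open>A\<close> applies.
\<close>

lemma twist_psi_mat_mul:
  fixes X Y :: "'a^'n::finite^'n"
  assumes F: "bilinear_form (mat_scale sA) sC F"
  shows "twist (psi_mat sA sC psi) F c (mat_mul mul X Y) =
    twist (psi_mat sA sC psi) (\<lambda>X' c'.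
      twist (psi_mat sA sC psi) (\<lambda>Y' c''. F (mat_mul mul X' Y') c'') c' Y) c X"
proof -
  let ?t = "\<lambda>i j l. twist psi (\<lambda>a' c'. twist psi (\<lambda>b' c''. F (Emat i j (mul a' b')) c'')
    c' (Y $ l $ j)) c (X $ i $ l)"
  have lin: "is_linear (mat_scale sA) (*) (\<lambda>X. F X c')" for c'
    using F by (simp add: bilinear_form_def)
  have F0: "F 0 = (\<lambda>c'. 0)"
    using is_linear_0[OF lin] by auto
  have FX: "bilinear_form (mat_scale sA) sC (\<lambda>Y'. F (mat_mul mul X' Y'))" for X'
    using F unfolding bilinear_form_def by (auto intro: is_linear_comp[OF mat_mul_linear_right])
  have G: "bilinear_form (mat_scale sA) sC
      (\<lambda>X' c'. twist (psi_mat sA sC psi) (\<lambda>Y' c''. F (mat_mul mul X' Y') c'') c' Y)"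
    by (intro bilinear_formI twist_psi_mat_linear_C[OF FX] twist_family
        is_linear_comp[OF mat_mul_linear_left lin])
  have inner: "twist (psi_mat sA sC psi) (\<lambda>Y' c''. F (mat_mul mul (Emat i l a') Y') c'') c' Y =
      (\<Sum>j\<in>UNIV. twist psi (\<lambda>b' c''. F (Emat i j (mul a' b')) c'') c' (Y $ l $ j))" for i l a' c'
  proof -
    have "twist (psi_mat sA sC psi) (\<lambda>Y' c''. F (mat_mul mul (Emat i l a') Y') c'') c' Y =
        (\<Sum>p\<in>UNIV. if p = l then
          \<Sum>j\<in>UNIV. twist psi (\<lambda>b' c''. F (Emat i j (mul a' b')) c'') c' (Y $ l $ j) else 0)"
      unfolding twist_psi_mat[OF FX]
      by (intro sum.cong) (auto simp: mat_mul_Emat F0 twist_0)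
    then show ?thesis by simp
  qed
  have "twist (psi_mat sA sC psi) F c (mat_mul mul X Y) = (\<Sum>i\<in>UNIV. \<Sum>j\<in>UNIV. \<Sum>l\<in>UNIV. ?t i j l)"
    unfolding twist_psi_mat[OF F]
    by (simp add: mat_mul_def is_linear_sum_arg[OF twist_linear_A[OF bilinear_Emat[OF F]]]
        twist_mul[OF bilinear_Emat[OF F]])
  also have "\<dots> = (\<Sum>i\<in>UNIV. \<Sum>l\<in>UNIV. \<Sum>j\<in>UNIV. ?t i j l)"
    by (intro sum.cong refl sum.swap)
  also have "\<dots> = twist (psi_mat sA sC psi) (\<lambda>X' c'.
      twist (psi_mat sA sC psi) (\<lambda>Y' c''. F (mat_mul mul X' Y') c'') c' Y) c X"
    unfolding twist_psi_mat[OF G] inner twist_sum ..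
  finally show ?thesis .
qed

lemma entwined_algebra_mat:
  "entwined_algebra (mat_scale sA) (mat_mul mul) sC
    (psi_mat sA sC psi :: 'c \<Rightarrow> 'a^'n::finite^'n \<Rightarrow> _)"
  by (rule entwined_algebra.intro)
    (simp_all add: vector_space_mat_scale vector_space_A vector_space_C mat_mul_linear_right
      mat_mul_linear_left mat_mul_assoc twist_psi_mat_linear_C twist_psi_mat_linear_A twist_psi_mat_mul)

end

section \<open>The generalized trace\<close>

text \<open>
  The generalized trace of \<open>X\<^sub>1 \<otimes> \<dots> \<otimes> X\<^sub>m\<close> is the sum over all closed paths
  \<open>p\<^sub>0, p\<^sub>1, \<dots>, p\<^sub>m = p\<^sub>0\<close> of the tensors of the entries \<open>(X\<^sub>i)\<^sub>p\<^sub>i\<^sub>-\<^sub>1\<^sub>,\<^sub>p\<^sub>i\<close>. Sums over paths with fixed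
  end points can be computed step by step.
\<close>

primrec path_sum :: "'n \<Rightarrow> 'n \<Rightarrow> ('a list \<Rightarrow> 'k::field) \<Rightarrow> ('a^'n::finite^'n) list \<Rightarrow> 'k"
  where
    "path_sum p q G [] = (if p = q then G [] else 0)"
  | "path_sum p q G (X # Xs) = (\<Sum>l\<in>UNIV. path_sum l q (\<lambda>as. G (X $ p $ l # as)) Xs)"

lemma functional_path_sum: "is_linear fun_scale (*) (\<lambda>G. path_sum p q G Xs)"
proof (induction Xs arbitrary: p)
  case Nil
  then show ?case by (cases "p = q") (simp_all add: is_linear_zero_form functional_point)
next
  case (Cons X Xs)
  show ?case unfolding path_sum.simps by (intro is_linear_sum_form functional_comp[OF Cons.IH])
qed

lemma path_sum_cong_length:
  assumes "\<And>as. length as = length Xs \<Longrightarrow> G as = H as"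
  shows "path_sum p q G Xs = path_sum p q H Xs"
  using assms
proof (induction Xs arbitrary: p G H)
  case (Cons X Xs)
  have "path_sum l q (\<lambda>as. G (X $ p $ l # as)) Xs = path_sum l q (\<lambda>as. H (X $ p $ l # as)) Xs" for l
    by (rule Cons.IH) (simp add: Cons.prems)
  then show ?case by simp
qed simp

lemma path_sum_snoc:
  "path_sum p q G (Xs @ [Z]) = (\<Sum>l\<in>UNIV. path_sum p l (\<lambda>as. G (as @ [Z $ l $ q])) Xs)"
proof (induction Xs arbitrary: p G)
  case (Cons X Xs)
  show ?case
    unfolding append_Cons path_sum.simps Cons.IH by (rule sum.swap)
qed simp

lemma multilinear_path_sum:
  assumes "multilinear sA G"
  shows "multilinear (mat_scale sA) (path_sum p q G)"
proof -
  have "is_linear (mat_scale sA) (*) (\<lambda>X. path_sum p q G (Xs @ X # Ys))" for Xs Ys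
    using assms
  proof (induction Xs arbitrary: p G)
    case Nil
    then show ?case unfolding append_Nil path_sum.simps
      by (intro is_linear_sum_form functional_family[OF functional_path_sum]
          is_linear_comp[OF is_linear_entry multilinear_hd])
  next
    case (Cons X Xs)
    then show ?case unfolding append_Cons path_sum.simps
      by (intro is_linear_sum_form Cons.IH multilinear_Cons)
  qed
  then show ?thesis by (simp add: multilinear_def)
qed

lemma multilinear_cochain_path_sum:
  assumes "multilinear_cochain sA sC g"
  shows "multilinear_cochain (mat_scale sA) sC (\<lambda>c. path_sum p q (g c))"
  using assms
  by (auto simp: multilinear_cochain_iff
      intro!: functional_family[OF functional_path_sum] multilinear_path_sum)

definition trace_cochain :: "('c, 'a, 'k::field) cochain \<Rightarrow> ('c, 'a^'n::finite^'n, 'k) cochain"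
  where "trace_cochain g c Xs = (\<Sum>p\<in>UNIV. path_sum p p (g c) Xs)"

lemma multilinear_cochain_trace:
  assumes "multilinear_cochain sA sC g"
  shows "multilinear_cochain (mat_scale sA) sC (trace_cochain g)"
  using multilinear_cochain_path_sum[OF assms]
  by (auto simp: multilinear_cochain_def trace_cochain_def intro!: is_linear_sum_form)

lemma trace_cochain_fun:
  "trace_cochain g = (\<lambda>c Xs. \<Sum>p\<in>UNIV. path_sum p p (g c) Xs)"
  "trace_cochain g c = (\<lambda>Xs. \<Sum>p\<in>UNIV. path_sum p p (g c) Xs)"
  by (simp_all add: trace_cochain_def fun_eq_iff)

text \<open>The product of the units \<open>e\<^sub>i\<^sub>1\<^sub>j\<^sub>1, e\<^sub>i\<^sub>2\<^sub>j\<^sub>2, \<dots>\<close> has a nonzero \<open>(p, q)\<close> entry only if the pairs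
  form a path from \<open>p\<close> to \<open>q\<close>.\<close>

lemma sum_paths_matrix_units:
  fixes Xs :: "('a^'n::finite^'n) list" and G :: "'a list \<Rightarrow> 'k::field"
  shows "(\<Sum>ps | length ps = length Xs.
      foldr (**) (map (\<lambda>(i, j). Emat i j 1) ps) (mat 1) $ p $ q * G (map2 (\<lambda>X (i, j). X $ i $ j) Xs ps))
    = path_sum p q G Xs"
proof (induction Xs arbitrary: p G)
  case Nil
  have "{ps :: ('n \<times> 'n) list. length ps = 0} = {[]}" by auto
  then show ?case by (simp add: mat_def)
next
  case (Cons X Xs)
  let ?e = "\<lambda>ps. foldr (**) (map (\<lambda>(i, j). Emat i j 1) ps) (mat 1) :: 'k^'n^'n"
  let ?m = "\<lambda>ps. map2 (\<lambda>X (i, j). X $ i $ j) Xs ps"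
  have e: "(Emat i j 1 ** M) $ p $ q = (if i = p then M $ j $ q else 0)" for i j and M :: "'k^'n^'n"
    by (simp add: matrix_matrix_mult_def Emat_def if_distrib[of "\<lambda>x. x * _"] cong: if_cong)
  have "(\<Sum>ps | length ps = length (X # Xs).
      ?e ps $ p $ q * G (map2 (\<lambda>X (i, j). X $ i $ j) (X # Xs) ps)) =
      (\<Sum>i\<in>UNIV. \<Sum>j\<in>UNIV. \<Sum>ps | length ps = length Xs.
        (Emat i j 1 ** ?e ps) $ p $ q * G (X $ i $ j # ?m ps))"
    by (simp add: sum_lists_Suc sum_UNIV_pair)
  also have "\<dots> = (\<Sum>i\<in>UNIV. if i = p then \<Sum>j\<in>UNIV. \<Sum>ps | length ps = length Xs.
        ?e ps $ j $ q * G (X $ p $ j # ?m ps) else 0)"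
    by (intro sum.cong refl) (auto simp: e)
  also have "\<dots> = path_sum p q G (X # Xs)"
    using Cons.IH[of _ "\<lambda>as. G (X $ p $ _ # as)"] by simp
  finally show ?case .
qed

lemma tr_map_eq: "tr_map n g = trace_cochain g"
proof (intro ext)
  fix c Xs
  have "tr_map n g c Xs = (\<Sum>ps | length ps = length Xs.
      trace (foldr (**) (map (\<lambda>(i, j). Emat i j 1) ps) (mat 1)) *
        g c (map2 (\<lambda>X (i, j). X $ i $ j) Xs ps))"
    unfolding tr_map_def gen_trace_def eval_tensor_def[of "\<lambda>c as. g c as", symmetric]
      is_linear_sum_arg[OF is_linear_eval_tensor] is_linearD(2)[OF is_linear_eval_tensor]
      eval_tensor_basis ..
  also have "\<dots> = trace_cochain g c Xs"
    unfolding trace_cochain_def sum_paths_matrix_units[symmetric] trace_def sum_distrib_right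
    by (rule sum.swap)
  finally show "tr_map n g c Xs = trace_cochain g c Xs" .
qed

context entwined_algebra
begin

text \<open>The sum over the intermediate vertex of two steps is the matrix product.\<close>

lemma path_sum_bar:
  fixes Xs :: "('a^'n::finite^'n) list"
  assumes "multilinear sA G"
  shows "path_sum p q (bar mul G) Xs = bar (mat_mul mul) (path_sum p q G) Xs"
  using assms
proof (induction Xs arbitrary: p G)
  case (Cons X Xs)
  let ?G = "\<lambda>l as. G (X $ p $ l # as)"
  have IH: "path_sum l q (bar mul (?G l)) Xs = bar (mat_mul mul) (path_sum l q (?G l)) Xs" for l
    by (rule Cons.IH[OF multilinear_Cons[OF Cons.prems]])
  let ?first = "case Xs of [] \<Rightarrow> 0 | Y # Ys \<Rightarrow> path_sum p q G (mat_mul mul X Y # Ys)"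
  have first: "(\<Sum>l\<in>UNIV. path_sum l q
      (\<lambda>as. case as of [] \<Rightarrow> 0 | b # bs \<Rightarrow> G (mul (X $ p $ l) b # bs)) Xs) = ?first"
  proof (cases Xs)
    case (Cons Y Ys)
    have "(\<Sum>l\<in>UNIV. \<Sum>m\<in>UNIV. path_sum m q (\<lambda>as. G (mul (X $ p $ l) (Y $ l $ m) # as)) Ys) =
        (\<Sum>m\<in>UNIV. \<Sum>l\<in>UNIV. path_sum m q (\<lambda>as. G (mul (X $ p $ l) (Y $ l $ m) # as)) Ys)"
      by (rule sum.swap)
    also have "\<dots> = path_sum p q G (mat_mul mul X Y # Ys)"
      by (simp add: mat_mul_def is_linear_sum_arg[OF multilinear_hd[OF Cons.prems]]
          functional_sum[OF functional_path_sum])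
    finally show ?thesis using Cons by simp
  qed simp
  have "path_sum p q (bar mul G) (X # Xs) =
      ?first - (\<Sum>l\<in>UNIV. bar (mat_mul mul) (path_sum l q (?G l)) Xs)"
    by (simp add: functional_diff[OF functional_path_sum] sum_subtractf first IH)
  also have "\<dots> = ?first - bar (mat_mul mul) (\<lambda>Ys. path_sum p q G (X # Ys)) Xs"
    by (simp add: functional_sum[OF functional_bar])
  finally show ?case by (simp split: list.split)
qed simp

lemma trace_bar:
  assumes "multilinear_cochain sA sC g"
  shows "trace_cochain (\<lambda>c. bar mul (g c)) c Xs = bar (mat_mul mul) (trace_cochain g c) Xs"
  using assms
  by (simp add: trace_cochain_fun functional_sum[OF functional_bar] multilinear_cochain_iff path_sum_bar)

lemma path_sum_0: "path_sum p q (\<lambda>as. 0) = (\<lambda>Xs. 0)"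
  using functional_0[OF functional_path_sum] by fast

text \<open>
  Cyclic invariance of the trace. A closed path based at \<open>p\<close> whose first step \<open>p \<rightarrow> j\<close> is moved to the
  end is a closed path based at \<open>j\<close>.
\<close>

lemma trace_wrap:
  fixes Xs :: "('a^'n::finite^'n) list"
  assumes g: "multilinear_cochain sA sC g"
  shows "trace_cochain (wrap mul psi g) c Xs =
    wrap (mat_mul mul) (psi_mat sA sC psi) (trace_cochain g) c Xs"
proof -
  interpret M: entwined_algebra "mat_scale sA" "mat_mul mul" sC "psi_mat sA sC psi :: 'c \<Rightarrow> 'a^'n^'n \<Rightarrow> _"
    by (rule entwined_algebra_mat)
  consider "Xs = []" | X where "Xs = [X]" | X Ys Z where "Xs = X # Ys @ [Z]"
    by (cases Xs; cases "tl Xs" rule: rev_cases) auto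
  then show ?thesis
  proof cases
    case (3 X Ys Z)
    let ?t = "\<lambda>p j l. twist psi (\<lambda>a' c'. path_sum j l (\<lambda>as. g c' (as @ [mul (Z $ l $ p) a'])) Ys) c (X $ p $ j)"
    have F: "bilinear_form (mat_scale sA) sC
        (\<lambda>A c'. trace_cochain g c' (Ys @ [mat_mul mul Z A]))"
      using M.bilinear_map_last[OF multilinear_cochain_trace[OF g], of "Ys @ [Z]"] by simp
    \<comment> \<open>The product with \<open>e\<^sub>i\<^sub>j(a)\<close> has only one nonzero column, which fixes the base point of the path.\<close>
    have entry: "mat_mul mul Z (Emat i j a) $ l $ p = (if p = j then mul (Z $ l $ i) a else 0)"
      for i j a l p
    proof -
      have "(\<Sum>m\<in>UNIV. mul (Z $ l $ m) (if m = i \<and> p = j then a else 0)) =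
          (\<Sum>m\<in>UNIV. if m = i then (if p = j then mul (Z $ l $ i) a else 0) else 0)"
        by (intro sum.cong) (auto simp: mul_zero)
      then show ?thesis by (simp add: mat_mul_def Emat_def)
    qed
    have last_zero: "g c' (as @ [0]) = 0" for c' as
      using g by (intro is_linear_0[OF multilinear_last]) (auto simp: multilinear_cochain_iff)
    have inner: "trace_cochain g c' (Ys @ [mat_mul mul Z (Emat i j a)]) =
        (\<Sum>l\<in>UNIV. path_sum j l (\<lambda>as. g c' (as @ [mul (Z $ l $ i) a])) Ys)" for i j a c'
    proof -
      have "trace_cochain g c' (Ys @ [mat_mul mul Z (Emat i j a)]) = (\<Sum>p\<in>UNIV. if p = j then
          (\<Sum>l\<in>UNIV. path_sum j l (\<lambda>as. g c' (as @ [mul (Z $ l $ i) a])) Ys) else 0)"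
        unfolding trace_cochain_def path_sum_snoc entry
        by (intro sum.cong) (auto simp: last_zero path_sum_0)
      then show ?thesis by simp
    qed
    have "trace_cochain (wrap mul psi g) c Xs = (\<Sum>p\<in>UNIV. \<Sum>j\<in>UNIV. \<Sum>l\<in>UNIV. ?t p j l)"
      by (simp add: 3 trace_cochain_def path_sum_snoc functional_twist[OF functional_path_sum])
    also have "\<dots> = wrap (mat_mul mul) (psi_mat sA sC psi) (trace_cochain g) c Xs"
      by (simp add: 3 twist_psi_mat[OF F] inner twist_sum)
    finally show ?thesis .
  qed (simp_all add: trace_cochain_def)
qed

lemma trace_entwined_diff:
  assumes "multilinear_cochain sA sC g"
  shows "trace_cochain (entwined_diff mul psi g) c Xs =
    entwined_diff (mat_mul mul) (psi_mat sA sC psi) (trace_cochain g) c Xs"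
proof -
  have "trace_cochain (entwined_diff mul psi g) c Xs =
      trace_cochain (wrap mul psi g) c Xs - trace_cochain (\<lambda>c. bar mul (g c)) c Xs"
    unfolding trace_cochain_def entwined_diff_def
    by (simp add: functional_diff[OF functional_path_sum] sum_subtractf)
  then show ?thesis by (simp add: trace_wrap trace_bar assms entwined_diff_def)
qed

lemma twist_list_path_sum:
  fixes Xs :: "('a^'n::finite^'n) list"
  assumes "multilinear_cochain sA sC g"
  shows "twist_list (psi_mat sA sC psi) (\<lambda>c. path_sum p q (g c)) c Xs = path_sum p q (twist_list psi g c) Xs"
  using assms
proof (induction Xs arbitrary: p g c)
  case (Cons X Xs)
  interpret M: entwined_algebra "mat_scale sA" "mat_mul mul" sC "psi_mat sA sC psi :: 'c \<Rightarrow> 'a^'n^'n \<Rightarrow> _"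
    by (rule entwined_algebra_mat)
  let ?F = "\<lambda>l a c'. twist_list (psi_mat sA sC psi) (\<lambda>c. path_sum l q (\<lambda>as. g c (a # as))) c' Xs"
  let ?tl = "\<lambda>j. twist psi (\<lambda>a' c'. ?F j a' c') c (X $ p $ j)"
  have bil: "bilinear_form (mat_scale sA) sC (\<lambda>X' c'.
      twist_list (psi_mat sA sC psi) (\<lambda>c Ys. path_sum p q (g c) (X' # Ys)) c' Xs)"
    by (rule M.bilinear_twist_list[OF multilinear_cochain_path_sum[OF Cons.prems]])
  have head_zero: "g c (0 # as) = 0" for c as
    using Cons.prems by (intro is_linear_0[OF multilinear_hd]) (auto simp: multilinear_cochain_iff)
  have entry: "?F l (Emat i j a $ p $ l) c' = (if i = p then if l = j then ?F j a c' else 0 else 0)"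
    for i j a l c'
    by (auto simp: Emat_entry head_zero path_sum_0 twist_list_0)
  have inner: "twist_list (psi_mat sA sC psi) (\<lambda>c Ys. path_sum p q (g c) (Emat i j a # Ys)) c' Xs =
      (if i = p then ?F j a c' else 0)" for i j a c'
    unfolding path_sum.simps twist_list_sum entry by simp
  have "twist_list (psi_mat sA sC psi) (\<lambda>c. path_sum p q (g c)) c (X # Xs) =
      (\<Sum>i\<in>UNIV. \<Sum>j\<in>UNIV. twist psi (\<lambda>a' c'. if i = p then ?F j a' c' else 0) c (X $ i $ j))"
    unfolding twist_list_Cons twist_psi_mat[OF bil] inner ..
  also have "\<dots> = (\<Sum>i\<in>UNIV. if i = p then \<Sum>j\<in>UNIV. ?tl j else 0)"
    by (intro sum.cong refl) (auto simp: twist_0)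
  also have "\<dots> = (\<Sum>j\<in>UNIV. twist psi (\<lambda>a' c'.
      path_sum j q (twist_list psi (\<lambda>c as. g c (a' # as)) c') Xs) c (X $ p $ j))"
    using Cons.IH[OF multilinear_cochain_Cons[OF Cons.prems]] by simp
  also have "\<dots> = path_sum p q (twist_list psi g c) (X # Xs)"
    by (simp add: functional_twist[OF functional_path_sum])
  finally show ?case .
qed simp

lemma twist_list_trace:
  assumes "multilinear_cochain sA sC g"
  shows "twist_list (psi_mat sA sC psi) (trace_cochain g) c Xs = trace_cochain (twist_list psi g) c Xs"
  by (simp add: trace_cochain_fun twist_list_sum twist_list_path_sum[OF assms])
end


section \<open>The corner inclusion\<close>

definition corner_cochain :: "'n \<Rightarrow> ('c, 'a::zero^'n::finite^'n, 'k) cochain \<Rightarrow> ('c, 'a, 'k) cochain"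
  where "corner_cochain i g c as = g c (map (Emat i i) as)"

context entwined_algebra
begin

lemma multilinear_cochain_corner:
  assumes "multilinear_cochain (mat_scale sA) sC g"
  shows "multilinear_cochain sA sC (corner_cochain i g)"
  using assms unfolding multilinear_cochain_def corner_cochain_def
  by (auto intro: is_linear_comp[OF is_linear_Emat])

lemma corner_bar: "bar (mat_mul mul) G (map (Emat i i) as :: ('a^'n::finite^'n) list) =
    bar mul (\<lambda>xs. G (map (Emat i i) xs)) as"
proof (induction as arbitrary: G)
  case (Cons a as)
  have "(case map (Emat i i) as of [] \<Rightarrow> 0 | B # Bs \<Rightarrow> G (mat_mul mul (Emat i i a) B # Bs)) =
      (case as of [] \<Rightarrow> 0 | b # bs \<Rightarrow> G (map (Emat i i) (mul a b # bs)))"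
    by (cases as) (simp_all add: mat_mul_Emat)
  then show ?case using Cons.IH[of "\<lambda>xs. G (Emat i i a # xs)"] by simp
qed simp

lemma corner_entwined_diff:
  fixes g :: "('c, 'a^'n::finite^'n, 'k) cochain"
  assumes g: "multilinear_cochain (mat_scale sA) sC g"
  shows "corner_cochain i (entwined_diff (mat_mul mul) (psi_mat sA sC psi) g) c as =
    entwined_diff mul psi (corner_cochain i g) c as"
proof -
  interpret M: entwined_algebra "mat_scale sA" "mat_mul mul" sC "psi_mat sA sC psi :: 'c \<Rightarrow> 'a^'n^'n \<Rightarrow> _"
    by (rule entwined_algebra_mat)
  have "corner_cochain i g c = (\<lambda>as. g c (map (Emat i i) as))"
    by (auto simp: corner_cochain_def)
  moreover have "wrap (mat_mul mul) (psi_mat sA sC psi) g c (map (Emat i i) as) =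
      wrap mul psi (corner_cochain i g) c as"
  proof (cases as)
    case (Cons a xs)
    have "map_last (\<lambda>z. mat_mul mul z (Emat i i a')) (map (Emat i i) xs) =
        map (Emat i i) (map_last (\<lambda>z. mul z a') xs)" for a'
      by (cases xs rule: rev_cases) (simp_all add: mat_mul_Emat)
    then show ?thesis
      using twist_psi_mat_Emat[OF M.bilinear_map_last[OF g, of "map (Emat i i) xs"]]
      by (cases "xs = []") (simp_all add: Cons corner_cochain_def)
  qed simp
  ultimately show ?thesis by (simp add: entwined_diff_def corner_cochain_def[of i "entwined_diff _ _ _"] corner_bar)
qed

lemma twist_list_corner:
  fixes g :: "('c, 'a^'n::finite^'n, 'k) cochain"
  assumes "multilinear_cochain (mat_scale sA) sC g"
  shows "twist_list psi (corner_cochain i g) c as = corner_cochain i (twist_list (psi_mat sA sC psi) g) c as"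
  using assms
proof (induction as arbitrary: g c)
  case (Cons a as)
  interpret M: entwined_algebra "mat_scale sA" "mat_mul mul" sC "psi_mat sA sC psi :: 'c \<Rightarrow> 'a^'n^'n \<Rightarrow> _"
    by (rule entwined_algebra_mat)
  have "(\<lambda>c xs. corner_cochain i g c (a' # xs)) = corner_cochain i (\<lambda>c Xs. g c (Emat i i a' # Xs))" for a'
    by (auto simp: corner_cochain_def fun_eq_iff)
  then have IH: "twist_list psi (\<lambda>c xs. corner_cochain i g c (a' # xs)) c' as =
      twist_list (psi_mat sA sC psi) (\<lambda>c Xs. g c (Emat i i a' # Xs)) c' (map (Emat i i) as)" for a' c'
    using Cons.IH[OF multilinear_cochain_Cons[OF Cons.prems]]
    by (simp add: corner_cochain_def[of i "twist_list _ _"])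
  show ?case
    unfolding twist_list_Cons IH
    by (simp add: corner_cochain_def twist_psi_mat_Emat[OF M.bilinear_twist_list[OF Cons.prems]])
qed (simp add: corner_cochain_def)

text \<open>The only closed path through nonzero entries of matrices in the corner is the constant one.\<close>

lemma corner_trace:
  assumes g: "multilinear_cochain sA sC g" and "as \<noteq> []"
  shows "corner_cochain i (trace_cochain g) c as = g c as"
proof -
  have start: "path_sum i q G (map (Emat i i) as) = (if q = i then G as else 0)"
    if "multilinear sA G" for q G as
    using that
  proof (induction as arbitrary: G)
    case (Cons a as)
    have "(\<Sum>l\<in>UNIV. path_sum l q (\<lambda>as. G (Emat i i a $ i $ l # as)) (map (Emat i i) as)) =
        (\<Sum>l\<in>UNIV. if l = i then path_sum i q (\<lambda>as. G (a # as)) (map (Emat i i) as) else 0)"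
      by (intro sum.cong refl)
        (auto simp: Emat_entry is_linear_0[OF multilinear_hd[OF Cons.prems]] path_sum_0)
    then show ?case using Cons.IH[OF multilinear_Cons[OF Cons.prems]] by simp
  qed auto
  have G: "multilinear sA (g c)" using g by (simp add: multilinear_cochain_iff)
  have "path_sum p p (g c) (map (Emat i i) as) = (if p = i then g c as else 0)" for p
  proof (cases "p = i")
    case False
    then show ?thesis using assms(2)
      by (cases as) (simp_all add: Emat_entry is_linear_0[OF multilinear_hd[OF G]] path_sum_0)
  qed (simp add: start G)
  then show ?thesis by (simp add: corner_cochain_def trace_cochain_def)
qed

end

section \<open>The homotopy\<close>

text \<open>The index \<open>i1\<close> is the one called \<open>1\<close> in the comments on matrix units.\<close>

locale matrix_entwining = entwined_algebra sA mul sC psi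
  for sA :: "'k::field \<Rightarrow> 'a::ab_group_add \<Rightarrow> 'a" and mul :: "'a \<Rightarrow> 'a \<Rightarrow> 'a"
    and sC :: "'k \<Rightarrow> 'c::ab_group_add \<Rightarrow> 'c"
    and psi :: "'c \<Rightarrow> 'a \<Rightarrow> ('a \<times> 'c \<Rightarrow>\<^sub>0 'k) set" +
  fixes one :: 'a and i1 :: "'n::finite"
  assumes mul_one_left: "mul one a = a" and mul_one_right: "mul a one = a"
    and twist_one: "bilinear_form sA sC F \<Longrightarrow> twist psi F c one = F one c"
begin

abbreviation psiM :: "'c \<Rightarrow> 'a^'n^'n \<Rightarrow> (('a^'n^'n) \<times> 'c \<Rightarrow>\<^sub>0 'k) set"
  where "psiM \<equiv> psi_mat sA sC psi"

abbreviation mulM :: "'a^'n^'n \<Rightarrow> 'a^'n^'n \<Rightarrow> 'a^'n^'n" where "mulM \<equiv> mat_mul mul"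

abbreviation scaleM :: "'k \<Rightarrow> 'a^'n^'n \<Rightarrow> 'a^'n^'n" where "scaleM \<equiv> mat_scale sA"

sublocale M: entwined_algebra scaleM mulM sC psiM
  by (rule entwined_algebra_mat)

text \<open>
  In terms of matrix units, \<open>corner_entry q l X\<close> is \<open>e\<^sub>1\<^sub>q X e\<^sub>l\<^sub>1\<close>, \<open>first_row_unit q\<close> is \<open>e\<^sub>1\<^sub>q\<close> and
  \<open>move_column k X\<close> is \<open>X e\<^sub>k\<^sub>1\<close>. The formulas by entries exhibit the first and the third as
  rearrangements.
\<close>

definition corner_entry :: "'n \<Rightarrow> 'n \<Rightarrow> 'a^'n^'n \<Rightarrow> 'a^'n^'n"
  where "corner_entry q l X = Emat i1 i1 (X $ q $ l)"

definition first_row_unit :: "'n \<Rightarrow> 'a^'n^'n"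
  where "first_row_unit q = Emat i1 q one"

definition move_column :: "'n \<Rightarrow> 'a^'n^'n \<Rightarrow> 'a^'n^'n"
  where "move_column k X = (\<chi> p q. if q = i1 then X $ p $ k else 0)"

lemma is_linear_corner_entry: "is_linear scaleM scaleM (corner_entry q l)"
  unfolding corner_entry_def by (rule is_linear_comp[OF is_linear_entry is_linear_Emat])

lemma is_linear_move_column: "is_linear scaleM scaleM (move_column k)"
  by (simp add: is_linear_def move_column_def mat_scale_def vec_eq_iff scale_simps)

lemma twist_corner_entry:
  assumes "bilinear_form scaleM sC F"
  shows "twist psiM F c (corner_entry q l X) = twist psiM (\<lambda>X' c'. F (corner_entry q l X') c') c X"
proof -
  have "corner_entry q l = (\<lambda>X. \<chi> p r. if (p, r) = (i1, i1) then X $ fst (q, l) $ snd (q, l) else 0)"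
    by (auto simp: corner_entry_def Emat_def fun_eq_iff vec_eq_iff)
  then show ?thesis
    using twist_psi_mat_rearrange[OF assms, where c = c and X = X and P = "\<lambda>x. x = (i1, i1)"
        and u = "\<lambda>_. (q, l)"]
    by simp
qed

lemma twist_move_column:
  assumes "bilinear_form scaleM sC F"
  shows "twist psiM F c (move_column k X) = twist psiM (\<lambda>X' c'. F (move_column k X') c') c X"
proof -
  have eq: "move_column k = (\<lambda>X. \<chi> p q. if snd (p, q) = i1
      then X $ fst (fst (p, q), k) $ snd (fst (p, q), k) else 0)"
    by (simp add: move_column_def fun_eq_iff)
  show ?thesis
    unfolding eq
    by (rule twist_psi_mat_rearrange[OF assms, where P = "\<lambda>x. snd x = i1" and u = "\<lambda>x. (fst x, k)"])
qed

lemma twist_first_row_unit: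
  assumes "bilinear_form scaleM sC F"
  shows "twist psiM F c (first_row_unit q) = F (first_row_unit q) c"
  unfolding first_row_unit_def
  by (simp add: twist_psi_mat_Emat[OF assms] twist_one[OF bilinear_Emat[OF assms]])

lemma mat_mul_entry: "mulM X Y $ p $ r = (\<Sum>m\<in>UNIV. mul (X $ p $ m) (Y $ m $ r))"
  by (simp add: mat_mul_def)

lemma sum_corner_entry_row_unit:
  "(\<Sum>l\<in>UNIV. mulM (corner_entry q l X) (first_row_unit l)) = mulM (first_row_unit q) X"
proof -
  have "(\<Sum>l\<in>UNIV. mulM (corner_entry q l X) (first_row_unit l)) $ p $ r =
      (if p = i1 then X $ q $ r else 0)" for p r
    by (simp add: corner_entry_def first_row_unit_def mat_mul_Emat Emat_entry mul_one_right)
  moreover have "mulM (first_row_unit q) X $ p $ r = (if p = i1 then X $ q $ r else 0)" for p r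
  proof -
    have "mulM (first_row_unit q) X $ p $ r =
        (\<Sum>l\<in>UNIV. if l = q then (if p = i1 then X $ q $ r else 0) else 0)"
      unfolding mat_mul_entry first_row_unit_def
      by (intro sum.cong refl) (auto simp: Emat_entry mul_one_left mul_zero)
    then show ?thesis by simp
  qed
  ultimately show ?thesis by (simp add: vec_eq_iff)
qed

lemma sum_corner_entry_mul:
  "(\<Sum>l\<in>UNIV. mulM (corner_entry q l X) (corner_entry l m Y)) = corner_entry q m (mulM X Y)"
  by (simp add: corner_entry_def mat_mul_Emat mat_mul_entry is_linear_sum_arg[OF is_linear_Emat])

lemma mul_move_column: "mulM X (move_column k Y) = move_column k (mulM X Y)"
  by (auto simp: mat_mul_def move_column_def vec_eq_iff mul_zero)

lemma row_unit_mul_move_column: "mulM (first_row_unit l) (move_column k Z) = Emat i1 i1 (Z $ l $ k)"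
proof -
  have "mulM (first_row_unit l) (move_column k Z) $ p $ r =
      (\<Sum>m\<in>UNIV. if m = l then (if p = i1 \<and> r = i1 then Z $ l $ k else 0) else 0)" for p r
    unfolding mat_mul_entry first_row_unit_def move_column_def
    by (intro sum.cong refl) (auto simp: Emat_entry mul_one_left mul_zero)
  then show ?thesis by (simp add: vec_eq_iff Emat_entry)
qed

lemma sum_move_column_mul_row_unit:
  "(\<Sum>k\<in>UNIV. mulM (move_column k Z) (first_row_unit k)) = Z"
proof -
  have "mulM (move_column k Z) (first_row_unit k) $ p $ r = (if r = k then Z $ p $ k else 0)" for k p r
  proof -
    have "mulM (move_column k Z) (first_row_unit k) $ p $ r =
        (\<Sum>m\<in>UNIV. if m = i1 then (if r = k then Z $ p $ k else 0) else 0)"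
      unfolding mat_mul_entry first_row_unit_def move_column_def
      by (intro sum.cong refl) (auto simp: Emat_entry mul_one_right mul_zero)
    then show ?thesis by simp
  qed
  then show ?thesis by (simp add: vec_eq_iff)
qed

lemma sum_move_column_mul_corner_entry:
  "(\<Sum>k\<in>UNIV. mulM (move_column k Z) (corner_entry k l X)) = move_column l (mulM Z X)"
proof -
  have "mulM (move_column k Z) (corner_entry k l X) $ p $ r =
      (if r = i1 then mul (Z $ p $ k) (X $ k $ l) else 0)" for k p r
  proof -
    have "mulM (move_column k Z) (corner_entry k l X) $ p $ r =
        (\<Sum>m\<in>UNIV. if m = i1 then (if r = i1 then mul (Z $ p $ k) (X $ k $ l) else 0) else 0)"
      unfolding mat_mul_entry corner_entry_def move_column_def
      by (intro sum.cong refl) (auto simp: Emat_entry mul_zero)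
    then show ?thesis by simp
  qed
  then show ?thesis by (auto simp: vec_eq_iff move_column_def mat_mul_def)
qed

text \<open>
  For \<open>q\<close> fixed, this is the alternating sum over \<open>j < m\<close> and over all paths \<open>q = l\<^sub>0, l\<^sub>1, \<dots>, l\<^sub>j = l\<close> of
  the value of \<open>G\<close> at \<open>e\<^sub>1\<^sub>1(x\<^sub>1), \<dots>, e\<^sub>1\<^sub>1(x\<^sub>j), e\<^sub>1\<^sub>l(1), X\<^sub>j\<^sub>+\<^sub>1, \<dots>, X\<^sub>m\<close>, where \<open>x\<^sub>i\<close> is the
  entry of \<open>X\<^sub>i\<close> at \<open>(l\<^sub>i\<^sub>-\<^sub>1, l\<^sub>i)\<close>. The value at the empty list excludes \<open>j = m\<close>: the row unit
  stands before the last entry at the latest.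
\<close>

primrec prefix_sum :: "'n \<Rightarrow> (('a^'n^'n) list \<Rightarrow> 'k) \<Rightarrow> ('a^'n^'n) list \<Rightarrow> 'k"
  where
    "prefix_sum q G [] = 0"
  | "prefix_sum q G (X # Xs) = G (first_row_unit q # X # Xs)
      - (\<Sum>l\<in>UNIV. prefix_sum l (\<lambda>Ys. G (corner_entry q l X # Ys)) Xs)"

lemma functional_prefix_sum: "is_linear fun_scale (*) (\<lambda>G. prefix_sum q G Xs)"
proof (induction Xs arbitrary: q)
  case (Cons X Xs)
  show ?case unfolding prefix_sum.simps
    by (intro is_linear_diff_form functional_point is_linear_sum_form functional_comp[OF Cons.IH])
qed (simp add: is_linear_zero_form)

lemma prefix_sum_cong_length:
  assumes "\<And>Ys. length Ys = Suc (length Xs) \<Longrightarrow> G Ys = H Ys"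
  shows "prefix_sum q G Xs = prefix_sum q H Xs"
  using assms
proof (induction Xs arbitrary: q G H)
  case (Cons X Xs)
  have "prefix_sum l (\<lambda>Ys. G (corner_entry q l X # Ys)) Xs =
      prefix_sum l (\<lambda>Ys. H (corner_entry q l X # Ys)) Xs" for l
    by (rule Cons.IH) (simp add: Cons.prems)
  then show ?case using Cons.prems by simp
qed simp

lemma multilinear_prefix_sum:
  assumes "multilinear scaleM G"
  shows "multilinear scaleM (prefix_sum q G)"
proof -
  have "is_linear scaleM (*) (\<lambda>X. prefix_sum q G (Xs @ X # Ys))" for Xs Ys
    using assms
  proof (induction Xs arbitrary: q G)
    case Nil
    then show ?case unfolding append_Nil prefix_sum.simps
      by (intro is_linear_diff_form multilinear_second is_linear_sum_form
          functional_family[OF functional_prefix_sum]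
          is_linear_comp[OF is_linear_corner_entry multilinear_hd])
  next
    case (Cons X Xs)
    have "is_linear scaleM (*) (\<lambda>Y. G ([first_row_unit q, X] @ Xs @ Y # Ys))"
      using multilinearD[OF Cons.prems, of "[first_row_unit q, X] @ Xs" Ys] by simp
    then show ?case unfolding append_Cons append_Nil prefix_sum.simps
      by (intro is_linear_diff_form is_linear_sum_form Cons.IH multilinear_Cons Cons.prems)
  qed
  then show ?thesis by (simp add: multilinear_def)
qed

lemma multilinear_cochain_prefix_sum:
  assumes "multilinear_cochain scaleM sC g"
  shows "multilinear_cochain scaleM sC (\<lambda>c. prefix_sum q (g c))"
  using assms
  by (auto simp: multilinear_cochain_iff
      intro!: functional_family[OF functional_prefix_sum] multilinear_prefix_sum)

lemma prefix_sum_map_last: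
  assumes "Xs \<noteq> []"
  shows "prefix_sum q (\<lambda>Ys. G (map_last f Ys)) Xs = prefix_sum q G (map_last f Xs)"
  using assms
proof (induction Xs arbitrary: q G)
  case (Cons X Xs)
  show ?case
  proof (cases "Xs = []")
    case False
    have "prefix_sum l (\<lambda>Ys. G (map_last f (corner_entry q l X # Ys))) Xs =
        prefix_sum l (\<lambda>Ys. G (corner_entry q l X # map_last f Ys)) Xs" for l
      by (rule prefix_sum_cong_length) (auto simp: map_last_Cons simp flip: length_greater_0_conv)
    also have "\<dots> l = prefix_sum l (\<lambda>Ys. G (corner_entry q l X # Ys)) (map_last f Xs)" for l
      by (rule Cons.IH[OF False])
    finally show ?thesis using False by (simp add: map_last_Cons)
  qed simp
qed simp

text \<open>
  Consecutive terms of \<open>prefix_sum\<close> share the faces next to the row unit, by the two identities for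
  products with \<open>corner_entry\<close>. All that survives of the bar faces is the product of the row unit
  with the last entry.
\<close>

lemma prefix_sum_bar:
  assumes "multilinear scaleM G"
  shows "prefix_sum q (bar mulM G) (Xs @ [W]) + bar mulM (prefix_sum q G) (Xs @ [W]) =
    (\<Sum>l\<in>UNIV. path_sum q l (\<lambda>as. G (map (Emat i1 i1) as @ [mulM (first_row_unit l) W])) Xs)"
  using assms
proof (induction Xs arbitrary: q G)
  case (Cons X Xs)
  obtain Y Ys where Ys: "Xs @ [W] = Y # Ys" by (cases "Xs @ [W]") auto
  let ?G = "\<lambda>l Zs. G (corner_entry q l X # Zs)"
  let ?S = "\<lambda>l. prefix_sum l (bar mulM (?G l)) (Y # Ys)"
  let ?B = "\<lambda>l. bar mulM (prefix_sum l (?G l)) (Y # Ys)"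
  let ?u = "first_row_unit q"
  let ?m = "\<lambda>l Zs. case Zs of [] \<Rightarrow> 0 | Z # Zs' \<Rightarrow> G (mulM (corner_entry q l X) Z # Zs')"
  \<comment> \<open>The faces \<open>e\<^sub>1\<^sub>1(x) e\<^sub>1\<^sub>l(1)\<close> and \<open>e\<^sub>1\<^sub>1(x) e\<^sub>1\<^sub>1(y)\<close>, summed over the vertex between the two factors.\<close>
  have middle: "(\<Sum>l\<in>UNIV. prefix_sum l (?m l) (Y # Ys)) = G (mulM ?u X # Y # Ys) -
      (\<Sum>m\<in>UNIV. prefix_sum m (\<lambda>Zs. G (corner_entry q m (mulM X Y) # Zs)) Ys)"
  proof -
    have "(\<Sum>l\<in>UNIV. prefix_sum l (?m l) (Y # Ys)) =
        (\<Sum>l\<in>UNIV. G (mulM (corner_entry q l X) (first_row_unit l) # Y # Ys)) -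
        (\<Sum>l\<in>UNIV. \<Sum>m\<in>UNIV. prefix_sum m (\<lambda>Zs. G (mulM (corner_entry q l X) (corner_entry l m Y) # Zs)) Ys)"
      by (simp add: sum_subtractf)
    also have "(\<Sum>l\<in>UNIV. G (mulM (corner_entry q l X) (first_row_unit l) # Y # Ys)) = G (mulM ?u X # Y # Ys)"
      by (simp add: sum_corner_entry_row_unit flip: is_linear_sum_arg[OF multilinear_hd[OF Cons.prems]])
    also have "(\<Sum>l\<in>UNIV. \<Sum>m\<in>UNIV. prefix_sum m (\<lambda>Zs. G (mulM (corner_entry q l X) (corner_entry l m Y) # Zs)) Ys) =
        (\<Sum>m\<in>UNIV. \<Sum>l\<in>UNIV. prefix_sum m (\<lambda>Zs. G (mulM (corner_entry q l X) (corner_entry l m Y) # Zs)) Ys)"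
      by (rule sum.swap)
    also have "\<dots> = (\<Sum>m\<in>UNIV. prefix_sum m (\<lambda>Zs. G (corner_entry q m (mulM X Y) # Zs)) Ys)"
      by (simp add: is_linear_sum_arg[OF multilinear_hd[OF Cons.prems]]
          functional_sum[OF functional_prefix_sum] flip: sum_corner_entry_mul)
    finally show ?thesis .
  qed
  have first: "bar mulM G (?u # X # Y # Ys) = G (mulM ?u X # Y # Ys) - G (?u # mulM X Y # Ys)
      + bar mulM (\<lambda>Zs. G (?u # X # Zs)) (Y # Ys)"
    unfolding bar.simps(2)[of mulM _ ?u] bar.simps(2)[of mulM _ X] by (simp del: bar.simps)
  have tail: "prefix_sum l (\<lambda>Zs. bar mulM G (corner_entry q l X # Zs)) (Y # Ys) =
      prefix_sum l (?m l) (Y # Ys) - ?S l" for l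
    unfolding bar.simps(2)[of mulM G "corner_entry q l X"]
    by (rule functional_diff[OF functional_prefix_sum])
  have "prefix_sum q (bar mulM G) (X # Y # Ys) = bar mulM G (?u # X # Y # Ys)
      - (\<Sum>l\<in>UNIV. prefix_sum l (?m l) (Y # Ys)) + (\<Sum>l\<in>UNIV. ?S l)"
    unfolding prefix_sum.simps(2)[of q _ X] tail
    by (simp add: sum_subtractf del: bar.simps prefix_sum.simps)
  moreover have "bar mulM (prefix_sum q G) (X # Y # Ys) = prefix_sum q G (mulM X Y # Ys)
      - bar mulM (\<lambda>Zs. G (?u # X # Zs)) (Y # Ys) + (\<Sum>l\<in>UNIV. ?B l)"
    unfolding bar.simps(2)[of mulM _ X] prefix_sum.simps(2)[of q G X]
      functional_diff[OF functional_bar] functional_sum[OF functional_bar]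
    by (simp del: bar.simps prefix_sum.simps)
  ultimately have "prefix_sum q (bar mulM G) (X # Y # Ys) + bar mulM (prefix_sum q G) (X # Y # Ys) =
      (\<Sum>l\<in>UNIV. ?S l + ?B l)"
    unfolding first middle prefix_sum.simps(2)[of q G "mulM X Y"]
    by (simp add: sum.distrib del: bar.simps prefix_sum.simps)
  also have "\<dots> = (\<Sum>l\<in>UNIV. \<Sum>m\<in>UNIV.
      path_sum l m (\<lambda>as. ?G l (map (Emat i1 i1) as @ [mulM (first_row_unit m) W])) Xs)"
    using Cons.IH[OF multilinear_Cons[OF Cons.prems]] by (simp add: Ys)
  also have "\<dots> = (\<Sum>m\<in>UNIV. path_sum q m
      (\<lambda>as. G (map (Emat i1 i1) as @ [mulM (first_row_unit m) W])) (X # Xs))"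
    by (simp add: corner_entry_def) (rule sum.swap)
  finally show ?case by (simp only: append_Cons Ys)
qed simp

text \<open>
  The last matrix is replaced by \<open>X\<^sub>m e\<^sub>k\<^sub>1\<close> and the path starts at \<open>k\<close>: this is what makes
  the wrapping of the row unit \<open>e\<^sub>1\<^sub>k(1)\<close> restore \<open>X\<^sub>m\<close>, as the sum of the \<open>X\<^sub>m e\<^sub>k\<^sub>1 e\<^sub>1\<^sub>k\<close>.
\<close>

definition homotopy :: "('c, 'a^'n^'n, 'k) cochain \<Rightarrow> ('c, 'a^'n^'n, 'k) cochain"
  where "homotopy g c Xs = (\<Sum>k\<in>UNIV. prefix_sum k (g c) (map_last (move_column k) Xs))"

lemma multilinear_cochain_homotopy:
  assumes "multilinear_cochain scaleM sC g"
  shows "multilinear_cochain scaleM sC (homotopy g)"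
proof -
  have "multilinear scaleM (\<lambda>Xs. prefix_sum k (g c) (map_last (move_column k) Xs))" for k c
    using assms by (intro multilinear_map_last is_linear_move_column multilinear_prefix_sum)
      (auto simp: multilinear_cochain_iff)
  then show ?thesis
    using assms unfolding multilinear_cochain_iff homotopy_def[abs_def]
    by (auto intro!: is_linear_sum_form functional_family[OF functional_prefix_sum] multilinear_sum)
qed

text \<open>By \<open>e\<^sub>1\<^sub>l Z e\<^sub>k\<^sub>1 = e\<^sub>1\<^sub>1(Z\<^sub>l\<^sub>k)\<close> the surviving faces close the path from \<open>k\<close> to \<open>l\<close> through the last
  matrix and add up to the trace in the corner.\<close>

lemma homotopy_bar:
  assumes "multilinear_cochain scaleM sC g" "Xs \<noteq> []"
  shows "homotopy (\<lambda>c. bar mulM (g c)) c Xs + bar mulM (homotopy g c) Xs =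
    trace_cochain (corner_cochain i1 g) c Xs"
proof -
  obtain Ys Z where Xs: "Xs = Ys @ [Z]" using assms(2) by (cases Xs rule: rev_cases) auto
  have G: "multilinear scaleM (g c)" using assms(1) by (simp add: multilinear_cochain_iff)
  have "bar mulM (homotopy g c) Xs = (\<Sum>k\<in>UNIV. bar mulM (prefix_sum k (g c)) (map_last (move_column k) Xs))"
    unfolding homotopy_def[abs_def]
    by (simp add: functional_sum[OF functional_bar] bar_map_last mul_move_column)
  then have "homotopy (\<lambda>c. bar mulM (g c)) c Xs + bar mulM (homotopy g c) Xs =
      (\<Sum>k\<in>UNIV. prefix_sum k (bar mulM (g c)) (Ys @ [move_column k Z])
        + bar mulM (prefix_sum k (g c)) (Ys @ [move_column k Z]))"
    by (simp add: homotopy_def Xs sum.distrib)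
  also have "\<dots> = trace_cochain (corner_cochain i1 g) c Xs"
    unfolding prefix_sum_bar[OF G] row_unit_mul_move_column
    by (simp add: trace_cochain_def Xs path_sum_snoc corner_cochain_def)
  finally show ?thesis .
qed

lemma sum_map_last:
  assumes "multilinear scaleM G" "Xs \<noteq> []"
  shows "(\<Sum>k\<in>UNIV. G (map_last (f k) Xs)) = G (map_last (\<lambda>z. \<Sum>k\<in>UNIV. f k z) Xs)"
  using assms(2) by (cases Xs rule: rev_cases)
    (simp_all add: is_linear_sum_arg[OF multilinear_last[OF assms(1)]])

text \<open>
  The wrapping face of the terms with \<open>j = 0\<close> returns the cochain itself. In the terms with \<open>j > 0\<close> the
  wrapped entry is \<open>e\<^sub>1\<^sub>1(x\<^sub>1)\<close>, and the sum over \<open>k\<close> of \<open>Z e\<^sub>k\<^sub>1 e\<^sub>1\<^sub>1(X\<^sub>k\<^sub>l) = Z e\<^sub>k\<^sub>k X e\<^sub>l\<^sub>1\<close> is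
  \<open>Z X e\<^sub>l\<^sub>1\<close>, which is what the homotopy produces after wrapping \<open>X\<close>. The two occur with opposite signs.
\<close>

lemma homotopy_wrap:
  assumes g: "multilinear_cochain scaleM sC g" and "Xs \<noteq> []"
  shows "homotopy (wrap mulM psiM g) c Xs + wrap mulM psiM (homotopy g) c Xs = g c Xs"
proof -
  obtain X Ys where Xs: "Xs = X # Ys" using assms(2) by (cases Xs) auto
  have G: "multilinear scaleM (g c)" for c using g by (simp add: multilinear_cochain_iff)
  let ?u = "first_row_unit" and ?col = "move_column"
  let ?rest = "\<lambda>k Ys. \<Sum>l\<in>UNIV. prefix_sum l (\<lambda>Zs. wrap mulM psiM g c (corner_entry k l X # Zs)) Ys"
  have unit: "(\<Sum>k\<in>UNIV. wrap mulM psiM g c (?u k # map_last (?col k) Xs)) = g c Xs"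
  proof -
    have "wrap mulM psiM g c (?u k # map_last (?col k) Xs) =
        g c (map_last (\<lambda>z. mulM z (?u k)) (map_last (?col k) Xs))" for k
      using assms(2) by (simp add: twist_first_row_unit[OF M.bilinear_map_last[OF g]])
    moreover have "map_last (\<lambda>z. z) Xs = Xs"
      by (cases Xs rule: rev_cases) simp_all
    ultimately show ?thesis
      by (simp add: map_last_map_last sum_map_last[OF G assms(2)] sum_move_column_mul_row_unit)
  qed
  show ?thesis
  proof (cases "Ys = []")
    case True
    then show ?thesis using unit by (simp add: Xs homotopy_def)
  next
    case False
    let ?T = "\<lambda>k l. twist psiM (\<lambda>A c'. prefix_sum l (g c')
      (map_last (\<lambda>z. mulM (?col k z) (corner_entry k l A)) Ys)) c X"
    have rest: "prefix_sum l (\<lambda>Zs. wrap mulM psiM g c (corner_entry k l X # Zs)) (map_last (?col k) Ys)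
        = ?T k l" for k l
    proof -
      have "prefix_sum l (\<lambda>Zs. wrap mulM psiM g c (corner_entry k l X # Zs)) (map_last (?col k) Ys) =
          prefix_sum l (\<lambda>Zs. twist psiM (\<lambda>A c'. g c' (map_last (\<lambda>z. mulM z A) Zs)) c (corner_entry k l X))
            (map_last (?col k) Ys)"
        by (rule prefix_sum_cong_length) (auto simp flip: length_greater_0_conv)
      also have "\<dots> = twist psiM (\<lambda>A c'. prefix_sum l (g c') (map_last (\<lambda>z. mulM z A) (map_last (?col k) Ys)))
          c (corner_entry k l X)"
        using False by (simp add: functional_twist[OF functional_prefix_sum] prefix_sum_map_last)
      also have "\<dots> = ?T k l"
        using twist_corner_entry[OF M.bilinear_map_last[OF multilinear_cochain_prefix_sum[OF g],
              of "map_last (?col k) Ys"]] False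
        by (simp add: map_last_map_last)
      finally show ?thesis .
    qed
    have columns: "prefix_sum l (g c') (map_last (?col l) (map_last (\<lambda>z. mulM z A) Ys)) =
        (\<Sum>k\<in>UNIV. prefix_sum l (g c') (map_last (\<lambda>z. mulM (?col k z) (corner_entry k l A)) Ys))" for l A c'
      unfolding sum_map_last[OF multilinear_prefix_sum[OF G] False]
      by (simp add: map_last_map_last sum_move_column_mul_corner_entry)
    have "wrap mulM psiM (homotopy g) c Xs = (\<Sum>l\<in>UNIV. \<Sum>k\<in>UNIV. ?T k l)"
      using False by (simp add: Xs homotopy_def columns twist_sum)
    also have "\<dots> = (\<Sum>k\<in>UNIV. \<Sum>l\<in>UNIV. ?T k l)" by (rule sum.swap)
    finally have "wrap mulM psiM (homotopy g) c Xs = (\<Sum>k\<in>UNIV. \<Sum>l\<in>UNIV. ?T k l)" .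
    moreover have "homotopy (wrap mulM psiM g) c Xs =
        (\<Sum>k\<in>UNIV. wrap mulM psiM g c (?u k # map_last (?col k) Xs)) - (\<Sum>k\<in>UNIV. \<Sum>l\<in>UNIV. ?T k l)"
      using False rest by (simp add: homotopy_def Xs map_last_Cons sum_subtractf)
    ultimately show ?thesis using unit by simp
  qed
qed

lemma homotopy_diff: "homotopy (\<lambda>c Xs. f c Xs - g c Xs) c Xs = homotopy f c Xs - homotopy g c Xs"
  by (simp add: homotopy_def functional_diff[OF functional_prefix_sum] sum_subtractf)

theorem homotopy_formula:
  assumes "multilinear_cochain scaleM sC g" "Xs \<noteq> []"
  shows "homotopy (entwined_diff mulM psiM g) c Xs + entwined_diff mulM psiM (homotopy g) c Xs =
    g c Xs - trace_cochain (corner_cochain i1 g) c Xs"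
proof -
  have "entwined_diff mulM psiM g = (\<lambda>c Xs. wrap mulM psiM g c Xs - bar mulM (g c) Xs)"
    by (intro ext) (simp add: entwined_diff_def)
  then show ?thesis
    using homotopy_wrap[OF assms, of c] homotopy_bar[OF assms, of c]
    by (simp add: homotopy_diff entwined_diff_def algebra_simps)
qed

lemma twist_list_move_column:
  assumes "multilinear_cochain scaleM sC g"
  shows "twist_list psiM (\<lambda>c Xs. g c (map_last (move_column k) Xs)) c Xs =
    twist_list psiM g c (map_last (move_column k) Xs)"
  using assms
proof (induction Xs arbitrary: g c)
  case (Cons X Xs)
  show ?case
  proof (cases "Xs = []")
    case True
    have "bilinear_form scaleM sC (\<lambda>X c. g c [X])"
      using Cons.prems by (intro bilinear_formI) (auto simp: multilinear_cochain_iff multilinear_hd)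
    then show ?thesis using True by (simp add: twist_move_column)
  next
    case False
    have "twist_list psiM (\<lambda>c Xs. g c (map_last (move_column k) (X' # Xs))) c' Xs =
        twist_list psiM (\<lambda>c Xs. g c (X' # map_last (move_column k) Xs)) c' Xs" for X' c'
      by (rule twist_list_cong_length)
        (use False in \<open>auto simp: map_last_Cons simp flip: length_greater_0_conv\<close>)
    also have "\<dots> X' c' = twist_list psiM (\<lambda>c Xs. g c (X' # Xs)) c' (map_last (move_column k) Xs)" for X' c'
      by (rule Cons.IH[OF multilinear_cochain_Cons[OF Cons.prems]])
    finally show ?thesis using False by (simp add: map_last_Cons)
  qed
qed simp

lemma twist_list_row_unit:
  assumes "multilinear_cochain scaleM sC g"
  shows "twist_list psiM (\<lambda>c Xs. g c (first_row_unit q # Xs)) c Xs = twist_list psiM g c (first_row_unit q # Xs)"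
  by (simp add: twist_first_row_unit[OF M.bilinear_twist_list[OF assms]])

text \<open>The row unit is fixed by the entwining and \<open>corner_entry\<close> is a rearrangement of entries.\<close>

lemma twist_list_prefix_sum:
  assumes "multilinear_cochain scaleM sC g"
  shows "twist_list psiM (\<lambda>c. prefix_sum q (g c)) c Xs = prefix_sum q (twist_list psiM g c) Xs"
  using assms
proof (induction Xs arbitrary: q g c)
  case (Cons X Xs)
  have bil: "bilinear_form scaleM sC
      (\<lambda>A c'. prefix_sum l (twist_list psiM (\<lambda>c Ys. g c (A # Ys)) c') Xs)" for l
  proof (rule bilinear_formI)
    fix c'
    have "is_linear scaleM (*) (\<lambda>A. twist_list psiM (\<lambda>c Ys. g c (A # Ys)) c' Zs)" for Zs
      using Cons.prems by (intro twist_list_family) (auto simp: multilinear_cochain_iff multilinear_hd)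
    then show "is_linear scaleM (*) (\<lambda>A. prefix_sum l (twist_list psiM (\<lambda>c Ys. g c (A # Ys)) c') Xs)"
      by (rule functional_family[OF functional_prefix_sum])
  next
    fix A
    show "is_linear sC (*) (\<lambda>c'. prefix_sum l (twist_list psiM (\<lambda>c Ys. g c (A # Ys)) c') Xs)"
      by (intro functional_family[OF functional_prefix_sum] M.linear_C_twist_list
          multilinear_cochain_Cons Cons.prems)
  qed
  have "twist_list psiM (\<lambda>c. prefix_sum q (g c)) c (X # Xs) =
      twist psiM (\<lambda>X' c'. twist_list psiM (\<lambda>c Ys. g c (first_row_unit q # X' # Ys)) c' Xs) c X
      - (\<Sum>l\<in>UNIV. twist psiM (\<lambda>X' c'.
          twist_list psiM (\<lambda>c. prefix_sum l (\<lambda>Ys. g c (corner_entry q l X' # Ys))) c' Xs) c X)"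
    by (simp add: twist_list_diff twist_diff twist_list_sum twist_sum)
  also have "twist psiM (\<lambda>X' c'. twist_list psiM (\<lambda>c Ys. g c (first_row_unit q # X' # Ys)) c' Xs) c X =
      twist_list psiM g c (first_row_unit q # X # Xs)"
    using twist_list_row_unit[OF Cons.prems, of q c "X # Xs"] by simp
  also have "(\<Sum>l\<in>UNIV. twist psiM (\<lambda>X' c'.
          twist_list psiM (\<lambda>c. prefix_sum l (\<lambda>Ys. g c (corner_entry q l X' # Ys))) c' Xs) c X) =
      (\<Sum>l\<in>UNIV. prefix_sum l (\<lambda>Ys. twist_list psiM g c (corner_entry q l X # Ys)) Xs)"
    unfolding Cons.IH[OF multilinear_cochain_Cons[OF Cons.prems]]
      twist_corner_entry[OF bil, symmetric] twist_list_Cons functional_twist[OF functional_prefix_sum] ..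
  finally show ?case by simp
qed (simp add: twist_list_0)

lemma twist_list_homotopy:
  assumes "multilinear_cochain scaleM sC g"
  shows "twist_list psiM (homotopy g) c Xs = homotopy (twist_list psiM g) c Xs"
  unfolding homotopy_def[abs_def]
  by (simp add: twist_list_sum twist_list_move_column[OF multilinear_cochain_prefix_sum[OF assms]]
      twist_list_prefix_sum[OF assms])

end

section \<open>Cochain complexes and cochain maps\<close>

lemma vector_space_cscale: "vector_space (cscale :: 'k::field \<Rightarrow> ('c, 'a, 'k) cochain \<Rightarrow> _)"
  by unfold_locales (simp_all add: cscale_def fun_eq_iff algebra_simps)

lemma cscale_apply: "cscale k g c as = k * g c as"
  by (simp add: cscale_def)

lemma module_cscale: "module (cscale :: 'k::field \<Rightarrow> ('c, 'a, 'k) cochain \<Rightarrow> _)"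
  using vector_space_cscale by (simp add: module_iff_vector_space)

lemma subspace_cscaleI:
  assumes "0 \<in> V" "\<And>f g. f \<in> V \<Longrightarrow> g \<in> V \<Longrightarrow> f + g \<in> V" "\<And>k f. f \<in> V \<Longrightarrow> cscale k f \<in> V"
  shows "module.subspace cscale V"
  using assms by (simp add: module.subspace_def[OF module_cscale])

lemma multilinear_cochain_0: "multilinear_cochain sA sC 0"
  by (simp add: multilinear_cochain_def is_linear_zero_form)

lemma multilinear_cochain_plus:
  "multilinear_cochain sA sC f \<Longrightarrow> multilinear_cochain sA sC g \<Longrightarrow> multilinear_cochain sA sC (f + g)"
  by (simp add: multilinear_cochain_def is_linear_add_form)

lemma multilinear_cochain_cscale:
  "multilinear_cochain sA sC f \<Longrightarrow> multilinear_cochain sA sC (cscale k f)"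
  by (simp add: multilinear_cochain_def cscale_def is_linear_scaled_form)

lemma is_linear_cochain_value: "is_linear cscale (*) (\<lambda>g. g c as)"
  by (simp add: is_linear_def cscale_def)

text \<open>An operator on cochains is linear as soon as its value at each point is a linear functional.\<close>

lemma linear_map_onI:
  assumes "\<And>g. g \<in> V \<Longrightarrow> f g \<in> W" and "\<And>c as. is_linear cscale (*) (\<lambda>g. f g c as)"
  shows "linear_map_on cscale cscale V W f"
  using assms by (auto simp: linear_map_on_def is_linear_def cscale_def fun_eq_iff)

lemma functional_cochain:
  "is_linear fun_scale (*) \<Phi> \<Longrightarrow> is_linear cscale (*) (\<lambda>g. \<Phi> (g c))"
  by (rule functional_family[OF _ is_linear_cochain_value])

lemma is_linear_wrap: "is_linear cscale (*) (\<lambda>g. wrap mul psi g c as)"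
proof (cases as)
  case (Cons a xs)
  then show ?thesis
    by (cases "xs = []") (simp_all add: is_linear_zero_form twist_family is_linear_cochain_value)
qed (simp add: is_linear_zero_form)

lemma is_linear_entwined_diff: "is_linear cscale (*) (\<lambda>g. entwined_diff mul psi g c as)"
  unfolding entwined_diff_def
  by (intro is_linear_diff_form is_linear_wrap functional_cochain functional_bar)

lemma is_linear_trace: "is_linear cscale (*) (\<lambda>g. trace_cochain g c Xs)"
  unfolding trace_cochain_def
  by (intro is_linear_sum_form functional_cochain functional_path_sum)

lemma entwined_diff_length:
  assumes "\<And>c as. length as \<noteq> n + 1 \<Longrightarrow> g c as = 0" "length as \<noteq> n + 2"
  shows "entwined_diff mul psi g c as = 0"
proof -
  have "hoch_diff mul psi n g c as = 0" using assms(2) by (simp add: hoch_diff_def)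
  then show ?thesis by (simp add: hoch_diff_eq_entwined_diff[OF assms(1)])
qed

context entwined_algebra
begin

lemma hoch_cochains_mem:
  "g \<in> hoch_cochains sA sC n \<longleftrightarrow>
    multilinear_cochain sA sC g \<and> (\<forall>c as. length as \<noteq> n + 1 \<longrightarrow> g c as = 0)"
  by (rule hoch_cochains_iff[OF vector_space_A vector_space_C])

lemma inv_cochains_mem:
  "g \<in> inv_cochains sA sC psi n \<longleftrightarrow> g \<in> hoch_cochains sA sC n \<and> twist_list psi g = g"
proof -
  have "twist_list psi g c as = g c as"
    if "g \<in> hoch_cochains sA sC n" "length as \<noteq> n + 1" for c as
  proof -
    have "twist_list psi g c as = twist_list psi (\<lambda>c as. 0) c as"
      by (rule twist_list_cong_length) (use that in \<open>simp add: hoch_cochains_mem\<close>)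
    then show ?thesis using that by (simp add: twist_list_0 hoch_cochains_mem)
  qed
  then show ?thesis
    by (auto simp: inv_cochains_def twist_list_def eval_tensor_def fun_eq_iff)
      (metis (no_types, lifting))
qed

lemma hoch_diff_eq: "g \<in> hoch_cochains sA sC n \<Longrightarrow> hoch_diff mul psi n g = entwined_diff mul psi g"
  by (rule hoch_diff_eq_entwined_diff) (simp add: hoch_cochains_mem)

lemma entwined_diff_mem:
  "g \<in> hoch_cochains sA sC n \<Longrightarrow> entwined_diff mul psi g \<in> hoch_cochains sA sC (Suc n)"
  by (auto simp: hoch_cochains_mem multilinear_cochain_entwined_diff intro: entwined_diff_length[of n])

lemma entwined_diff_mem_inv:
  assumes "g \<in> inv_cochains sA sC psi n"
  shows "entwined_diff mul psi g \<in> inv_cochains sA sC psi (Suc n)"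
proof -
  have g: "g \<in> hoch_cochains sA sC n" and inv: "twist_list psi g = g"
    using assms by (auto simp: inv_cochains_mem)
  have "multilinear_cochain sA sC g" using g by (simp add: hoch_cochains_mem)
  from twist_list_entwined_diff[OF this] show ?thesis
    unfolding inv_cochains_mem inv using entwined_diff_mem[OF g] by blast
qed

end

lemma linear_map_on_hoch_diff:
  assumes "\<And>g. g \<in> V \<Longrightarrow> hoch_diff mul psi n g \<in> W"
  shows "linear_map_on cscale cscale V W (hoch_diff mul psi n)"
proof (rule linear_map_onI)
  fix c as
  show "is_linear cscale (*) (\<lambda>g. hoch_diff mul psi n g c as)"
  proof (cases "length as = n + 2")
    case True
    have "is_linear cscale (*) (\<lambda>g. eval_tensor (\<lambda>a' c'. g c' (butlast (tl as) @ [mul (last as) a']))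
          (rep (psi c (hd as))) +
        (\<Sum>i = 1..n + 1. (- 1) ^ i *
          g c (take (i - 1) as @ [mul (as ! (i - 1)) (as ! i)] @ drop (i + 1) as)))"
      by (intro is_linear_add_form eval_tensor_family is_linear_sum_form is_linear_scaled_form
          is_linear_cochain_value)
    then show ?thesis using True by (simp add: hoch_diff_def eval_tensor_def)
  qed (simp add: hoch_diff_def is_linear_zero_form)
qed (rule assms)

context entwined_algebra
begin

lemma cochain_complex_hoch_diff:
  assumes "\<And>n. V n \<subseteq> hoch_cochains sA sC n" and "\<And>n. module.subspace cscale (V n)"
    and "\<And>n g. g \<in> V n \<Longrightarrow> entwined_diff mul psi g \<in> V (Suc n)"
  shows "cochain_complex cscale \<lparr>obj = V, diff = hoch_diff mul psi\<rparr>"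
  unfolding cochain_complex_def
proof (intro conjI allI ballI)
  have eq: "hoch_diff mul psi n g = entwined_diff mul psi g" if "g \<in> V n" for g n
    using hoch_diff_eq that assms(1) by blast
  show "linear_map_on cscale cscale (obj \<lparr>obj = V, diff = hoch_diff mul psi\<rparr> n)
      (obj \<lparr>obj = V, diff = hoch_diff mul psi\<rparr> (Suc n)) (diff \<lparr>obj = V, diff = hoch_diff mul psi\<rparr> n)" for n
    using linear_map_on_hoch_diff[of "V n" mul psi n "V (Suc n)"] assms(3) by (simp add: eq)
  fix n g
  assume "g \<in> obj \<lparr>obj = V, diff = hoch_diff mul psi\<rparr> n"
  then have "g \<in> V n" by simp
  moreover from this have "multilinear_cochain sA sC g"
    using subsetD[OF assms(1)] by (simp add: hoch_cochains_mem)
  ultimately show "diff \<lparr>obj = V, diff = hoch_diff mul psi\<rparr> (Suc n)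
      (diff \<lparr>obj = V, diff = hoch_diff mul psi\<rparr> n g) = 0"
    using assms(3) by (simp add: eq fun_eq_iff entwined_diff_entwined_diff)
qed (use assms(2) vector_space_cscale in auto)

lemma subspace_hoch_cochains: "module.subspace cscale (hoch_cochains sA sC n)"
  by (rule subspace_cscaleI)
    (auto simp: hoch_cochains_mem multilinear_cochain_0 multilinear_cochain_plus
      multilinear_cochain_cscale, simp add: cscale_def)

lemma is_linear_twist_list: "is_linear cscale (*) (\<lambda>g. twist_list psi g c as)"
  by (intro twist_list_family is_linear_cochain_value)

lemma subspace_inv_cochains: "module.subspace cscale (inv_cochains sA sC psi n)"
proof (rule subspace_cscaleI)
  note sub = subspace_hoch_cochains[of n, unfolded module.subspace_def[OF module_cscale]]
  note lin = is_linearD[OF is_linear_twist_list] is_linear_0[OF is_linear_twist_list]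
  show "0 \<in> inv_cochains sA sC psi n"
    using sub by (simp add: inv_cochains_mem fun_eq_iff lin)
  show "f + g \<in> inv_cochains sA sC psi n"
    if "f \<in> inv_cochains sA sC psi n" "g \<in> inv_cochains sA sC psi n" for f g
    using sub that by (simp add: inv_cochains_mem fun_eq_iff lin)
  show "cscale k f \<in> inv_cochains sA sC psi n" if "f \<in> inv_cochains sA sC psi n" for f k
    using sub that by (simp add: inv_cochains_mem fun_eq_iff lin) (simp add: cscale_def)
qed

lemma cochain_complex_hochschild: "cochain_complex cscale (hochschild_complex sA mul sC psi)"
  unfolding hochschild_complex_def
  by (rule cochain_complex_hoch_diff) (simp_all add: subspace_hoch_cochains entwined_diff_mem)

lemma cochain_complex_invariant: "cochain_complex cscale (invariant_complex sA mul sC psi)"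
  unfolding invariant_complex_def
proof (rule cochain_complex_hoch_diff)
  show "inv_cochains sA sC psi n \<subseteq> hoch_cochains sA sC n" for n
    by (auto simp: inv_cochains_def)
qed (blast intro: subspace_inv_cochains entwined_diff_mem_inv)+

end

lemma inc_map_eq: "inc_map i = (\<lambda>n. corner_cochain i)"
  by (intro ext) (simp add: inc_map_def corner_cochain_def)

context matrix_entwining
begin

lemma corner_mem:
  "g \<in> hoch_cochains scaleM sC n \<Longrightarrow> corner_cochain i1 g \<in> hoch_cochains sA sC n"
  by (simp add: hoch_cochains_mem M.hoch_cochains_mem multilinear_cochain_corner)
    (simp add: corner_cochain_def)

lemma corner_mem_inv:
  "g \<in> inv_cochains scaleM sC psiM n \<Longrightarrow> corner_cochain i1 g \<in> inv_cochains sA sC psi n"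
  using twist_list_corner[of g i1] corner_mem[of g n]
  by (auto simp: inv_cochains_mem M.inv_cochains_mem M.hoch_cochains_mem intro!: ext)

lemma trace_mem:
  assumes "g \<in> hoch_cochains sA sC n"
  shows "trace_cochain g \<in> hoch_cochains scaleM sC n"
proof -
  have "path_sum p q (g c) Xs = path_sum p q (\<lambda>as. 0) Xs"
    if "length Xs \<noteq> n + 1" for p q c and Xs :: "('a^'n^'n) list"
    by (rule path_sum_cong_length) (use assms that in \<open>simp add: hoch_cochains_mem\<close>)
  then show ?thesis
    using assms by (simp add: hoch_cochains_mem M.hoch_cochains_mem multilinear_cochain_trace)
      (simp add: trace_cochain_def path_sum_0)
qed

lemma trace_mem_inv:
  "g \<in> inv_cochains sA sC psi n \<Longrightarrow> trace_cochain g \<in> inv_cochains scaleM sC psiM n"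
  using twist_list_trace[of g] trace_mem[of g n]
  by (auto simp: inv_cochains_mem M.inv_cochains_mem hoch_cochains_mem intro!: ext)

lemma cochain_map_corner:
  "cochain_map cscale cscale (hochschild_complex scaleM mulM sC psiM)
    (hochschild_complex sA mul sC psi) (inc_map i1)"
  "cochain_map cscale cscale (invariant_complex scaleM mulM sC psiM)
    (invariant_complex sA mul sC psi) (inc_map i1)"
proof -
  have lin: "is_linear cscale (*) (\<lambda>g. corner_cochain i1 g c as)" for c as
    unfolding corner_cochain_def by (rule is_linear_cochain_value)
  have comm: "corner_cochain i1 (hoch_diff mulM psiM n g) = hoch_diff mul psi n (corner_cochain i1 g)"
    if "g \<in> hoch_cochains scaleM sC n" for n g
    using that
    by (simp add: M.hoch_diff_eq hoch_diff_eq corner_mem fun_eq_iff corner_entwined_diff M.hoch_cochains_mem)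
  show "cochain_map cscale cscale (hochschild_complex scaleM mulM sC psiM)
      (hochschild_complex sA mul sC psi) (inc_map i1)"
    unfolding cochain_map_def inc_map_eq
    using M.cochain_complex_hochschild cochain_complex_hochschild
    by (auto simp: hochschild_complex_def comm intro!: linear_map_onI corner_mem lin)
  show "cochain_map cscale cscale (invariant_complex scaleM mulM sC psiM)
      (invariant_complex sA mul sC psi) (inc_map i1)"
    unfolding cochain_map_def inc_map_eq
    using M.cochain_complex_invariant cochain_complex_invariant
    by (auto simp: invariant_complex_def comm M.inv_cochains_mem
        intro!: linear_map_onI corner_mem_inv lin)
qed

lemma cochain_map_trace:
  "cochain_map cscale cscale (hochschild_complex sA mul sC psi)
    (hochschild_complex scaleM mulM sC psiM) tr_map"
  "cochain_map cscale cscale (invariant_complex sA mul sC psi)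
    (invariant_complex scaleM mulM sC psiM) tr_map"
proof -
  have comm: "trace_cochain (hoch_diff mul psi n g) = hoch_diff mulM psiM n (trace_cochain g)"
    if "g \<in> hoch_cochains sA sC n" for n g
    using that
    by (simp add: M.hoch_diff_eq hoch_diff_eq trace_mem fun_eq_iff trace_entwined_diff hoch_cochains_mem)
  show "cochain_map cscale cscale (hochschild_complex sA mul sC psi)
      (hochschild_complex scaleM mulM sC psiM) tr_map"
    unfolding cochain_map_def tr_map_eq
    using M.cochain_complex_hochschild cochain_complex_hochschild
    by (auto simp: hochschild_complex_def comm intro!: linear_map_onI trace_mem is_linear_trace)
  show "cochain_map cscale cscale (invariant_complex sA mul sC psi)
      (invariant_complex scaleM mulM sC psiM) tr_map"
    unfolding cochain_map_def tr_map_eq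
    using M.cochain_complex_invariant cochain_complex_invariant
    by (auto simp: invariant_complex_def comm inv_cochains_mem
        intro!: linear_map_onI trace_mem_inv is_linear_trace)
qed

section \<open>The homotopy equivalence\<close>

text \<open>In particular, for \<open>m = 0\<close> the homotopy vanishes, as there is nothing in degree \<open>-1\<close>.\<close>

lemma homotopy_vanishes:
  assumes "g \<in> hoch_cochains scaleM sC m" "length Xs \<noteq> m"
  shows "homotopy g c Xs = 0"
proof -
  have "prefix_sum k (g c) (map_last (move_column k) Xs) =
      prefix_sum k (\<lambda>Ys. 0) (map_last (move_column k) Xs)" for k
    by (rule prefix_sum_cong_length) (use assms in \<open>simp add: M.hoch_cochains_mem\<close>)
  then show ?thesis by (simp add: homotopy_def functional_0[OF functional_prefix_sum])
qed

lemma homotopy_mem: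
  "g \<in> hoch_cochains scaleM sC (Suc n) \<Longrightarrow> homotopy g \<in> hoch_cochains scaleM sC n"
  using homotopy_vanishes[of g "Suc n"]
  by (simp add: M.hoch_cochains_mem multilinear_cochain_homotopy)

lemma homotopy_mem_inv:
  "g \<in> inv_cochains scaleM sC psiM (Suc n) \<Longrightarrow> homotopy g \<in> inv_cochains scaleM sC psiM n"
  using twist_list_homotopy[of g] homotopy_mem[of g n]
  by (auto simp: M.inv_cochains_mem M.hoch_cochains_mem intro!: ext)

lemma is_linear_homotopy: "is_linear cscale (*) (\<lambda>g. homotopy g c Xs)"
  unfolding homotopy_def by (intro is_linear_sum_form functional_cochain functional_prefix_sum)

text \<open>
  The sign turns the formula for \<open>id - tr \<circ> inc\<close> into one for \<open>tr \<circ> inc - id\<close>. On the empty list,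
  which \<open>homotopy_formula\<close> excludes, all terms are zero.
\<close>

lemma trace_corner_minus_id:
  assumes "g \<in> hoch_cochains scaleM sC n"
  shows "trace_cochain (corner_cochain i1 g) - g =
    cscale (- 1) (homotopy (entwined_diff mulM psiM g)) + entwined_diff mulM psiM (cscale (- 1) (homotopy g))"
proof (intro ext)
  fix c Xs
  have neg: "entwined_diff mulM psiM (cscale (- 1) (homotopy g)) c Xs = - entwined_diff mulM psiM (homotopy g) c Xs"
    using is_linearD(2)[OF is_linear_entwined_diff[of mulM psiM c Xs], of "- 1"] by simp
  show "(trace_cochain (corner_cochain i1 g) - g) c Xs = (cscale (- 1) (homotopy (entwined_diff mulM psiM g))
      + entwined_diff mulM psiM (cscale (- 1) (homotopy g))) c Xs"
  proof (cases "Xs = []")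
    case True
    then show ?thesis using assms trace_mem[OF corner_mem[OF assms]]
      by (simp add: neg M.hoch_cochains_mem) (simp add: homotopy_def entwined_diff_def cscale_apply)
  next
    case False
    have "multilinear_cochain scaleM sC g" using assms by (simp add: M.hoch_cochains_mem)
    from homotopy_formula[OF this False, of c] show ?thesis
      by (simp add: neg cscale_apply algebra_simps)
  qed
qed

end

lemma cochain_map_mem: "cochain_map s1 s2 K L f \<Longrightarrow> x \<in> obj K n \<Longrightarrow> f n x \<in> obj L n"
  unfolding cochain_map_def linear_map_on_def by blast

lemma cochain_map_comp:
  assumes "cochain_map s1 s2 K L f" "cochain_map s2 s3 L N g"
  shows "cochain_map s1 s3 K N (\<lambda>n. g n \<circ> f n)"
proof -
  note mem = cochain_map_mem[OF assms(1)]
  have "linear_map_on s1 s3 (obj K n) (obj N n) (g n \<circ> f n)" for n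
  proof -
    have "linear_map_on s1 s2 (obj K n) (obj L n) (f n)" "linear_map_on s2 s3 (obj L n) (obj N n) (g n)"
      using assms by (simp_all add: cochain_map_def)
    then show ?thesis using mem unfolding linear_map_on_def image_subset_iff comp_def by metis
  qed
  then show ?thesis using assms mem by (simp add: cochain_map_def)
qed

lemma cochain_map_id: "cochain_complex s K \<Longrightarrow> cochain_map s s K K (\<lambda>n. id)"
  by (simp add: cochain_map_def linear_map_on_def)

context matrix_entwining
begin

theorem homotopy_inverses_corner_trace:
  "homotopy_inverses cscale cscale (invariant_complex scaleM mulM sC psiM)
    (invariant_complex sA mul sC psi) (inc_map i1) tr_map"
  unfolding homotopy_inverses_def
proof (intro conjI)
  let ?IM = "invariant_complex scaleM mulM sC psiM" and ?IA = "invariant_complex sA mul sC psi"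
  let ?h = "\<lambda>(n :: nat) g. cscale (- 1) (homotopy g)"
  note inc = cochain_map_corner(2) and tr = cochain_map_trace(2)
  have IM_sub: "cscale k g \<in> inv_cochains scaleM sC psiM n" if "g \<in> inv_cochains scaleM sC psiM n" for k g n
    using M.subspace_inv_cochains[of n] that by (simp add: module.subspace_def[OF module_cscale])
  have h_lin: "linear_map_on cscale cscale (obj ?IM (Suc n)) (obj ?IM n) (?h n)" for n
  proof (rule linear_map_onI)
    show "is_linear cscale (*) (\<lambda>g. cscale (- 1) (homotopy g) c Xs)" for c Xs
      unfolding cscale_def[of "- 1"] by (intro is_linear_scaled_form is_linear_homotopy)
  qed (simp add: invariant_complex_def homotopy_mem_inv IM_sub)
  have h_0: "(tr_map 0 \<circ> inc_map i1 0) g - id g = ?h 0 (diff ?IM 0 g)" if "g \<in> obj ?IM 0" for g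
  proof -
    have g: "g \<in> hoch_cochains scaleM sC 0"
      using that by (simp add: invariant_complex_def M.inv_cochains_mem)
    have "homotopy g c Xs = 0" for c Xs
      using homotopy_vanishes[OF g, of Xs c] by (cases Xs) (simp_all add: homotopy_def)
    then have "cscale (- 1) (homotopy g) = 0" by (simp add: fun_eq_iff cscale_def)
    moreover have "entwined_diff mulM psiM 0 = (0 :: ('c, 'a^'n^'n, 'k) cochain)"
      by (intro ext) (simp add: is_linear_0[OF is_linear_entwined_diff])
    ultimately show ?thesis
      using trace_corner_minus_id[OF g]
      by (simp add: invariant_complex_def M.hoch_diff_eq[OF g] tr_map_eq inc_map_eq)
  qed
  have h_Suc: "(tr_map (Suc n) \<circ> inc_map i1 (Suc n)) g - id g =
      ?h (Suc n) (diff ?IM (Suc n) g) + diff ?IM n (?h n g)" if "g \<in> obj ?IM (Suc n)" for n g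
  proof -
    have g: "g \<in> inv_cochains scaleM sC psiM (Suc n)"
      using that by (simp add: invariant_complex_def)
    then have "cscale (- 1) (homotopy g) \<in> hoch_cochains scaleM sC n"
      using IM_sub[OF homotopy_mem_inv] by (simp add: M.inv_cochains_mem)
    then show ?thesis
      using trace_corner_minus_id[of g "Suc n"] g
      by (simp add: invariant_complex_def M.hoch_diff_eq M.inv_cochains_mem tr_map_eq inc_map_eq)
  qed
  show "cochain_homotopic cscale cscale ?IM ?IM (\<lambda>n. tr_map n \<circ> inc_map i1 n) (\<lambda>n. id)"
    unfolding cochain_homotopic_def
    using cochain_map_comp[OF inc tr] cochain_map_id[OF M.cochain_complex_invariant] h_lin h_0 h_Suc
    by (intro conjI exI[where x = ?h]) blast+
  have id: "(inc_map i1 n \<circ> tr_map n) g = g" if "g \<in> obj ?IA n" for n g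
  proof -
    have g: "g \<in> hoch_cochains sA sC n"
      using that by (simp add: invariant_complex_def inv_cochains_mem)
    have "corner_cochain i1 (trace_cochain g) c as = g c as" for c as
      using g corner_trace[of g as i1 c] corner_mem[OF trace_mem[OF g]]
      by (cases "as = []") (simp_all add: hoch_cochains_mem)
    then show ?thesis by (simp add: inc_map_eq tr_map_eq fun_eq_iff)
  qed
  have "linear_map_on cscale cscale (obj ?IA (Suc n)) (obj ?IA n) (\<lambda>g. 0)" for n
    using subspace_inv_cochains[of n]
    by (auto simp: linear_map_on_def invariant_complex_def module.subspace_def[OF module_cscale]
        cscale_def fun_eq_iff)
  moreover have "diff ?IA n 0 = 0" for n
    by (auto simp: invariant_complex_def hoch_diff_def fun_eq_iff lin_ext_def)
  ultimately show "cochain_homotopic cscale cscale ?IA ?IA (\<lambda>n. inc_map i1 n \<circ> tr_map n) (\<lambda>n. id)"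
    unfolding cochain_homotopic_def
    using cochain_map_comp[OF tr inc] cochain_map_id[OF cochain_complex_invariant] id
    by (intro conjI exI[where x = "\<lambda>n g. 0"]) auto
qed (rule cochain_map_corner cochain_map_trace)+

end

section \<open>Homotopy inverses induce isomorphisms on cohomology\<close>

lemma linear_map_on_diff:
  assumes "linear_map_on s1 s2 V W f" "x \<in> V" "y \<in> V" "x - y \<in> V"
  shows "f (x - y) = f x - f y"
proof -
  have "f (x - y + y) = f (x - y) + f y"
    using assms unfolding linear_map_on_def by blast
  then show ?thesis by (simp add: algebra_simps)
qed

lemma cochain_complex_subspaceD:
  assumes "cochain_complex s K"
  shows "0 \<in> obj K n" "x \<in> obj K n \<Longrightarrow> y \<in> obj K n \<Longrightarrow> x - y \<in> obj K n"
proof -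
  interpret vector_space s using assms by (simp add: cochain_complex_def)
  have "subspace (obj K n)" using assms by (simp add: cochain_complex_def)
  then show "0 \<in> obj K n" "x \<in> obj K n \<Longrightarrow> y \<in> obj K n \<Longrightarrow> x - y \<in> obj K n"
    by (rule subspace_0, rule subspace_diff)
qed

lemma cochain_complex_diffD:
  assumes "cochain_complex s K"
  shows "x \<in> obj K n \<Longrightarrow> y \<in> obj K n \<Longrightarrow> diff K n (x - y) = diff K n x - diff K n y"
    and "diff K n 0 = 0"
proof -
  have lin: "linear_map_on s s (obj K n) (obj K (Suc n)) (diff K n)"
    using assms by (simp add: cochain_complex_def)
  show *: "x \<in> obj K n \<Longrightarrow> y \<in> obj K n \<Longrightarrow> diff K n (x - y) = diff K n x - diff K n y" for x y
    using linear_map_on_diff[OF lin] cochain_complex_subspaceD[OF assms] by blast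
  show "diff K n 0 = 0" using *[of 0 0] cochain_complex_subspaceD[OF assms] by simp
qed

lemma coboundaries_0:
  assumes "cochain_complex s K"
  shows "0 \<in> coboundaries K n"
  using cochain_complex_subspaceD(1)[OF assms] cochain_complex_diffD(2)[OF assms]
  by (auto simp: coboundaries_def intro!: image_eqI[of 0 _ 0] split: nat.split)

lemma coboundaries_diff:
  assumes "cochain_complex s K" "x \<in> coboundaries K n" "y \<in> coboundaries K n"
  shows "x - y \<in> coboundaries K n"
proof (cases n)
  case (Suc m)
  then obtain u v where "u \<in> obj K m" "x = diff K m u" "v \<in> obj K m" "y = diff K m v"
    using assms(2,3) by (auto simp: coboundaries_def)
  then show ?thesis
    using Suc cochain_complex_subspaceD(2)[OF assms(1)] cochain_complex_diffD(1)[OF assms(1)]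
    by (auto simp: coboundaries_def intro!: image_eqI[of _ _ "u - v"])
qed (use assms in \<open>auto simp: coboundaries_def\<close>)

lemma equiv_cohomologous:
  assumes "cochain_complex s K"
  shows "equiv (cocycles K n) (cohomologous K n)"
proof (rule equivI)
  show "cohomologous K n \<subseteq> cocycles K n \<times> cocycles K n" by (auto simp: cohomologous_def)
  show "refl_on (cocycles K n) (cohomologous K n)"
    by (auto simp: refl_on_def cohomologous_def coboundaries_0[OF assms])
  show "sym (cohomologous K n)"
  proof (rule symI)
    fix x y
    assume "(x, y) \<in> cohomologous K n"
    then show "(y, x) \<in> cohomologous K n"
      using coboundaries_diff[OF assms coboundaries_0[OF assms], of "x - y" n]
      by (simp add: cohomologous_def)
  qed
  show "trans (cohomologous K n)"
  proof (rule transI)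
    fix x y z
    assume xy: "(x, y) \<in> cohomologous K n" and yz: "(y, z) \<in> cohomologous K n"
    have "0 - (y - z) \<in> coboundaries K n"
      using coboundaries_diff[OF assms coboundaries_0[OF assms], of "y - z" n] yz by (simp add: cohomologous_def)
    then have "(x - y) - (0 - (y - z)) \<in> coboundaries K n"
      using coboundaries_diff[OF assms, of "x - y" n "0 - (y - z)"] xy by (simp add: cohomologous_def)
    then show "(x, z) \<in> cohomologous K n" using xy yz by (simp add: cohomologous_def)
  qed
qed

lemma cochain_map_cocycle:
  assumes "cochain_map s1 s2 K L f" "x \<in> cocycles K n"
  shows "f n x \<in> cocycles L n"
proof -
  have x: "x \<in> obj K n" "diff K n x = 0" using assms(2) by (auto simp: cocycles_def)
  have lin: "linear_map_on s1 s2 (obj K (Suc n)) (obj L (Suc n)) (f (Suc n))"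
    using assms(1) by (simp add: cochain_map_def)
  have K: "cochain_complex s1 K" using assms(1) by (simp add: cochain_map_def)
  have "f (Suc n) 0 = 0"
    using linear_map_on_diff[OF lin, of 0 0] cochain_complex_subspaceD(1)[OF K] by simp
  moreover have "f (Suc n) (diff K n x) = diff L n (f n x)"
    using assms(1) x(1) by (simp add: cochain_map_def)
  ultimately show ?thesis
    using cochain_map_mem[OF assms(1) x(1)] x(2) by (simp add: cocycles_def)
qed

lemma cochain_map_cohomologous:
  assumes f: "cochain_map s1 s2 K L f" and xy: "(x, y) \<in> cohomologous K n"
  shows "(f n x, f n y) \<in> cohomologous L n"
proof -
  have K: "cochain_complex s1 K" using f by (simp add: cochain_map_def)
  have lin: "linear_map_on s1 s2 (obj K n) (obj L n) (f n)" for n using f by (simp add: cochain_map_def)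
  have x: "x \<in> cocycles K n" and y: "y \<in> cocycles K n" and d: "x - y \<in> coboundaries K n"
    using xy by (auto simp: cohomologous_def)
  have "f n (x - y) = f n x - f n y"
    using linear_map_on_diff[OF lin] x y cochain_complex_subspaceD(2)[OF K] by (auto simp: cocycles_def)
  moreover have "f n (x - y) \<in> coboundaries L n"
  proof (cases n)
    case 0
    have "f 0 0 = 0" using linear_map_on_diff[OF lin, of 0 0 0] cochain_complex_subspaceD(1)[OF K] by simp
    then show ?thesis using 0 d by (simp add: coboundaries_def)
  next
    case (Suc m)
    then obtain z where z: "z \<in> obj K m" "x - y = diff K m z" using d by (auto simp: coboundaries_def)
    then have "f n (x - y) = diff L m (f m z)" using f Suc by (simp add: cochain_map_def)
    moreover have "f m z \<in> obj L m" using lin[of m] z by (auto simp: linear_map_on_def)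
    ultimately show ?thesis using Suc by (simp add: coboundaries_def)
  qed
  ultimately show ?thesis
    using cochain_map_cocycle[OF f] x y by (simp add: cohomologous_def)
qed

lemma cohomology_map_class:
  assumes f: "cochain_map s1 s2 K L f" and x: "x \<in> cocycles K n"
  shows "cohomology_map L f n (cohomologous K n `` {x}) = cohomologous L n `` {f n x}"
proof -
  have K: "cochain_complex s1 K" and L: "cochain_complex s2 L" using f by (auto simp: cochain_map_def)
  have "(x, x) \<in> cohomologous K n"
    using x coboundaries_0[OF K] by (simp add: cohomologous_def)
  moreover have "cohomologous L n `` {f n y} = cohomologous L n `` {f n x}"
    if "(x, y) \<in> cohomologous K n" for y
    using equiv_class_eq[OF equiv_cohomologous[OF L] cochain_map_cohomologous[OF f that]] by simp
  ultimately show ?thesis unfolding cohomology_map_def by blast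
qed

lemma cohomologous_if_homotopic:
  assumes h: "cochain_homotopic s1 s2 K L f g" and x: "x \<in> cocycles K n"
  shows "(f n x, g n x) \<in> cohomologous L n"
proof -
  have f: "cochain_map s1 s2 K L f" and g: "cochain_map s1 s2 K L g"
    using h by (auto simp: cochain_homotopic_def)
  have K: "cochain_complex s1 K" and L: "cochain_complex s2 L" using f by (auto simp: cochain_map_def)
  obtain h where lin: "\<And>n. linear_map_on s1 s2 (obj K (Suc n)) (obj L n) (h n)"
    and h0: "\<And>x. x \<in> obj K 0 \<Longrightarrow> f 0 x - g 0 x = h 0 (diff K 0 x)"
    and hS: "\<And>n x. x \<in> obj K (Suc n) \<Longrightarrow>
      f (Suc n) x - g (Suc n) x = h (Suc n) (diff K (Suc n) x) + diff L n (h n x)"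
    using h unfolding cochain_homotopic_def by blast
  have z: "h n 0 = 0" for n
    using linear_map_on_diff[OF lin, of 0 n 0] cochain_complex_subspaceD(1)[OF K] by simp
  have "f n x - g n x \<in> coboundaries L n"
  proof (cases n)
    case 0
    then show ?thesis using h0[of x] x z by (simp add: cocycles_def coboundaries_def)
  next
    case (Suc m)
    have "h m x \<in> obj L m" using lin[of m] x Suc by (auto simp: linear_map_on_def cocycles_def)
    then show ?thesis using hS[of x m] x z Suc by (auto simp: cocycles_def coboundaries_def)
  qed
  then show ?thesis
    using cochain_map_cocycle[OF f x] cochain_map_cocycle[OF g x] by (simp add: cohomologous_def)
qed

lemma homotopic_id_on_cohomology:
  assumes f: "cochain_map s1 s2 K L f" and g: "cochain_map s2 s1 L K g"
    and h: "cochain_homotopic s1 s1 K K (\<lambda>n. g n \<circ> f n) (\<lambda>n. id)" and X: "X \<in> cohomology K n"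
  shows "cohomology_map L f n X \<in> cohomology L n" (is ?mem)
    and "cohomology_map K g n (cohomology_map L f n X) = X" (is ?inv)
proof -
  have K: "cochain_complex s1 K" using f by (simp add: cochain_map_def)
  obtain x where x: "x \<in> cocycles K n" "X = cohomologous K n `` {x}"
    using X by (auto simp: cohomology_def elim: quotientE)
  have fx: "f n x \<in> cocycles L n" by (rule cochain_map_cocycle[OF f x(1)])
  show ?mem
    unfolding x(2) cohomology_map_class[OF f x(1)] cohomology_def by (rule quotientI[OF fx])
  have "(g n (f n x), x) \<in> cohomologous K n"
    using cohomologous_if_homotopic[OF h x(1)] by simp
  then show ?inv
    unfolding x(2) cohomology_map_class[OF f x(1)] cohomology_map_class[OF g fx]
    by (rule equiv_class_eq[OF equiv_cohomologous[OF K]])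
qed

theorem quasi_isomorphism_if_homotopy_inverses:
  assumes "homotopy_inverses s1 s2 K L f g"
  shows "quasi_isomorphism s1 s2 K L f" and "quasi_isomorphism s2 s1 L K g"
proof -
  note h = assms[unfolded homotopy_inverses_def]
  note KL = homotopic_id_on_cohomology[of s1 s2 K L f g] and LK = homotopic_id_on_cohomology[of s2 s1 L K g f]
  have "bij_betw (cohomology_map L f n) (cohomology K n) (cohomology L n)" for n
    by (rule bij_betw_byWitness[where f' = "cohomology_map K g n"]) (use h KL LK in auto)
  moreover have "bij_betw (cohomology_map K g n) (cohomology L n) (cohomology K n)" for n
    by (rule bij_betw_byWitness[where f' = "cohomology_map L f n"]) (use h KL LK in auto)
  ultimately show "quasi_isomorphism s1 s2 K L f" and "quasi_isomorphism s2 s1 L K g"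
    using h by (simp_all add: quasi_isomorphism_def)
qed

lemma (in entwining_structure) matrix_entwining: "matrix_entwining sA mul sC psi one"
  by (intro matrix_entwining.intro entwined_algebra matrix_entwining_axioms.intro)
    (simp_all add: A.mul_one_left A.mul_one_right twist_one)


theorem proposition6p3:
  fixes sA :: "'k::field \<Rightarrow> 'a::ab_group_add \<Rightarrow> 'a"
    and mul :: "'a \<Rightarrow> 'a \<Rightarrow> 'a" and one :: 'a
    and sC :: "'k \<Rightarrow> 'c::ab_group_add \<Rightarrow> 'c"
    and Delta :: "'c \<Rightarrow> ('c \<times> 'c \<Rightarrow>\<^sub>0 'k) set" and eps :: "'c \<Rightarrow> 'k"
    and psi :: "'c \<Rightarrow> 'a \<Rightarrow> ('a \<times> 'c \<Rightarrow>\<^sub>0 'k) set"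
    and i1 :: "'n::finite"
  assumes "entwining_structure sA mul one sC Delta eps psi"
  shows
    "let psiM = psi_mat sA sC psi :: 'c \<Rightarrow> 'a^'n^'n \<Rightarrow> (('a^'n^'n) \<times> 'c \<Rightarrow>\<^sub>0 'k) set;
         CA = hochschild_complex sA mul sC psi;
         CM = hochschild_complex (mat_scale sA) (mat_mul mul) sC psiM;
         IA = invariant_complex sA mul sC psi;
         IM = invariant_complex (mat_scale sA) (mat_mul mul) sC psiM;
         inc = inc_map i1;
         tr = tr_map
     in cochain_map cscale cscale CM CA inc \<and>
        cochain_map cscale cscale CA CM tr \<and>
        cochain_map cscale cscale IM IA inc \<and>
        cochain_map cscale cscale IA IM tr \<and>
        homotopy_inverses cscale cscale IM IA inc tr \<and>
        quasi_isomorphism cscale cscale IM IA inc \<and>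
        quasi_isomorphism cscale cscale IA IM tr"
proof -
  interpret entwining_structure sA mul one sC Delta eps psi by (rule assms)
  interpret matrix_entwining sA mul sC psi one i1 by (rule matrix_entwining)
  note equivalence = homotopy_inverses_corner_trace
  show ?thesis
    unfolding Let_def
    by (intro conjI cochain_map_corner cochain_map_trace equivalence
        quasi_isomorphism_if_homotopy_inverses[OF equivalence])
qed

end
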